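(* The construction that sends a category with a comonad $(\mathsf{C},Q)$ to the forgetful functor $U_Q:\mathsf{Cog}_{\mathsf{C}}(Q)\to \mathsf{C}$ canonically induces a 2-functor from $\mathsf{Comonads}$ to $\mathsf{Functors}$ that is strictly fully faithful and that preserves strict finite products.
   Context: Categories are taken in a fixed universe; $\mathsf{Cats}$ is the strict 2-category of these categories, functors and natural transformations. A strict 2-category is a category enriched in categories and a 2-functor is a (strict) enriched functor. $\mathsf{Comonads}$ is the following strict 2-category. Objects: pairs $(\mathsf{C},Q)$ of a category and a comonad $(Q, w_Q:Q\to QQ, n_Q:Q\to \mathrm{Id})$ on it. Morphisms $(\mathsf{C},Q)\to(\mathsf{D},R)$: oplax comonad functors, i.e. pairs $(F,A)$ of a functor $F:\mathsf{C}\to\mathsf{D}$ and a natural transformation $A:FQ\to RF$ such that $(w_RF)\circ A=(RA)\circ(AQ)\circ(Fw_Q)$ as maps $FQ\to RRF$, and $(n_RF)\circ A=Fn_Q$. 2-morphisms $(F,A)\to(F',A')$: natural transformations $a:F\to F'$ such that $(Ra)\circ A=A'\circ(aQ)$. Composition of morphisms is $(G,B)\circ(F,A)=(GF,(BF)\circ(GA))$. $\mathsf{Functors}$ is the following strict 2-category. Objects: functors $F:\mathsf{C}\to\mathsf{D}$ between categories. Morphisms from $F_1:\mathsf{C}_1\to\mathsf{D}_1$ to $F_2:\mathsf{C}_2\to\mathsf{D}_2$: pairs of functors $(S:\mathsf{C}_1\to\mathsf{C}_2,\,T:\mathsf{D}_1\to\mathsf{D}_2)$ with $F_2S=TF_1$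 strictly. 2-morphisms $(S_1,T_1)\to(S_2,T_2)$: pairs of natural transformations $A_S:S_1\to S_2$, $A_T:T_1\to T_2$ with $A_TF_1=F_2A_S$. $\mathsf{Cog}_{\mathsf{C}}(Q)$ is the category of $Q$-coalgebras. The induced action on morphisms sends $(F,A):(\mathsf{C},Q)\to(\mathsf{D},R)$ to the pair $(F_{cog},F)$, where $F_{cog}(V)$ is $F(V)$ with coaction $F(V)\to FQ(V)\xrightarrow{A}RF(V)$, and it sends a 2-morphism $a$ to the pair whose component on underlying categories is $a$ and whose component on coalgebras has underlying map $a(V):F(V)\to F'(V)$. A 2-functor $\Phi:\mathsf{A}\to\mathsf{B}$ is strictly fully faithful if each functor $\mathsf{A}(X,Y)\to\mathsf{B}(\Phi X,\Phi Y)$ is an isomorphism of categories. A strict product of $X,Y$ in a strict 2-category is an object $X\times Y$ with projections such that $\mathsf{A}(Z,X\times Y)\to\mathsf{A}(Z,X)\times\mathsf{A}(Z,Y)$ is an isomorphism of categories for all $Z$; a strict final object $\ast$ is one with $\mathsf{A}(Z,\ast)$ isomorphic to the one-point category for all $Z$. Both $\mathsf{Comonads}$ and $\mathsf{Functors}$ have strict finite products. A 2-functor preserves strict finite products if the canonical morphisms $\Phi(X\times Y)\to\Phi(X)\times\Phi(Y)$ and $\Phi(\ast)\to\ast$ are isomorphisms. *)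

theory Defs
  imports Main "HOL-Library.FuncSet"
begin

section \<open>Categories, functors, natural transformations\<close>

text \<open>All structure maps are extensional (undefined off their domain), so that HOL equality of
  functors and of natural transformations is equality of the mathematical data.\<close>

record ('o, 'm) category =
  Obj :: "'o set"
  Arr :: "'m set"
  Dom :: "'m \<Rightarrow> 'o"
  Cod :: "'m \<Rightarrow> 'o"
  Idn :: "'o \<Rightarrow> 'm"
  Comp :: "'m \<Rightarrow> 'm \<Rightarrow> 'm"  (infixl "\<cdot>\<index>" 70)

locale category =
  fixes C :: "('o, 'm) category" (structure)
  assumes Dom_in: "Dom C \<in> Arr C \<rightarrow>\<^sub>E Obj C"
    and Cod_in: "Cod C \<in> Arr C \<rightarrow>\<^sub>E Obj C"
    and Idn_in: "Idn C \<in> Obj C \<rightarrow>\<^sub>E Arr C"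
    and Dom_Idn: "x \<in> Obj C \<Longrightarrow> Dom C (Idn C x) = x"
    and Cod_Idn: "x \<in> Obj C \<Longrightarrow> Cod C (Idn C x) = x"
    and Comp_in: "\<lbrakk>f \<in> Arr C; g \<in> Arr C; Dom C g = Cod C f\<rbrakk> \<Longrightarrow> g \<cdot> f \<in> Arr C"
    and Dom_Comp: "\<lbrakk>f \<in> Arr C; g \<in> Arr C; Dom C g = Cod C f\<rbrakk> \<Longrightarrow> Dom C (g \<cdot> f) = Dom C f"
    and Cod_Comp: "\<lbrakk>f \<in> Arr C; g \<in> Arr C; Dom C g = Cod C f\<rbrakk> \<Longrightarrow> Cod C (g \<cdot> f) = Cod C g"
    and Comp_undefined:
      "\<not> (f \<in> Arr C \<and> g \<in> Arr C \<and> Dom C g = Cod C f) \<Longrightarrow> g \<cdot> f = undefined"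
    and Comp_Idn: "f \<in> Arr C \<Longrightarrow> f \<cdot> Idn C (Dom C f) = f"
    and Idn_Comp: "f \<in> Arr C \<Longrightarrow> Idn C (Cod C f) \<cdot> f = f"
    and Comp_assoc:
      "\<lbrakk>f \<in> Arr C; g \<in> Arr C; h \<in> Arr C; Dom C g = Cod C f; Dom C h = Cod C g\<rbrakk>
        \<Longrightarrow> (h \<cdot> g) \<cdot> f = h \<cdot> (g \<cdot> f)"

record ('o, 'm, 'p, 'n) cfunctor =
  FOb :: "'o \<Rightarrow> 'p"
  FAr :: "'m \<Rightarrow> 'n"

locale is_functor =
  source: category C + target: category D
  for C :: "('o, 'm) category" and D :: "('p, 'n) category" +
  fixes F :: "('o, 'm, 'p, 'n) cfunctor"
  assumes FOb_in: "FOb F \<in> Obj C \<rightarrow>\<^sub>E Obj D"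
    and FAr_in: "FAr F \<in> Arr C \<rightarrow>\<^sub>E Arr D"
    and Dom_FAr: "f \<in> Arr C \<Longrightarrow> Dom D (FAr F f) = FOb F (Dom C f)"
    and Cod_FAr: "f \<in> Arr C \<Longrightarrow> Cod D (FAr F f) = FOb F (Cod C f)"
    and FAr_Idn: "x \<in> Obj C \<Longrightarrow> FAr F (Idn C x) = Idn D (FOb F x)"
    and FAr_Comp: "\<lbrakk>f \<in> Arr C; g \<in> Arr C; Dom C g = Cod C f\<rbrakk>
        \<Longrightarrow> FAr F (g \<cdot>\<^bsub>C\<^esub> f) = FAr F g \<cdot>\<^bsub>D\<^esub> FAr F f"

definition fidentity :: "('o, 'm) category \<Rightarrow> ('o, 'm, 'o, 'm) cfunctor" where
  "fidentity C = \<lparr>FOb = (\<lambda>x\<in>Obj C. x), FAr = (\<lambda>f\<in>Arr C. f)\<rparr>"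

text \<open>\<open>fcompose C G F\<close> is the composite \<open>G F\<close>, where \<open>C\<close> is the source of \<open>F\<close>.\<close>

definition fcompose ::
  "('o, 'm) category \<Rightarrow> ('p, 'n, 'q, 'l) cfunctor \<Rightarrow> ('o, 'm, 'p, 'n) cfunctor
    \<Rightarrow> ('o, 'm, 'q, 'l) cfunctor" where
  "fcompose C G F =
    \<lparr>FOb = compose (Obj C) (FOb G) (FOb F), FAr = compose (Arr C) (FAr G) (FAr F)\<rparr>"

definition iso_of_categories ::
  "('o, 'm) category \<Rightarrow> ('p, 'n) category \<Rightarrow> ('o, 'm, 'p, 'n) cfunctor \<Rightarrow> bool" where
  "iso_of_categories C D F \<longleftrightarrow> is_functor C D F \<and>
    (\<exists>G. is_functor D C G \<and> fcompose C G F = fidentity C \<and> fcompose D F G = fidentity D)"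

locale nat_trans =
  source: is_functor C D F + target: is_functor C D G
  for C :: "('o, 'm) category" and D :: "('p, 'n) category"
    and F :: "('o, 'm, 'p, 'n) cfunctor" and G :: "('o, 'm, 'p, 'n) cfunctor" +
  fixes a :: "'o \<Rightarrow> 'n"
  assumes component_in: "a \<in> Obj C \<rightarrow>\<^sub>E Arr D"
    and Dom_component: "x \<in> Obj C \<Longrightarrow> Dom D (a x) = FOb F x"
    and Cod_component: "x \<in> Obj C \<Longrightarrow> Cod D (a x) = FOb G x"
    and naturality:
      "f \<in> Arr C \<Longrightarrow> a (Cod C f) \<cdot>\<^bsub>D\<^esub> FAr F f = FAr G f \<cdot>\<^bsub>D\<^esub> a (Dom C f)"

definition nt_identity ::
  "('o, 'm) category \<Rightarrow> ('p, 'n) category \<Rightarrow> ('o, 'm, 'p, 'n) cfunctor \<Rightarrow> 'o \<Rightarrow> 'n" where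
  "nt_identity C D F = (\<lambda>x\<in>Obj C. Idn D (FOb F x))"

definition nt_vcomp ::
  "('o, 'm) category \<Rightarrow> ('p, 'n) category \<Rightarrow> ('o \<Rightarrow> 'n) \<Rightarrow> ('o \<Rightarrow> 'n) \<Rightarrow> 'o \<Rightarrow> 'n" where
  "nt_vcomp C D b a = (\<lambda>x\<in>Obj C. b x \<cdot>\<^bsub>D\<^esub> a x)"

text \<open>Horizontal composite of \<open>a : F \<rightarrow> F'\<close> and \<open>b : G \<rightarrow> G'\<close>, where \<open>C\<close> is the source of \<open>F\<close> and
  \<open>E\<close> the target of \<open>G\<close>: the component at \<open>x\<close> is \<open>G F x \<rightarrow> G F' x \<rightarrow> G' F' x\<close>.\<close>

definition nt_hcomp ::
  "('o, 'm) category \<Rightarrow> ('q, 'l) category \<Rightarrow> ('p, 'n, 'q, 'l) cfunctor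
    \<Rightarrow> ('o, 'm, 'p, 'n) cfunctor \<Rightarrow> ('p \<Rightarrow> 'l) \<Rightarrow> ('o \<Rightarrow> 'n) \<Rightarrow> 'o \<Rightarrow> 'l" where
  "nt_hcomp C E G F' b a = (\<lambda>x\<in>Obj C. b (FOb F' x) \<cdot>\<^bsub>E\<^esub> FAr G (a x))"

definition prod_category ::
  "('o, 'm) category \<Rightarrow> ('p, 'n) category \<Rightarrow> ('o \<times> 'p, 'm \<times> 'n) category" where
  "prod_category C D =
    \<lparr>Obj = Obj C \<times> Obj D,
     Arr = Arr C \<times> Arr D,
     Dom = (\<lambda>(f, g)\<in>Arr C \<times> Arr D. (Dom C f, Dom D g)),
     Cod = (\<lambda>(f, g)\<in>Arr C \<times> Arr D. (Cod C f, Cod D g)),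
     Idn = (\<lambda>(x, y)\<in>Obj C \<times> Obj D. (Idn C x, Idn D y)),
     Comp = (\<lambda>(f', g') (f, g).
        if f \<in> Arr C \<and> f' \<in> Arr C \<and> Dom C f' = Cod C f \<and>
           g \<in> Arr D \<and> g' \<in> Arr D \<and> Dom D g' = Cod D g
        then (f' \<cdot>\<^bsub>C\<^esub> f, g' \<cdot>\<^bsub>D\<^esub> g) else undefined)\<rparr>"

definition one_category :: "(unit, unit) category" where
  "one_category = \<lparr>Obj = {()}, Arr = {()}, Dom = (\<lambda>_. ()), Cod = (\<lambda>_. ()),
     Idn = (\<lambda>_. ()), Comp = (\<lambda>_ _. ())\<rparr>"

text \<open>The category with object set \<open>S\<close> whose morphisms \<open>x \<rightarrow> y\<close> are the elements of \<open>H x y\<close>,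
  tagged with source and target.\<close>

datatype ('f, 't) arrow = Arrow (src: 'f) (tgt: 'f) (under: 't)

definition arrow_category ::
  "'f set \<Rightarrow> ('f \<Rightarrow> 'f \<Rightarrow> 't set) \<Rightarrow> ('f \<Rightarrow> 't) \<Rightarrow> ('t \<Rightarrow> 't \<Rightarrow> 't)
    \<Rightarrow> ('f, ('f, 't) arrow) category" where
  "arrow_category S H i c =
    (let A = {a. src a \<in> S \<and> tgt a \<in> S \<and> under a \<in> H (src a) (tgt a)} in
    \<lparr>Obj = S,
     Arr = A,
     Dom = (\<lambda>a\<in>A. src a),
     Cod = (\<lambda>a\<in>A. tgt a),
     Idn = (\<lambda>x\<in>S. Arrow x x (i x)),
     Comp = (\<lambda>b a. if a \<in> A \<and> b \<in> A \<and> src b = tgt a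
        then Arrow (src a) (tgt b) (c (under b) (under a)) else undefined)\<rparr>)"

section \<open>Strict 2-categories\<close>

record ('a, 'f, 't) two_category =
  Ob2 :: "'a set"
  Hom2 :: "'a \<Rightarrow> 'a \<Rightarrow> ('f, 't) category"
  Unit2 :: "'a \<Rightarrow> 'f"
  Comp2 :: "'a \<Rightarrow> 'a \<Rightarrow> 'a \<Rightarrow> ('f \<times> 'f, 't \<times> 't, 'f, 't) cfunctor"

text \<open>\<open>Comp2 A X Y Z\<close> is the composition functor \<open>A(Y,Z) \<times> A(X,Y) \<rightarrow> A(X,Z)\<close>.\<close>

abbreviation comp1 where "comp1 A X Y Z g f \<equiv> FOb (Comp2 A X Y Z) (g, f)"
abbreviation comp2 where "comp2 A X Y Z b a \<equiv> FAr (Comp2 A X Y Z) (b, a)"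

locale strict_2_category =
  fixes A :: "('a, 'f, 't) two_category"
  assumes Hom_category: "\<lbrakk>X \<in> Ob2 A; Y \<in> Ob2 A\<rbrakk> \<Longrightarrow> category (Hom2 A X Y)"
    and Unit_in: "X \<in> Ob2 A \<Longrightarrow> Unit2 A X \<in> Obj (Hom2 A X X)"
    and Comp_functor: "\<lbrakk>X \<in> Ob2 A; Y \<in> Ob2 A; Z \<in> Ob2 A\<rbrakk> \<Longrightarrow>
      is_functor (prod_category (Hom2 A Y Z) (Hom2 A X Y)) (Hom2 A X Z) (Comp2 A X Y Z)"
    and unit_left_1: "\<lbrakk>X \<in> Ob2 A; Y \<in> Ob2 A; f \<in> Obj (Hom2 A X Y)\<rbrakk> \<Longrightarrow>
      comp1 A X Y Y (Unit2 A Y) f = f"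
    and unit_left_2: "\<lbrakk>X \<in> Ob2 A; Y \<in> Ob2 A; a \<in> Arr (Hom2 A X Y)\<rbrakk> \<Longrightarrow>
      comp2 A X Y Y (Idn (Hom2 A Y Y) (Unit2 A Y)) a = a"
    and unit_right_1: "\<lbrakk>X \<in> Ob2 A; Y \<in> Ob2 A; f \<in> Obj (Hom2 A X Y)\<rbrakk> \<Longrightarrow>
      comp1 A X X Y f (Unit2 A X) = f"
    and unit_right_2: "\<lbrakk>X \<in> Ob2 A; Y \<in> Ob2 A; a \<in> Arr (Hom2 A X Y)\<rbrakk> \<Longrightarrow>
      comp2 A X X Y a (Idn (Hom2 A X X) (Unit2 A X)) = a"
    and assoc_1: "\<lbrakk>W \<in> Ob2 A; X \<in> Ob2 A; Y \<in> Ob2 A; Z \<in> Ob2 A;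
        f \<in> Obj (Hom2 A W X); g \<in> Obj (Hom2 A X Y); h \<in> Obj (Hom2 A Y Z)\<rbrakk> \<Longrightarrow>
      comp1 A W X Z (comp1 A X Y Z h g) f = comp1 A W Y Z h (comp1 A W X Y g f)"
    and assoc_2: "\<lbrakk>W \<in> Ob2 A; X \<in> Ob2 A; Y \<in> Ob2 A; Z \<in> Ob2 A;
        a \<in> Arr (Hom2 A W X); b \<in> Arr (Hom2 A X Y); c \<in> Arr (Hom2 A Y Z)\<rbrakk> \<Longrightarrow>
      comp2 A W X Z (comp2 A X Y Z c b) a = comp2 A W Y Z c (comp2 A W X Y b a)"

record ('a, 'f, 't, 'b, 'g, 's) two_functor =
  on_obj :: "'a \<Rightarrow> 'b"
  on_hom :: "'a \<Rightarrow> 'a \<Rightarrow> ('f, 't, 'g, 's) cfunctor"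

locale is_two_functor =
  source: strict_2_category A + target: strict_2_category B
  for A :: "('a, 'f, 't) two_category" and B :: "('b, 'g, 's) two_category" +
  fixes \<Phi> :: "('a, 'f, 't, 'b, 'g, 's) two_functor"
  assumes on_obj_in: "X \<in> Ob2 A \<Longrightarrow> on_obj \<Phi> X \<in> Ob2 B"
    and on_hom_functor: "\<lbrakk>X \<in> Ob2 A; Y \<in> Ob2 A\<rbrakk> \<Longrightarrow>
      is_functor (Hom2 A X Y) (Hom2 B (on_obj \<Phi> X) (on_obj \<Phi> Y)) (on_hom \<Phi> X Y)"
    and on_hom_unit: "X \<in> Ob2 A \<Longrightarrow> FOb (on_hom \<Phi> X X) (Unit2 A X) = Unit2 B (on_obj \<Phi> X)"
    and on_hom_comp1: "\<lbrakk>X \<in> Ob2 A; Y \<in> Ob2 A; Z \<in> Ob2 A;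
        f \<in> Obj (Hom2 A X Y); g \<in> Obj (Hom2 A Y Z)\<rbrakk> \<Longrightarrow>
      FOb (on_hom \<Phi> X Z) (comp1 A X Y Z g f) =
      comp1 B (on_obj \<Phi> X) (on_obj \<Phi> Y) (on_obj \<Phi> Z)
        (FOb (on_hom \<Phi> Y Z) g) (FOb (on_hom \<Phi> X Y) f)"
    and on_hom_comp2: "\<lbrakk>X \<in> Ob2 A; Y \<in> Ob2 A; Z \<in> Ob2 A;
        a \<in> Arr (Hom2 A X Y); b \<in> Arr (Hom2 A Y Z)\<rbrakk> \<Longrightarrow>
      FAr (on_hom \<Phi> X Z) (comp2 A X Y Z b a) =
      comp2 B (on_obj \<Phi> X) (on_obj \<Phi> Y) (on_obj \<Phi> Z)
        (FAr (on_hom \<Phi> Y Z) b) (FAr (on_hom \<Phi> X Y) a)"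

definition strictly_fully_faithful ::
  "('a, 'f, 't) two_category \<Rightarrow> ('b, 'g, 's) two_category
    \<Rightarrow> ('a, 'f, 't, 'b, 'g, 's) two_functor \<Rightarrow> bool" where
  "strictly_fully_faithful A B \<Phi> \<longleftrightarrow> (\<forall>X\<in>Ob2 A. \<forall>Y\<in>Ob2 A.
     iso_of_categories (Hom2 A X Y) (Hom2 B (on_obj \<Phi> X) (on_obj \<Phi> Y)) (on_hom \<Phi> X Y))"

definition iso_1cell ::
  "('a, 'f, 't) two_category \<Rightarrow> 'a \<Rightarrow> 'a \<Rightarrow> 'f \<Rightarrow> bool" where
  "iso_1cell A X Y f \<longleftrightarrow> f \<in> Obj (Hom2 A X Y) \<and>
    (\<exists>g\<in>Obj (Hom2 A Y X). comp1 A X Y X g f = Unit2 A X \<and> comp1 A Y X Y f g = Unit2 A Y)"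

text \<open>The functor \<open>A(Z,P) \<rightarrow> A(Z,X) \<times> A(Z,Y)\<close> given by composition with \<open>p : P \<rightarrow> X\<close> and
  \<open>q : P \<rightarrow> Y\<close>.\<close>

definition pairing_functor ::
  "('a, 'f, 't) two_category \<Rightarrow> 'a \<Rightarrow> 'a \<Rightarrow> 'a \<Rightarrow> 'f \<Rightarrow> 'f \<Rightarrow> 'a
    \<Rightarrow> ('f, 't, 'f \<times> 'f, 't \<times> 't) cfunctor" where
  "pairing_functor A X Y P p q Z =
    \<lparr>FOb = (\<lambda>f\<in>Obj (Hom2 A Z P). (comp1 A Z P X p f, comp1 A Z P Y q f)),
     FAr = (\<lambda>a\<in>Arr (Hom2 A Z P).
        (comp2 A Z P X (Idn (Hom2 A P X) p) a, comp2 A Z P Y (Idn (Hom2 A P Y) q) a))\<rparr>"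

definition strict_product ::
  "('a, 'f, 't) two_category \<Rightarrow> 'a \<Rightarrow> 'a \<Rightarrow> 'a \<Rightarrow> 'f \<Rightarrow> 'f \<Rightarrow> bool" where
  "strict_product A X Y P p q \<longleftrightarrow>
    P \<in> Ob2 A \<and> p \<in> Obj (Hom2 A P X) \<and> q \<in> Obj (Hom2 A P Y) \<and>
    (\<forall>Z\<in>Ob2 A. iso_of_categories (Hom2 A Z P) (prod_category (Hom2 A Z X) (Hom2 A Z Y))
       (pairing_functor A X Y P p q Z))"

definition strict_final :: "('a, 'f, 't) two_category \<Rightarrow> 'a \<Rightarrow> bool" where
  "strict_final A T \<longleftrightarrow> T \<in> Ob2 A \<and>
    (\<forall>Z\<in>Ob2 A. \<exists>F. iso_of_categories (Hom2 A Z T) one_category F)"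

definition has_strict_finite_products :: "('a, 'f, 't) two_category \<Rightarrow> bool" where
  "has_strict_finite_products A \<longleftrightarrow> (\<exists>T. strict_final A T) \<and>
    (\<forall>X\<in>Ob2 A. \<forall>Y\<in>Ob2 A. \<exists>P p q. strict_product A X Y P p q)"

text \<open>The morphism \<open>h\<close> below is the canonical comparison morphism, unique by the universal
  property of its target.\<close>

definition preserves_strict_finite_products ::
  "('a, 'f, 't) two_category \<Rightarrow> ('b, 'g, 's) two_category
    \<Rightarrow> ('a, 'f, 't, 'b, 'g, 's) two_functor \<Rightarrow> bool" where
  "preserves_strict_finite_products A B \<Phi> \<longleftrightarrow>
    (\<forall>X\<in>Ob2 A. \<forall>Y\<in>Ob2 A. \<forall>P p q P' p' q'.
       strict_product A X Y P p q \<longrightarrow>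
       strict_product B (on_obj \<Phi> X) (on_obj \<Phi> Y) P' p' q' \<longrightarrow>
       (\<exists>h\<in>Obj (Hom2 B (on_obj \<Phi> P) P').
          comp1 B (on_obj \<Phi> P) P' (on_obj \<Phi> X) p' h = FOb (on_hom \<Phi> P X) p \<and>
          comp1 B (on_obj \<Phi> P) P' (on_obj \<Phi> Y) q' h = FOb (on_hom \<Phi> P Y) q \<and>
          iso_1cell B (on_obj \<Phi> P) P' h)) \<and>
    (\<forall>T T'. strict_final A T \<longrightarrow> strict_final B T' \<longrightarrow>
       (\<exists>h\<in>Obj (Hom2 B (on_obj \<Phi> T) T'). iso_1cell B (on_obj \<Phi> T) T' h))"

section \<open>The universe\<close>

text \<open>The elements of the universe form the type \<open>'u\<close>; \<open>small\<close> singles out the subsets of \<open>'u\<close>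
  that belong to the universe, and \<open>pr\<close> is the ordered pair. Only the closure properties
  needed to form products and categories of coalgebras are imposed: every Grothendieck universe
  is an instance, with \<open>'u\<close> its type of elements.\<close>

locale universe =
  fixes small :: "'u set \<Rightarrow> bool" and pr :: "'u \<times> 'u \<Rightarrow> 'u"
  assumes inj_pr: "inj pr"
    and small_singleton: "small {x}"
    and small_subset: "\<lbrakk>small S; T \<subseteq> S\<rbrakk> \<Longrightarrow> small T"
    and small_Times: "\<lbrakk>small S; small T\<rbrakk> \<Longrightarrow> small (pr ` (S \<times> T))"

definition small_category :: "('u set \<Rightarrow> bool) \<Rightarrow> ('u, 'u) category \<Rightarrow> bool" where
  "small_category small C \<longleftrightarrow> category C \<and> small (Obj C) \<and> small (Arr C)"

section \<open>The 2-category of comonads\<close>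

record ('o, 'm) comonad =
  base :: "('o, 'm) category"
  endo :: "('o, 'm, 'o, 'm) cfunctor"
  comult :: "'o \<Rightarrow> 'm"
  counit :: "'o \<Rightarrow> 'm"

locale comonad =
  comult: nat_trans "base Q" "base Q" "endo Q" "fcompose (base Q) (endo Q) (endo Q)" "comult Q" +
  counit: nat_trans "base Q" "base Q" "endo Q" "fidentity (base Q)" "counit Q"
  for Q :: "('o, 'm) comonad" +
  assumes coassociative: "x \<in> Obj (base Q) \<Longrightarrow>
      comult Q (FOb (endo Q) x) \<cdot>\<^bsub>base Q\<^esub> comult Q x =
      FAr (endo Q) (comult Q x) \<cdot>\<^bsub>base Q\<^esub> comult Q x"
    and counit_left: "x \<in> Obj (base Q) \<Longrightarrow>
      counit Q (FOb (endo Q) x) \<cdot>\<^bsub>base Q\<^esub> comult Q x = Idn (base Q) (FOb (endo Q) x)"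
    and counit_right: "x \<in> Obj (base Q) \<Longrightarrow>
      FAr (endo Q) (counit Q x) \<cdot>\<^bsub>base Q\<^esub> comult Q x = Idn (base Q) (FOb (endo Q) x)"

type_synonym ('o, 'm, 'p, 'n) comonad_1cell = "('o, 'm, 'p, 'n) cfunctor \<times> ('o \<Rightarrow> 'n)"

locale oplax_comonad_functor =
  source: comonad Q + target: comonad R +
  structure_map: nat_trans "base Q" "base R"
    "fcompose (base Q) F (endo Q)" "fcompose (base Q) (endo R) F" A
  for Q :: "('o, 'm) comonad" and R :: "('p, 'n) comonad"
    and F :: "('o, 'm, 'p, 'n) cfunctor" and A :: "'o \<Rightarrow> 'n" +
  assumes underlying_functor: "is_functor (base Q) (base R) F"
    and comult_compatible: "x \<in> Obj (base Q) \<Longrightarrow>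
      comult R (FOb F x) \<cdot>\<^bsub>base R\<^esub> A x =
      FAr (endo R) (A x) \<cdot>\<^bsub>base R\<^esub> A (FOb (endo Q) x) \<cdot>\<^bsub>base R\<^esub> FAr F (comult Q x)"
    and counit_compatible: "x \<in> Obj (base Q) \<Longrightarrow>
      counit R (FOb F x) \<cdot>\<^bsub>base R\<^esub> A x = FAr F (counit Q x)"

definition comonad_2cells ::
  "('o, 'm) comonad \<Rightarrow> ('p, 'n) comonad \<Rightarrow> ('o, 'm, 'p, 'n) comonad_1cell
    \<Rightarrow> ('o, 'm, 'p, 'n) comonad_1cell \<Rightarrow> ('o \<Rightarrow> 'n) set" where
  "comonad_2cells Q R = (\<lambda>(F, A) (F', A').
     {a. nat_trans (base Q) (base R) F F' a \<and>
         (\<forall>x\<in>Obj (base Q).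
            FAr (endo R) (a x) \<cdot>\<^bsub>base R\<^esub> A x = A' x \<cdot>\<^bsub>base R\<^esub> a (FOb (endo Q) x))})"

definition comonad_hom ::
  "('o, 'm) comonad \<Rightarrow> ('p, 'n) comonad \<Rightarrow> (('o, 'm, 'p, 'n) comonad_1cell,
     (('o, 'm, 'p, 'n) comonad_1cell, 'o \<Rightarrow> 'n) arrow) category" where
  "comonad_hom Q R = arrow_category
     {(F, A). oplax_comonad_functor Q R F A}
     (comonad_2cells Q R)
     (\<lambda>(F, A). nt_identity (base Q) (base R) F)
     (nt_vcomp (base Q) (base R))"

definition comonad_comp1 ::
  "('o, 'm) comonad \<Rightarrow> ('q, 'l) comonad \<Rightarrow> ('p, 'n, 'q, 'l) comonad_1cell
    \<Rightarrow> ('o, 'm, 'p, 'n) comonad_1cell \<Rightarrow> ('o, 'm, 'q, 'l) comonad_1cell" where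
  "comonad_comp1 Q S = (\<lambda>(G, B) (F, A).
     (fcompose (base Q) G F,
      \<lambda>x\<in>Obj (base Q). B (FOb F x) \<cdot>\<^bsub>base S\<^esub> FAr G (A x)))"

definition Comonads ::
  "('u set \<Rightarrow> bool) \<Rightarrow> (('u, 'u) comonad, ('u, 'u, 'u, 'u) comonad_1cell,
     (('u, 'u, 'u, 'u) comonad_1cell, 'u \<Rightarrow> 'u) arrow) two_category" where
  "Comonads small =
    \<lparr>Ob2 = {Q. comonad Q \<and> small_category small (base Q)},
     Hom2 = comonad_hom,
     Unit2 = (\<lambda>Q. (fidentity (base Q), nt_identity (base Q) (base Q) (endo Q))),
     Comp2 = (\<lambda>Q R S.
       \<lparr>FOb = (\<lambda>(g, f)\<in>Obj (comonad_hom R S) \<times> Obj (comonad_hom Q R). comonad_comp1 Q S g f),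
        FAr = (\<lambda>(b, a)\<in>Arr (comonad_hom R S) \<times> Arr (comonad_hom Q R).
          Arrow (comonad_comp1 Q S (src b) (src a)) (comonad_comp1 Q S (tgt b) (tgt a))
            (nt_hcomp (base Q) (base S) (fst (src b)) (fst (tgt a)) (under b) (under a)))\<rparr>)\<rparr>"

section \<open>The 2-category of functors\<close>

record ('o, 'm, 'p, 'n) functor_obj =
  fsrc :: "('o, 'm) category"
  ftgt :: "('p, 'n) category"
  ffun :: "('o, 'm, 'p, 'n) cfunctor"

type_synonym 'u square = "('u, 'u, 'u, 'u) cfunctor \<times> ('u, 'u, 'u, 'u) cfunctor"

definition square_2cells ::
  "('u, 'u, 'u, 'u) functor_obj \<Rightarrow> ('u, 'u, 'u, 'u) functor_obj \<Rightarrow> 'u square \<Rightarrow> 'u square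
    \<Rightarrow> (('u \<Rightarrow> 'u) \<times> ('u \<Rightarrow> 'u)) set" where
  "square_2cells X Y = (\<lambda>(S, T) (S', T').
     {(a, b). nat_trans (fsrc X) (fsrc Y) S S' a \<and> nat_trans (ftgt X) (ftgt Y) T T' b \<and>
        (\<forall>x\<in>Obj (fsrc X). b (FOb (ffun X) x) = FAr (ffun Y) (a x))})"

definition functors_hom ::
  "('u, 'u, 'u, 'u) functor_obj \<Rightarrow> ('u, 'u, 'u, 'u) functor_obj
    \<Rightarrow> ('u square, ('u square, ('u \<Rightarrow> 'u) \<times> ('u \<Rightarrow> 'u)) arrow) category" where
  "functors_hom X Y = arrow_category
     {(S, T). is_functor (fsrc X) (fsrc Y) S \<and> is_functor (ftgt X) (ftgt Y) T \<and>
        fcompose (fsrc X) (ffun Y) S = fcompose (fsrc X) T (ffun X)}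
     (square_2cells X Y)
     (\<lambda>(S, T). (nt_identity (fsrc X) (fsrc Y) S, nt_identity (ftgt X) (ftgt Y) T))
     (\<lambda>(a', b') (a, b).
        (nt_vcomp (fsrc X) (fsrc Y) a' a, nt_vcomp (ftgt X) (ftgt Y) b' b))"

definition square_comp ::
  "('u, 'u, 'u, 'u) functor_obj \<Rightarrow> 'u square \<Rightarrow> 'u square \<Rightarrow> 'u square" where
  "square_comp X = (\<lambda>(S', T') (S, T). (fcompose (fsrc X) S' S, fcompose (ftgt X) T' T))"

definition Functors ::
  "('u set \<Rightarrow> bool) \<Rightarrow> (('u, 'u, 'u, 'u) functor_obj, 'u square,
     ('u square, ('u \<Rightarrow> 'u) \<times> ('u \<Rightarrow> 'u)) arrow) two_category" where
  "Functors small =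
    \<lparr>Ob2 = {X. small_category small (fsrc X) \<and> small_category small (ftgt X) \<and>
        is_functor (fsrc X) (ftgt X) (ffun X)},
     Hom2 = functors_hom,
     Unit2 = (\<lambda>X. (fidentity (fsrc X), fidentity (ftgt X))),
     Comp2 = (\<lambda>X Y Z.
       \<lparr>FOb = (\<lambda>(g, f)\<in>Obj (functors_hom Y Z) \<times> Obj (functors_hom X Y). square_comp X g f),
        FAr = (\<lambda>(b, a)\<in>Arr (functors_hom Y Z) \<times> Arr (functors_hom X Y).
          Arrow (square_comp X (src b) (src a)) (square_comp X (tgt b) (tgt a))
            (nt_hcomp (fsrc X) (fsrc Z) (fst (src b)) (fst (tgt a))
               (fst (under b)) (fst (under a)),
             nt_hcomp (ftgt X) (ftgt Z) (snd (src b)) (snd (tgt a))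
               (snd (under b)) (snd (under a))))\<rparr>)\<rparr>"

section \<open>Coalgebras\<close>

definition coalgebras :: "('o, 'm) comonad \<Rightarrow> ('o \<times> 'm) set" where
  "coalgebras Q = {(V, k). V \<in> Obj (base Q) \<and> k \<in> Arr (base Q) \<and>
     Dom (base Q) k = V \<and> Cod (base Q) k = FOb (endo Q) V \<and>
     comult Q V \<cdot>\<^bsub>base Q\<^esub> k = FAr (endo Q) k \<cdot>\<^bsub>base Q\<^esub> k \<and>
     counit Q V \<cdot>\<^bsub>base Q\<^esub> k = Idn (base Q) V}"

definition Cog :: "('o, 'm) comonad \<Rightarrow> ('o \<times> 'm, ('o \<times> 'm, 'm) arrow) category" where
  "Cog Q = arrow_category
     (coalgebras Q)
     (\<lambda>(V, k) (W, l). {f \<in> Arr (base Q). Dom (base Q) f = V \<and> Cod (base Q) f = W \<and>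
        FAr (endo Q) f \<cdot>\<^bsub>base Q\<^esub> k = l \<cdot>\<^bsub>base Q\<^esub> f})
     (\<lambda>(V, k). Idn (base Q) V)
     (Comp (base Q))"

definition forgetful ::
  "('o, 'm) comonad \<Rightarrow> ('o \<times> 'm, ('o \<times> 'm, 'm) arrow, 'o, 'm) cfunctor" where
  "forgetful Q = \<lparr>FOb = (\<lambda>(V, k)\<in>Obj (Cog Q). V), FAr = (\<lambda>f\<in>Arr (Cog Q). under f)\<rparr>"

definition lift_obj ::
  "('p, 'n) comonad \<Rightarrow> ('o, 'm, 'p, 'n) comonad_1cell \<Rightarrow> 'o \<times> 'm \<Rightarrow> 'p \<times> 'n" where
  "lift_obj R = (\<lambda>(F, A) (V, k). (FOb F V, A V \<cdot>\<^bsub>base R\<^esub> FAr F k))"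

definition lift_functor ::
  "('o, 'm) comonad \<Rightarrow> ('p, 'n) comonad \<Rightarrow> ('o, 'm, 'p, 'n) comonad_1cell
    \<Rightarrow> ('o \<times> 'm, ('o \<times> 'm, 'm) arrow, 'p \<times> 'n, ('p \<times> 'n, 'n) arrow) cfunctor" where
  "lift_functor Q R FA =
    \<lparr>FOb = (\<lambda>V\<in>Obj (Cog Q). lift_obj R FA V),
     FAr = (\<lambda>f\<in>Arr (Cog Q).
        Arrow (lift_obj R FA (src f)) (lift_obj R FA (tgt f)) (FAr (fst FA) (under f)))\<rparr>"

definition lift_2cell ::
  "('o, 'm) comonad \<Rightarrow> ('p, 'n) comonad
    \<Rightarrow> (('o, 'm, 'p, 'n) comonad_1cell, 'o \<Rightarrow> 'n) arrow
    \<Rightarrow> 'o \<times> 'm \<Rightarrow> ('p \<times> 'n, 'n) arrow" where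
  "lift_2cell Q R a = (\<lambda>V\<in>Obj (Cog Q).
     Arrow (lift_obj R (src a) V) (lift_obj R (tgt a) V) (under a (fst V)))"

text \<open>A coalgebra is a pair and not itself an element of \<open>'u\<close>, so categories of coalgebras are
  transported into the universe along the pairing.\<close>

definition encode_category ::
  "('o \<Rightarrow> 'p) \<Rightarrow> ('m \<Rightarrow> 'n) \<Rightarrow> ('o, 'm) category \<Rightarrow> ('p, 'n) category" where
  "encode_category e d C =
    (let e' = inv_into (Obj C) e; d' = inv_into (Arr C) d in
    \<lparr>Obj = e ` Obj C,
     Arr = d ` Arr C,
     Dom = (\<lambda>f\<in>d ` Arr C. e (Dom C (d' f))),
     Cod = (\<lambda>f\<in>d ` Arr C. e (Cod C (d' f))),
     Idn = (\<lambda>x\<in>e ` Obj C. d (Idn C (e' x))),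
     Comp = (\<lambda>g f. if f \<in> d ` Arr C \<and> g \<in> d ` Arr C \<and> Dom C (d' g) = Cod C (d' f)
        then d (d' g \<cdot>\<^bsub>C\<^esub> d' f) else undefined)\<rparr>)"

definition encode_functor ::
  "('o \<Rightarrow> 'p) \<Rightarrow> ('m \<Rightarrow> 'n) \<Rightarrow> ('o, 'm) category \<Rightarrow> ('o, 'm, 'p, 'n) cfunctor" where
  "encode_functor e d C = \<lparr>FOb = restrict e (Obj C), FAr = restrict d (Arr C)\<rparr>"

definition decode_functor ::
  "('o \<Rightarrow> 'p) \<Rightarrow> ('m \<Rightarrow> 'n) \<Rightarrow> ('o, 'm) category \<Rightarrow> ('p, 'n, 'o, 'm) cfunctor" where
  "decode_functor e d C =
    \<lparr>FOb = restrict (inv_into (Obj C) e) (e ` Obj C),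
     FAr = restrict (inv_into (Arr C) d) (d ` Arr C)\<rparr>"

definition encode_arrow :: "('u \<times> 'u \<Rightarrow> 'u) \<Rightarrow> ('u \<times> 'u, 'u) arrow \<Rightarrow> 'u" where
  "encode_arrow pr a = pr (pr (pr (src a), pr (tgt a)), under a)"

definition CogU :: "('u \<times> 'u \<Rightarrow> 'u) \<Rightarrow> ('u, 'u) comonad \<Rightarrow> ('u, 'u) category" where
  "CogU pr Q = encode_category pr (encode_arrow pr) (Cog Q)"

definition forgetfulU :: "('u \<times> 'u \<Rightarrow> 'u) \<Rightarrow> ('u, 'u) comonad \<Rightarrow> ('u, 'u, 'u, 'u) cfunctor" where
  "forgetfulU pr Q =
     fcompose (CogU pr Q) (forgetful Q) (decode_functor pr (encode_arrow pr) (Cog Q))"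

definition lift_functorU ::
  "('u \<times> 'u \<Rightarrow> 'u) \<Rightarrow> ('u, 'u) comonad \<Rightarrow> ('u, 'u) comonad
    \<Rightarrow> ('u, 'u, 'u, 'u) comonad_1cell \<Rightarrow> ('u, 'u, 'u, 'u) cfunctor" where
  "lift_functorU pr Q R FA =
     fcompose (CogU pr Q) (encode_functor pr (encode_arrow pr) (Cog R))
       (fcompose (CogU pr Q) (lift_functor Q R FA)
         (decode_functor pr (encode_arrow pr) (Cog Q)))"

definition lift_2cellU ::
  "('u \<times> 'u \<Rightarrow> 'u) \<Rightarrow> ('u, 'u) comonad \<Rightarrow> ('u, 'u) comonad
    \<Rightarrow> (('u, 'u, 'u, 'u) comonad_1cell, 'u \<Rightarrow> 'u) arrow \<Rightarrow> 'u \<Rightarrow> 'u" where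
  "lift_2cellU pr Q R a = (\<lambda>v\<in>Obj (CogU pr Q).
     encode_arrow pr (lift_2cell Q R a (inv_into (Obj (Cog Q)) pr v)))"

definition forgetful_2functor ::
  "('u \<times> 'u \<Rightarrow> 'u) \<Rightarrow>
    (('u, 'u) comonad, ('u, 'u, 'u, 'u) comonad_1cell,
     (('u, 'u, 'u, 'u) comonad_1cell, 'u \<Rightarrow> 'u) arrow,
     ('u, 'u, 'u, 'u) functor_obj, 'u square,
     ('u square, ('u \<Rightarrow> 'u) \<times> ('u \<Rightarrow> 'u)) arrow) two_functor" where
  "forgetful_2functor pr =
    \<lparr>on_obj = (\<lambda>Q. \<lparr>fsrc = CogU pr Q, ftgt = base Q, ffun = forgetfulU pr Q\<rparr>),
     on_hom = (\<lambda>Q R.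
       \<lparr>FOb = (\<lambda>f\<in>Obj (comonad_hom Q R). (lift_functorU pr Q R f, fst f)),
        FAr = (\<lambda>a\<in>Arr (comonad_hom Q R).
          Arrow (lift_functorU pr Q R (src a), fst (src a))
            (lift_functorU pr Q R (tgt a), fst (tgt a))
            (lift_2cellU pr Q R a, under a))\<rparr>)\<rparr>"

end

theory Submission
  imports Defs
begin

text \<open>
  The 2-functor sends an oplax comonad functor \<open>(F, A)\<close> to the functor that equips \<open>F V\<close> with the
  coaction \<open>A V \<circ> F k\<close>, where \<open>k\<close> is the coaction of \<open>V\<close>. The laws of \<open>A\<close> make this
  a coalgebra (\<open>lift_obj_in_coalgebras\<close>). The forgetful functors are faithful, hence a 2-cell of squares is
  determined by its component on underlying categories (\<open>square_2cells_eqI\<close>); this reduces the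
  2-functor laws on 2-cells to the underlying categories, where they hold by construction.

  Full faithfulness is a Yoneda-type argument with cofree coalgebras \<open>(Q x, w)\<close>. A functor \<open>S\<close> on
  coalgebras over \<open>T\<close> assigns to the cofree coalgebra a coaction \<open>s : T Q x \<rightarrow> R T Q x\<close>, and
  \<open>A = R T n \<circ> s : T Q x \<rightarrow> R T x\<close> is the only possible structure map (\<open>structure_map_from_cofree\<close>).
  That it is one, and that it induces \<open>S\<close>, follows by applying \<open>S\<close> to the coaction of a coalgebra,
  viewed as a morphism to the cofree coalgebra on its carrier (\<open>lift_functorU_surj\<close>). The same
  evaluation at cofree coalgebras treats 2-cells (\<open>lift_2cellU_surj\<close>).

  Products of functors and of comonads are both built on products of categories. A product of
  categories is described by \<open>product_cone\<close>: joint bijectivity of the projections on objects and on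
  morphisms. The comonad on a product is given by pairing, and the projections commute
  strictly with the structure, so all equations are tested after projecting
  (\<open>strict_product_Comonads\<close>, \<open>strict_product_Functors\<close>). For the same reason coalgebras over a
  product of comonads are pairs of coalgebras (\<open>product_cone_CogU\<close>), so that the 2-functor
  carries one chosen product of each pair to a product. As strict products are unique up to
  isomorphism and 2-functors preserve isomorphisms, this suffices for preservation of all of them
  (\<open>preserves_strict_finite_productsI\<close>); final objects are treated alike.
\<close>

section \<open>Categories, functors and natural transformations\<close>

context category
begin

lemma Dom_Obj [simp]: "f \<in> Arr C \<Longrightarrow> Dom C f \<in> Obj C"
  using Dom_in by auto

lemma Cod_Obj [simp]: "f \<in> Arr C \<Longrightarrow> Cod C f \<in> Obj C"
  using Cod_in by auto

lemma Idn_Arr [simp]: "x \<in> Obj C \<Longrightarrow> Idn C x \<in> Arr C"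
  using Idn_in by auto

lemma Comp_Idn_eq [simp]: "\<lbrakk>f \<in> Arr C; Dom C f = x\<rbrakk> \<Longrightarrow> f \<cdot> Idn C x = f"
  using Comp_Idn by auto

lemma Idn_Comp_eq [simp]: "\<lbrakk>f \<in> Arr C; Cod C f = x\<rbrakk> \<Longrightarrow> Idn C x \<cdot> f = f"
  using Idn_Comp by auto

declare Dom_Idn [simp] Cod_Idn [simp] Comp_in [simp] Dom_Comp [simp] Cod_Comp [simp]

text \<open>Calculations bracket composites to the right. This form lets an equation between two-step
  composites act on the first two factors of a longer one without rebracketing.\<close>

lemma Comp_extend:
  assumes "g \<cdot> f = h" "f \<in> Arr C" "g \<in> Arr C" "Dom C g = Cod C f" "e \<in> Arr C" "Cod C e = Dom C f"
  shows "g \<cdot> (f \<cdot> e) = h \<cdot> e"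
  using assms Comp_assoc [of e f g] by auto

end

context is_functor
begin

lemma FOb_Obj [simp]: "x \<in> Obj C \<Longrightarrow> FOb F x \<in> Obj D"
  using FOb_in by auto

lemma FAr_Arr [simp]: "f \<in> Arr C \<Longrightarrow> FAr F f \<in> Arr D"
  using FAr_in by auto

lemma FOb_extensional: "FOb F \<in> extensional (Obj C)"
  using FOb_in by (auto simp: PiE_def)

lemma FAr_extensional: "FAr F \<in> extensional (Arr C)"
  using FAr_in by (auto simp: PiE_def)

declare Dom_FAr [simp] Cod_FAr [simp] FAr_Idn [simp] FAr_Comp [simp]

end

context nat_trans
begin

lemma component_Arr [simp]: "x \<in> Obj C \<Longrightarrow> a x \<in> Arr D"
  using component_in by auto

lemma component_extensional: "a \<in> extensional (Obj C)"
  using component_in by (auto simp: PiE_def)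

declare Dom_component [simp] Cod_component [simp]

end

lemma functor_eqI:
  assumes "is_functor C D F" "is_functor C D' G"
    and "\<And>x. x \<in> Obj C \<Longrightarrow> FOb F x = FOb G x" "\<And>f. f \<in> Arr C \<Longrightarrow> FAr F f = FAr G f"
  shows "F = G"
proof -
  have "FOb F = FOb G"
    by (rule extensionalityI [OF is_functor.FOb_extensional [OF assms(1)]
          is_functor.FOb_extensional [OF assms(2)] assms(3)])
  moreover have "FAr F = FAr G"
    by (rule extensionalityI [OF is_functor.FAr_extensional [OF assms(1)]
          is_functor.FAr_extensional [OF assms(2)] assms(4)])
  ultimately show ?thesis by (cases F, cases G) simp
qed

lemma nat_trans_eqI:
  assumes "nat_trans C D F G a" "nat_trans C D' F' G' b"
    and "\<And>x. x \<in> Obj C \<Longrightarrow> a x = b x"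
  shows "a = b"
  by (rule extensionalityI [OF nat_trans.component_extensional [OF assms(1)]
        nat_trans.component_extensional [OF assms(2)] assms(3)])

lemma is_functorD:
  assumes "is_functor C D F"
  shows "category C" "category D"
  using assms by (auto simp: is_functor_def)

lemma FOb_fidentity [simp]: "x \<in> Obj C \<Longrightarrow> FOb (fidentity C) x = x"
  by (simp add: fidentity_def)

lemma FAr_fidentity [simp]: "f \<in> Arr C \<Longrightarrow> FAr (fidentity C) f = f"
  by (simp add: fidentity_def)

lemma FOb_fcompose [simp]: "x \<in> Obj C \<Longrightarrow> FOb (fcompose C G F) x = FOb G (FOb F x)"
  by (simp add: fcompose_def compose_def)

lemma FAr_fcompose [simp]: "f \<in> Arr C \<Longrightarrow> FAr (fcompose C G F) f = FAr G (FAr F f)"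
  by (simp add: fcompose_def compose_def)

lemma nt_identity_apply [simp]: "x \<in> Obj C \<Longrightarrow> nt_identity C D F x = Idn D (FOb F x)"
  by (simp add: nt_identity_def)

lemma nt_vcomp_apply [simp]: "x \<in> Obj C \<Longrightarrow> nt_vcomp C D b a x = b x \<cdot>\<^bsub>D\<^esub> a x"
  by (simp add: nt_vcomp_def)

lemma nt_hcomp_apply [simp]:
  "x \<in> Obj C \<Longrightarrow> nt_hcomp C E G F' b a x = b (FOb F' x) \<cdot>\<^bsub>E\<^esub> FAr G (a x)"
  by (simp add: nt_hcomp_def)

lemma is_functorI:
  assumes "category C" "category D"
    and "FOb F \<in> extensional (Obj C)" "FAr F \<in> extensional (Arr C)"
    and "\<And>x. x \<in> Obj C \<Longrightarrow> FOb F x \<in> Obj D" "\<And>f. f \<in> Arr C \<Longrightarrow> FAr F f \<in> Arr D"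
    and "\<And>f. f \<in> Arr C \<Longrightarrow> Dom D (FAr F f) = FOb F (Dom C f)"
    and "\<And>f. f \<in> Arr C \<Longrightarrow> Cod D (FAr F f) = FOb F (Cod C f)"
    and "\<And>x. x \<in> Obj C \<Longrightarrow> FAr F (Idn C x) = Idn D (FOb F x)"
    and "\<And>f g. \<lbrakk>f \<in> Arr C; g \<in> Arr C; Dom C g = Cod C f\<rbrakk>
        \<Longrightarrow> FAr F (g \<cdot>\<^bsub>C\<^esub> f) = FAr F g \<cdot>\<^bsub>D\<^esub> FAr F f"
  shows "is_functor C D F"
  using assms by (auto simp: is_functor_def is_functor_axioms_def PiE_def)

lemma nat_transI:
  assumes "is_functor C D F" "is_functor C D G" "a \<in> extensional (Obj C)"
    and "\<And>x. x \<in> Obj C \<Longrightarrow> a x \<in> Arr D"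
    and "\<And>x. x \<in> Obj C \<Longrightarrow> Dom D (a x) = FOb F x"
    and "\<And>x. x \<in> Obj C \<Longrightarrow> Cod D (a x) = FOb G x"
    and "\<And>f. f \<in> Arr C \<Longrightarrow> a (Cod C f) \<cdot>\<^bsub>D\<^esub> FAr F f = FAr G f \<cdot>\<^bsub>D\<^esub> a (Dom C f)"
  shows "nat_trans C D F G a"
  using assms by (auto simp: nat_trans_def nat_trans_axioms_def PiE_def)

lemma is_functor_fidentity:
  assumes "category C" shows "is_functor C C (fidentity C)"
proof -
  interpret category C by fact
  show ?thesis
    by (rule is_functorI) (auto simp: assms, auto simp: fidentity_def)
qed

lemma is_functor_fcompose:
  assumes "is_functor C D F" "is_functor D E G"
  shows "is_functor C E (fcompose C G F)"
proof -
  interpret F: is_functor C D F by fact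
  interpret G: is_functor D E G by fact
  show ?thesis
  proof (rule is_functorI)
    show "category C" "category E" by unfold_locales
  qed (auto, auto simp: fcompose_def compose_def)
qed

lemma fcompose_assoc:
  assumes "is_functor B C F" "is_functor C D G" "is_functor D E H"
  shows "fcompose B (fcompose C H G) F = fcompose B H (fcompose B G F)"
proof -
  interpret F: is_functor B C F by fact
  interpret G: is_functor C D G by fact
  show ?thesis
    by (rule functor_eqI [of B E _ E]) (auto intro!: is_functor_fcompose assms)
qed

lemma fcompose_fidentity_left:
  assumes "is_functor C D F" shows "fcompose C (fidentity D) F = F"
proof -
  interpret F: is_functor C D F by fact
  show ?thesis
    by (rule functor_eqI [of C D _ D])
      (auto intro!: is_functor_fcompose is_functor_fidentity assms F.target.category_axioms)
qed

lemma fcompose_fidentity_right: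
  assumes "is_functor C D F" shows "fcompose C F (fidentity C) = F"
proof -
  interpret F: is_functor C D F by fact
  show ?thesis
    by (rule functor_eqI [of C D _ D])
      (auto intro!: is_functor_fcompose is_functor_fidentity assms F.source.category_axioms)
qed

lemma nat_trans_identity:
  assumes "is_functor C D F" shows "nat_trans C D F F (nt_identity C D F)"
proof -
  interpret F: is_functor C D F by fact
  show ?thesis
    by (rule nat_transI) (auto simp: assms, auto simp: nt_identity_def)
qed

lemma nat_trans_vcomp:
  assumes "nat_trans C D F G a" "nat_trans C D G H b"
  shows "nat_trans C D F H (nt_vcomp C D b a)"
proof -
  interpret a: nat_trans C D F G a by fact
  interpret b: nat_trans C D G H b by fact
  show ?thesis
  proof (rule nat_transI)
    show "is_functor C D F" "is_functor C D H" by unfold_locales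
  next
    fix f assume f [simp]: "f \<in> Arr C"
    have "(b (Cod C f) \<cdot>\<^bsub>D\<^esub> a (Cod C f)) \<cdot>\<^bsub>D\<^esub> FAr F f =
        b (Cod C f) \<cdot>\<^bsub>D\<^esub> (FAr G f \<cdot>\<^bsub>D\<^esub> a (Dom C f))"
      using a.naturality [OF f] by (simp add: a.source.target.Comp_assoc)
    also have "\<dots> = (FAr H f \<cdot>\<^bsub>D\<^esub> b (Dom C f)) \<cdot>\<^bsub>D\<^esub> a (Dom C f)"
      using b.naturality [OF f] by (simp flip: a.source.target.Comp_assoc)
    finally show "nt_vcomp C D b a (Cod C f) \<cdot>\<^bsub>D\<^esub> FAr F f =
        FAr H f \<cdot>\<^bsub>D\<^esub> nt_vcomp C D b a (Dom C f)"
      by (simp add: a.source.target.Comp_assoc)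
  qed (auto, auto simp: nt_vcomp_def)
qed

lemma nat_trans_hcomp:
  assumes "nat_trans C D F F' a" "nat_trans D E G G' b"
  shows "nat_trans C E (fcompose C G F) (fcompose C G' F') (nt_hcomp C E G F' b a)"
proof -
  interpret a: nat_trans C D F F' a by fact
  interpret b: nat_trans D E G G' b by fact
  show ?thesis
  proof (rule nat_transI)
    show "is_functor C E (fcompose C G F)" "is_functor C E (fcompose C G' F')"
      by (rule is_functor_fcompose; unfold_locales)+
  next
    fix f assume f [simp]: "f \<in> Arr C"
    have "b (FOb F' (Cod C f)) \<cdot>\<^bsub>E\<^esub> FAr G (a (Cod C f)) \<cdot>\<^bsub>E\<^esub> FAr G (FAr F f) =
        b (FOb F' (Cod C f)) \<cdot>\<^bsub>E\<^esub> FAr G (a (Cod C f) \<cdot>\<^bsub>D\<^esub> FAr F f)"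
      by (simp add: b.source.target.Comp_assoc)
    also have "\<dots> = b (FOb F' (Cod C f)) \<cdot>\<^bsub>E\<^esub> FAr G (FAr F' f) \<cdot>\<^bsub>E\<^esub> FAr G (a (Dom C f))"
      using a.naturality [OF f] by (simp add: b.source.target.Comp_assoc)
    also have "\<dots> = FAr G' (FAr F' f) \<cdot>\<^bsub>E\<^esub> b (FOb F' (Dom C f)) \<cdot>\<^bsub>E\<^esub> FAr G (a (Dom C f))"
      using b.naturality [of "FAr F' f"] by simp
    finally show "nt_hcomp C E G F' b a (Cod C f) \<cdot>\<^bsub>E\<^esub> FAr (fcompose C G F) f =
        FAr (fcompose C G' F') f \<cdot>\<^bsub>E\<^esub> nt_hcomp C E G F' b a (Dom C f)"
      by (simp add: b.source.target.Comp_assoc)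
  qed (auto, auto simp: nt_hcomp_def)
qed

lemma nt_vcomp_identity_right:
  assumes "nat_trans C D F G a" shows "nt_vcomp C D a (nt_identity C D F) = a"
proof -
  interpret a: nat_trans C D F G a by fact
  show ?thesis
    by (rule nat_trans_eqI [OF nat_trans_vcomp [OF nat_trans_identity assms] assms])
      (unfold_locales, simp)
qed

lemma nt_vcomp_identity_left:
  assumes "nat_trans C D F G a" shows "nt_vcomp C D (nt_identity C D G) a = a"
proof -
  interpret a: nat_trans C D F G a by fact
  show ?thesis
    by (rule nat_trans_eqI [OF nat_trans_vcomp [OF assms nat_trans_identity] assms])
      (unfold_locales, simp)
qed

lemma nt_vcomp_assoc:
  assumes "nat_trans C D F G a" "nat_trans C D G H b" "nat_trans C D H K c"
  shows "nt_vcomp C D (nt_vcomp C D c b) a = nt_vcomp C D c (nt_vcomp C D b a)"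
proof -
  interpret a: nat_trans C D F G a by fact
  interpret b: nat_trans C D G H b by fact
  interpret c: nat_trans C D H K c by fact
  show ?thesis
    by (rule nat_trans_eqI [of C D F K _ D F K])
      (auto intro!: nat_trans_vcomp assms simp: a.source.target.Comp_assoc
        intro: nat_trans_vcomp [OF assms(1) nat_trans_vcomp [OF assms(2,3)]]
          nat_trans_vcomp [OF nat_trans_vcomp [OF assms(1,2)] assms(3)])
qed

lemma nt_hcomp_identity:
  assumes "is_functor C D F" "is_functor D E G"
  shows "nt_hcomp C E G F (nt_identity D E G) (nt_identity C D F) =
    nt_identity C E (fcompose C G F)"
proof -
  interpret F: is_functor C D F by fact
  interpret G: is_functor D E G by fact
  show ?thesis
    by (auto simp: nt_hcomp_def nt_identity_def fun_eq_iff)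
qed

text \<open>The interchange law rests on the naturality square of \<open>b : G \<rightarrow> G'\<close> at the components
  of \<open>a' : F' \<rightarrow> F''\<close>.\<close>

lemma nt_interchange:
  assumes "nat_trans C D F F' a" "nat_trans C D F' F'' a'"
    and "nat_trans D E G G' b" "nat_trans D E G' G'' b'"
  shows "nt_hcomp C E G F'' (nt_vcomp D E b' b) (nt_vcomp C D a' a) =
    nt_vcomp C E (nt_hcomp C E G' F'' b' a') (nt_hcomp C E G F' b a)"
proof -
  interpret a: nat_trans C D F F' a by fact
  interpret a': nat_trans C D F' F'' a' by fact
  interpret b: nat_trans D E G G' b by fact
  interpret b': nat_trans D E G' G'' b' by fact
  note assoc = b.source.target.Comp_assoc
  have "nt_hcomp C E G F'' (nt_vcomp D E b' b) (nt_vcomp C D a' a) x =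
    nt_vcomp C E (nt_hcomp C E G' F'' b' a') (nt_hcomp C E G F' b a) x" if [simp]: "x \<in> Obj C" for x
    using b.source.target.Comp_extend [OF b.naturality [of "a' x"], of "FAr G (a x)"]
    by (simp add: assoc)
  then show ?thesis
    by (simp add: nt_hcomp_def nt_vcomp_def fun_eq_iff)
qed

lemma nt_hcomp_assoc:
  assumes "nat_trans B C F F' a" "nat_trans C D G G' b" "nat_trans D E H H' c"
  shows "nt_hcomp B E (fcompose C H G) F' (nt_hcomp C E H G' c b) a =
    nt_hcomp B E H (fcompose B G' F') c (nt_hcomp B D G F' b a)"
proof -
  interpret a: nat_trans B C F F' a by fact
  interpret b: nat_trans C D G G' b by fact
  interpret c: nat_trans D E H H' c by fact
  show ?thesis
    by (auto simp: nt_hcomp_def fun_eq_iff c.source.target.Comp_assoc)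
qed

lemma nt_hcomp_unit_left:
  assumes "nat_trans C D F F' a"
  shows "nt_hcomp C D (fidentity D) F' (nt_identity D D (fidentity D)) a = a"
proof -
  interpret a: nat_trans C D F F' a by fact
  show ?thesis
    by (rule extensionalityI [OF _ a.component_extensional])
      (auto simp: nt_hcomp_def)
qed

lemma nt_hcomp_unit_right:
  assumes "nat_trans C D F F' a"
  shows "nt_hcomp C D F (fidentity C) a (nt_identity C C (fidentity C)) = a"
proof -
  interpret a: nat_trans C D F F' a by fact
  show ?thesis
    by (rule extensionalityI [OF _ a.component_extensional])
      (auto simp: nt_hcomp_def)
qed

lemma nt_hcomp_whisker:
  assumes "nat_trans C D F F' a" "is_functor D E G"
  shows "nt_hcomp C E G F' (nt_identity D E G) a = (\<lambda>x\<in>Obj C. FAr G (a x))"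
proof -
  interpret a: nat_trans C D F F' a by fact
  interpret G: is_functor D E G by fact
  show ?thesis by (auto simp: nt_hcomp_def fun_eq_iff)
qed

text \<open>Isomorphisms of categories are recognised by bijectivity; the inverse functor need never be
  written down.\<close>

lemma iso_of_categoriesI:
  assumes "is_functor C D F" "bij_betw (FOb F) (Obj C) (Obj D)" "bij_betw (FAr F) (Arr C) (Arr D)"
  shows "iso_of_categories C D F"
proof -
  interpret F: is_functor C D F by fact
  define o' where "o' = inv_into (Obj C) (FOb F)"
  define a' where "a' = inv_into (Arr C) (FAr F)"
  define G where "G = \<lparr>FOb = restrict o' (Obj D), FAr = restrict a' (Arr D)\<rparr>"
  have oF [simp]: "o' (FOb F x) = x" if "x \<in> Obj C" for x
    using bij_betw_inv_into_left [OF assms(2) that] by (simp add: o'_def)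
  have aF [simp]: "a' (FAr F x) = x" if "x \<in> Arr C" for x
    using bij_betw_inv_into_left [OF assms(3) that] by (simp add: a'_def)
  have obj: "\<exists>x'\<in>Obj C. x = FOb F x'" if "x \<in> Obj D" for x
    using that assms(2) by (auto simp: bij_betw_def)
  have arr: "\<exists>x'\<in>Arr C. x = FAr F x'" if "x \<in> Arr D" for x
    using that assms(3) by (auto simp: bij_betw_def)
  have G: "is_functor D C G"
  proof (rule is_functorI)
    show "category D" "category C" by unfold_locales
  next
    fix f assume "f \<in> Arr D"
    then obtain f' where f': "f' \<in> Arr C" "f = FAr F f'" using arr by blast
    then show "FAr G f \<in> Arr C" "Dom C (FAr G f) = FOb G (Dom D f)"
      "Cod C (FAr G f) = FOb G (Cod D f)" by (auto simp: G_def)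
  next
    fix x assume "x \<in> Obj D"
    then obtain x' where x': "x' \<in> Obj C" "x = FOb F x'" using obj by blast
    have "Idn D x = FAr F (Idn C x')" using x' by simp
    then have "a' (Idn D x) = Idn C x'" using x'(1) by (simp only: aF F.source.Idn_Arr)
    then show "FAr G (Idn D x) = Idn C (FOb G x)" "FOb G x \<in> Obj C" using x' by (auto simp: G_def)
  next
    fix f g assume fg: "f \<in> Arr D" "g \<in> Arr D" "Dom D g = Cod D f"
    then obtain f' g' where f': "f' \<in> Arr C" "f = FAr F f'" and g': "g' \<in> Arr C" "g = FAr F g'"
      using arr by metis
    have "FOb F (Dom C g') = FOb F (Cod C f')" using fg(3) f' g' by simp
    then have "o' (FOb F (Dom C g')) = o' (FOb F (Cod C f'))" by simp
    then have m: "Dom C g' = Cod C f'" using f' g' by simp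
    then have "a' (FAr F (g' \<cdot>\<^bsub>C\<^esub> f')) = g' \<cdot>\<^bsub>C\<^esub> f'" using f' g' aF F.source.Comp_in by blast
    then show "FAr G (g \<cdot>\<^bsub>D\<^esub> f) = FAr G g \<cdot>\<^bsub>C\<^esub> FAr G f"
      using f' g' m by (simp add: G_def)
  qed (auto simp: G_def)
  have "fcompose C G F = fidentity C"
    by (rule functor_eqI [OF is_functor_fcompose [OF assms(1) G] is_functor_fidentity])
      (unfold_locales, auto simp: G_def)
  moreover have "fcompose D F G = fidentity D"
    by (rule functor_eqI [OF is_functor_fcompose [OF G assms(1)] is_functor_fidentity])
      (unfold_locales, auto simp: G_def dest!: obj arr)
  ultimately show ?thesis
    using assms(1) G by (auto simp: iso_of_categories_def)
qed

lemma iso_of_categories_bij_Obj: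
  assumes "iso_of_categories C D F" shows "bij_betw (FOb F) (Obj C) (Obj D)"
proof -
  obtain G where F: "is_functor C D F" and G: "is_functor D C G"
    and "fcompose C G F = fidentity C" "fcompose D F G = fidentity D"
    using assms by (auto simp: iso_of_categories_def)
  then have "\<forall>x\<in>Obj C. FOb G (FOb F x) = x" "\<forall>y\<in>Obj D. FOb F (FOb G y) = y"
    by (metis FOb_fcompose FOb_fidentity)+
  then show ?thesis
    using is_functor.FOb_Obj [OF F] is_functor.FOb_Obj [OF G]
    by (intro bij_betw_byWitness [where f' = "FOb G"]) auto
qed

definition terminal_category :: "('o, 'm) category \<Rightarrow> bool" where
  "terminal_category C \<longleftrightarrow> category C \<and> (\<exists>x. Obj C = {x}) \<and> (\<exists>f. Arr C = {f})"

lemma category_one_category: "category one_category"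
  by unfold_locales (auto simp: one_category_def)

lemma terminal_category_iso_one:
  assumes "terminal_category C" shows "\<exists>F. iso_of_categories C one_category F"
proof -
  obtain x f where C: "category C" "Obj C = {x}" "Arr C = {f}"
    using assms by (auto simp: terminal_category_def)
  interpret category C by fact
  let ?F = "\<lparr>FOb = (\<lambda>_\<in>Obj C. ()), FAr = (\<lambda>_\<in>Arr C. ())\<rparr>"
  have "is_functor C one_category ?F"
    by (rule is_functorI) (auto simp: C(1) category_one_category, auto simp: one_category_def)
  then have "iso_of_categories C one_category ?F"
    by (rule iso_of_categoriesI) (auto simp: C bij_betw_def one_category_def)
  then show ?thesis by blast
qed

lemma functor_to_terminal_unique:
  assumes "terminal_category D" "is_functor C D F" "is_functor C D G"
  shows "F = G"
proof (rule functor_eqI [OF assms(2,3)])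
  show "FOb F x = FOb G x" if "x \<in> Obj C" for x
    using is_functor.FOb_Obj [OF assms(2) that] is_functor.FOb_Obj [OF assms(3) that] assms(1)
    by (auto simp: terminal_category_def)
  show "FAr F x = FAr G x" if "x \<in> Arr C" for x
    using is_functor.FAr_Arr [OF assms(2) that] is_functor.FAr_Arr [OF assms(3) that] assms(1)
    by (auto simp: terminal_category_def)
qed

lemma functor_to_terminal_exists:
  assumes "category C" "terminal_category D"
  shows "\<exists>F. is_functor C D F"
proof -
  obtain x f where D: "category D" "Obj D = {x}" "Arr D = {f}"
    using assms by (auto simp: terminal_category_def)
  interpret D: category D by fact
  interpret C: category C by fact
  have sub: "Dom D f = x" "Cod D f = x" "Idn D x = f"
    using D.Dom_Obj [of f] D.Cod_Obj [of f] D.Idn_Arr [of x] by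
        (auto simp: D simp del: D.Dom_Obj D.Cod_Obj D.Idn_Arr)
  then have "f \<cdot>\<^bsub>D\<^esub> f = f" using D.Comp_Idn_eq [of f x] D by simp
  then have "is_functor C D \<lparr>FOb = (\<lambda>_\<in>Obj C. x), FAr = (\<lambda>_\<in>Arr C. f)\<rparr>"
    by (intro is_functorI) (auto simp: assms D sub)
  then show ?thesis by blast
qed

lemma terminal_arrow:
  assumes "terminal_category D" "f \<in> Arr D" "g \<in> Arr D" shows "f = g"
  using assms by (auto simp: terminal_category_def)

lemma nat_trans_to_terminal_unique:
  assumes "terminal_category D" "nat_trans C D F G a" "nat_trans C D F' G' b"
  shows "a = b"
  by (rule nat_trans_eqI [OF assms(2,3)])
    (rule terminal_arrow [OF assms(1) nat_trans.component_Arr [OF assms(2)]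
        nat_trans.component_Arr [OF assms(3)]])

subsection \<open>Products of categories\<close>

lemma Obj_prod_category [simp]: "Obj (prod_category C D) = Obj C \<times> Obj D"
  and Arr_prod_category [simp]: "Arr (prod_category C D) = Arr C \<times> Arr D"
  by (simp_all add: prod_category_def)

lemma prod_category_simps [simp]:
  "\<lbrakk>f \<in> Arr C; g \<in> Arr D\<rbrakk> \<Longrightarrow> Dom (prod_category C D) (f, g) = (Dom C f, Dom D g)"
  "\<lbrakk>f \<in> Arr C; g \<in> Arr D\<rbrakk> \<Longrightarrow> Cod (prod_category C D) (f, g) = (Cod C f, Cod D g)"
  "\<lbrakk>x \<in> Obj C; y \<in> Obj D\<rbrakk> \<Longrightarrow> Idn (prod_category C D) (x, y) = (Idn C x, Idn D y)"
  "\<lbrakk>f \<in> Arr C; g \<in> Arr D; f' \<in> Arr C; g' \<in> Arr D; Dom C f' = Cod C f; Dom D g' = Cod D g\<rbrakk>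
    \<Longrightarrow> (f', g') \<cdot>\<^bsub>prod_category C D\<^esub> (f, g) = (f' \<cdot>\<^bsub>C\<^esub> f, g' \<cdot>\<^bsub>D\<^esub> g)"
  by (simp_all add: prod_category_def)

lemma category_prod_category:
  assumes "category C" "category D" shows "category (prod_category C D)"
proof -
  interpret C: category C by fact
  interpret D: category D by fact
  show ?thesis
  proof
    show "\<not> (f \<in> Arr (prod_category C D) \<and> g \<in> Arr (prod_category C D) \<and>
      Dom (prod_category C D) g = Cod (prod_category C D) f) \<Longrightarrow>
      g \<cdot>\<^bsub>prod_category C D\<^esub> f = undefined" for f g
      by (cases f; cases g) (auto simp: prod_category_def)
  qed (auto simp: C.Comp_assoc D.Comp_assoc, auto simp: prod_category_def split: if_splits)
qed

text \<open>Joint bijectivity is easy to check, and it makes sense for any category over \<open>C\<close> and \<open>D\<close>, such as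
  the coalgebras of a product comonad, and not just for one construction of the product.
  Everything on a product (functors, natural transformations, comonads) is obtained from
  the pairing lemmas below and compared after applying \<open>p\<close> and \<open>q\<close>.\<close>

locale product_cone =
  p: is_functor E C p + q: is_functor E D q
  for E :: "('e, 'k) category" and C :: "('o, 'm) category" and D :: "('p, 'n) category"
    and p q +
  assumes bij_Obj: "bij_betw (\<lambda>x. (FOb p x, FOb q x)) (Obj E) (Obj C \<times> Obj D)"
    and bij_Arr: "bij_betw (\<lambda>f. (FAr p f, FAr q f)) (Arr E) (Arr C \<times> Arr D)"
begin

lemma Obj_eqI: "\<lbrakk>x \<in> Obj E; y \<in> Obj E; FOb p x = FOb p y; FOb q x = FOb q y\<rbrakk> \<Longrightarrow> x = y"
  using bij_Obj by (auto simp: bij_betw_def inj_on_def)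

lemma Arr_eqI: "\<lbrakk>f \<in> Arr E; g \<in> Arr E; FAr p f = FAr p g; FAr q f = FAr q g\<rbrakk> \<Longrightarrow> f = g"
  using bij_Arr by (auto simp: bij_betw_def inj_on_def)

lemma Obj_exists:
  assumes "x \<in> Obj C" "y \<in> Obj D" obtains z where "z \<in> Obj E" "FOb p z = x" "FOb q z = y"
proof -
  have "(x, y) \<in> (\<lambda>x. (FOb p x, FOb q x)) ` Obj E"
    using assms bij_Obj by (simp add: bij_betw_def)
  then show ?thesis using that by auto
qed

lemma Arr_exists:
  assumes "f \<in> Arr C" "g \<in> Arr D" obtains h where "h \<in> Arr E" "FAr p h = f" "FAr q h = g"
proof -
  have "(f, g) \<in> (\<lambda>x. (FAr p x, FAr q x)) ` Arr E"
    using assms bij_Arr by (simp add: bij_betw_def)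
  then show ?thesis using that by auto
qed

lemma functor_pairing_unique:
  assumes "is_functor Z E F" "is_functor Z E G"
    and "fcompose Z p F = fcompose Z p G" "fcompose Z q F = fcompose Z q G"
  shows "F = G"
proof -
  interpret F: is_functor Z E F by fact
  interpret G: is_functor Z E G by fact
  show ?thesis
  proof (rule functor_eqI [OF assms(1,2)])
    show "FOb F x = FOb G x" if "x \<in> Obj Z" for x
      using that arg_cong [OF assms(3), of "\<lambda>H. FOb H x"] arg_cong [OF assms(4), of "\<lambda>H. FOb H x"]
      by (intro Obj_eqI) auto
    show "FAr F x = FAr G x" if "x \<in> Arr Z" for x
      using that arg_cong [OF assms(3), of "\<lambda>H. FAr H x"] arg_cong [OF assms(4), of "\<lambda>H. FAr H x"]
      by (intro Arr_eqI) auto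
  qed
qed

lemma functor_pairing:
  assumes "is_functor Z C f" "is_functor Z D g"
  obtains F where "is_functor Z E F" "fcompose Z p F = f" "fcompose Z q F = g"
proof -
  interpret f: is_functor Z C f by fact
  interpret g: is_functor Z D g by fact
  have "\<forall>x\<in>Obj Z. \<exists>z. z \<in> Obj E \<and> FOb p z = FOb f x \<and> FOb q z = FOb g x"
    by (metis Obj_exists f.FOb_Obj g.FOb_Obj)
  then obtain o' where o': "\<And>x. x \<in> Obj Z \<Longrightarrow> o' x \<in> Obj E \<and> FOb p (o' x) = FOb f x \<and> FOb q (o' x) =
      FOb g x"
    by metis
  have "\<forall>x\<in>Arr Z. \<exists>z. z \<in> Arr E \<and> FAr p z = FAr f x \<and> FAr q z = FAr g x"
    by (metis Arr_exists f.FAr_Arr g.FAr_Arr)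
  then obtain a' where a': "\<And>x. x \<in> Arr Z \<Longrightarrow> a' x \<in> Arr E \<and> FAr p (a' x) = FAr f x \<and> FAr q (a' x) =
      FAr g x"
    by metis
  let ?F = "\<lparr>FOb = restrict o' (Obj Z), FAr = restrict a' (Arr Z)\<rparr>"
  have ends: "Dom E (a' x) = o' (Dom Z x)" "Cod E (a' x) = o' (Cod Z x)" if "x \<in> Arr Z" for x
    using that a' [OF that] o'
    by (auto intro!: Obj_eqI simp flip: p.Dom_FAr q.Dom_FAr p.Cod_FAr q.Cod_FAr)
  have F: "is_functor Z E ?F"
  proof (rule is_functorI)
    show "category Z" "category E" by unfold_locales
    show "FAr ?F (Idn Z x) = Idn E (FOb ?F x)" if "x \<in> Obj Z" for x
      using that a' [of "Idn Z x"] o' by (auto intro!: Arr_eqI)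
    show "FAr ?F (h \<cdot>\<^bsub>Z\<^esub> k) = FAr ?F h \<cdot>\<^bsub>E\<^esub> FAr ?F k"
      if "k \<in> Arr Z" "h \<in> Arr Z" "Dom Z h = Cod Z k" for h k
      using that a' [of "h \<cdot>\<^bsub>Z\<^esub> k"] a' ends by (auto intro!: Arr_eqI)
  qed (use o' a' ends in auto)
  moreover have "fcompose Z p ?F = f"
    by (rule functor_eqI [OF is_functor_fcompose [OF F p.is_functor_axioms] assms(1)])
      (use o' a' in auto)
  moreover have "fcompose Z q ?F = g"
    by (rule functor_eqI [OF is_functor_fcompose [OF F q.is_functor_axioms] assms(2)])
      (use o' a' in auto)
  ultimately show ?thesis using that by blast
qed

lemma nat_trans_pairing:
  assumes "is_functor Z E F" "is_functor Z E G"
    and "nat_trans Z C (fcompose Z p F) (fcompose Z p G) a"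
    and "nat_trans Z D (fcompose Z q F) (fcompose Z q G) b"
  obtains c where "nat_trans Z E F G c" "\<forall>x\<in>Obj Z. FAr p (c x) = a x" "\<forall>x\<in>Obj Z. FAr q (c x) = b x"
proof -
  interpret F: is_functor Z E F by fact
  interpret G: is_functor Z E G by fact
  interpret a: nat_trans Z C "fcompose Z p F" "fcompose Z p G" a by fact
  interpret b: nat_trans Z D "fcompose Z q F" "fcompose Z q G" b by fact
  have "\<forall>x\<in>Obj Z. \<exists>z. z \<in> Arr E \<and> FAr p z = a x \<and> FAr q z = b x"
    by (metis Arr_exists a.component_Arr b.component_Arr)
  then obtain c where c: "\<And>x. x \<in> Obj Z \<Longrightarrow> c x \<in> Arr E \<and> FAr p (c x) = a x \<and> FAr q (c x) = b x"
    by metis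
  have ends: "Dom E (c x) = FOb F x" "Cod E (c x) = FOb G x" if "x \<in> Obj Z" for x
    using that c [OF that] by
        (auto intro!: Obj_eqI simp flip: p.Dom_FAr q.Dom_FAr p.Cod_FAr q.Cod_FAr)
  have "nat_trans Z E F G (restrict c (Obj Z))"
  proof (rule nat_transI [OF assms(1,2)])
    fix f assume f: "f \<in> Arr Z"
    have "c (Cod Z f) \<cdot>\<^bsub>E\<^esub> FAr F f = FAr G f \<cdot>\<^bsub>E\<^esub> c (Dom Z f)"
      using f c ends a.naturality [OF f] b.naturality [OF f] by (auto intro!: Arr_eqI)
    then show "restrict c (Obj Z) (Cod Z f) \<cdot>\<^bsub>E\<^esub> FAr F f = FAr G f \<cdot>\<^bsub>E\<^esub> restrict c (Obj Z) (Dom Z f)"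
      using f by simp
  qed (use c ends in auto)
  then show ?thesis using that c by simp
qed

end

section \<open>Categories of tagged arrows\<close>

lemma Obj_arrow_category [simp]: "Obj (arrow_category S H i c) = S"
  by (simp add: arrow_category_def Let_def)

lemma Arr_arrow_category:
  "Arr (arrow_category S H i c) = {a. src a \<in> S \<and> tgt a \<in> S \<and> under a \<in> H (src a) (tgt a)}"
  by (simp add: arrow_category_def Let_def)

lemma Arrow_in_Arr [simp]:
  "Arrow f g t \<in> Arr (arrow_category S H i c) \<longleftrightarrow> f \<in> S \<and> g \<in> S \<and> t \<in> H f g"
  by (simp add: Arr_arrow_category)

lemma arrow_category_simps [simp]:
  "a \<in> Arr (arrow_category S H i c) \<Longrightarrow> Dom (arrow_category S H i c) a = src a"
  "a \<in> Arr (arrow_category S H i c) \<Longrightarrow> Cod (arrow_category S H i c) a = tgt a"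
  "x \<in> S \<Longrightarrow> Idn (arrow_category S H i c) x = Arrow x x (i x)"
  "\<lbrakk>a \<in> Arr (arrow_category S H i c); b \<in> Arr (arrow_category S H i c); src b = tgt a\<rbrakk> \<Longrightarrow>
    b \<cdot>\<^bsub>arrow_category S H i c\<^esub> a = Arrow (src a) (tgt b) (c (under b) (under a))"
  by (simp_all add: arrow_category_def Let_def)

lemma category_arrow_category:
  assumes "\<And>x. x \<in> S \<Longrightarrow> i x \<in> H x x"
    and "\<And>x y z t u. \<lbrakk>x \<in> S; y \<in> S; z \<in> S; t \<in> H x y; u \<in> H y z\<rbrakk> \<Longrightarrow> c u t \<in> H x z"
    and "\<And>x y t. \<lbrakk>x \<in> S; y \<in> S; t \<in> H x y\<rbrakk> \<Longrightarrow> c t (i x) = t"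
    and "\<And>x y t. \<lbrakk>x \<in> S; y \<in> S; t \<in> H x y\<rbrakk> \<Longrightarrow> c (i y) t = t"
    and "\<And>w x y z t u v. \<lbrakk>w \<in> S; x \<in> S; y \<in> S; z \<in> S; t \<in> H w x; u \<in> H x y; v \<in> H y z\<rbrakk>
      \<Longrightarrow> c (c v u) t = c v (c u t)"
  shows "category (arrow_category S H i c)"
proof -
  have 1: "c (under b) (under a) \<in> H (src a) (tgt b)"
    if "a \<in> Arr (arrow_category S H i c)" "b \<in> Arr (arrow_category S H i c)" "src b = tgt a" for a b
    using that assms(2) [of "src a" "tgt a" "tgt b" "under a" "under b"]
    by (simp add: Arr_arrow_category)
  show ?thesis
  proof
    show "\<not> (f \<in> Arr (arrow_category S H i c) \<and> g \<in> Arr (arrow_category S H i c) \<and>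
      Dom (arrow_category S H i c) g = Cod (arrow_category S H i c) f) \<Longrightarrow>
      g \<cdot>\<^bsub>arrow_category S H i c\<^esub> f = undefined" for f g
      by (auto simp: arrow_category_def Let_def)
  qed (use assms 1 in \<open>auto simp: arrow_category_def Let_def split: arrow.splits
        intro!: arrow.expand\<close>)
qed

text \<open>The composition functors of both 2-categories below have the shape treated here: \<open>m\<close> composes
  1-cells and \<open>n\<close> is the horizontal composite of 2-cells; the last hypothesis is interchange.\<close>

lemma is_functor_arrow_composition:
  fixes S1 H1 i1 c1 S2 H2 i2 c2 S3 H3 i3 c3
  defines "K1 \<equiv> arrow_category S1 H1 i1 c1" and "K2 \<equiv> arrow_category S2 H2 i2 c2"
    and "K3 \<equiv> arrow_category S3 H3 i3 c3"
  assumes "category K1" "category K2" "category K3"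
    and m: "\<And>g f. \<lbrakk>g \<in> S1; f \<in> S2\<rbrakk> \<Longrightarrow> m g f \<in> S3"
    and n: "\<And>g g' u f f' t. \<lbrakk>g \<in> S1; g' \<in> S1; u \<in> H1 g g'; f \<in> S2; f' \<in> S2; t \<in> H2 f f'\<rbrakk>
      \<Longrightarrow> n (Arrow g g' u) (Arrow f f' t) \<in> H3 (m g f) (m g' f')"
    and n_id: "\<And>g f. \<lbrakk>g \<in> S1; f \<in> S2\<rbrakk>
      \<Longrightarrow> n (Arrow g g (i1 g)) (Arrow f f (i2 f)) = i3 (m g f)"
    and n_comp: "\<And>g g' g'' u u' f f' f'' t t'. \<lbrakk>g \<in> S1; g' \<in> S1; g'' \<in> S1; u \<in> H1 g g'; u' \<in> H1 g'
        g'';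
        f \<in> S2; f' \<in> S2; f'' \<in> S2; t \<in> H2 f f'; t' \<in> H2 f' f''\<rbrakk>
      \<Longrightarrow> n (Arrow g g'' (c1 u' u)) (Arrow f f'' (c2 t' t)) =
        c3 (n (Arrow g' g'' u') (Arrow f' f'' t')) (n (Arrow g g' u) (Arrow f f' t))"
  shows "is_functor (prod_category K1 K2) K3
    \<lparr>FOb = (\<lambda>(g, f)\<in>S1 \<times> S2. m g f),
     FAr = (\<lambda>(b, a)\<in>Arr K1 \<times> Arr K2. Arrow (m (src b) (src a)) (m (tgt b) (tgt a)) (n b a))\<rparr>"
proof (rule is_functorI)
  show "category (prod_category K1 K2)" "category K3"
    using assms(4-6) category_prod_category by auto
  note defs = K1_def K2_def K3_def
  interpret K1: category K1 by fact
  interpret K2: category K2 by fact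
  fix x f g
  let ?F = "\<lparr>FOb = (\<lambda>(g, f)\<in>S1 \<times> S2. m g f),
     FAr = (\<lambda>(b, a)\<in>Arr K1 \<times> Arr K2. Arrow (m (src b) (src a)) (m (tgt b) (tgt a)) (n b a))\<rparr>"
  have nin: "Arrow (m (src b) (src a)) (m (tgt b) (tgt a)) (n b a) \<in> Arr K3"
    if "b \<in> Arr K1" "a \<in> Arr K2" for b a
    using that m n [of "src b" "tgt b" "under b" "src a" "tgt a" "under a"]
    by (auto simp: defs Arr_arrow_category)
  { assume "f \<in> Arr (prod_category K1 K2)"
    then show "FAr ?F f \<in> Arr K3" "Dom K3 (FAr ?F f) = FOb ?F (Dom (prod_category K1 K2) f)"
      "Cod K3 (FAr ?F f) = FOb ?F (Cod (prod_category K1 K2) f)"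
      using nin by (auto simp: defs) (auto simp: Arr_arrow_category) }
  { assume "x \<in> Obj (prod_category K1 K2)"
    then show "FOb ?F x \<in> Obj K3" "FAr ?F (Idn (prod_category K1 K2) x) = Idn K3 (FOb ?F x)"
      using K1.Idn_Arr K2.Idn_Arr by (auto simp: defs n_id m) }
  { assume "f \<in> Arr (prod_category K1 K2)" "g \<in> Arr (prod_category K1 K2)"
      "Dom (prod_category K1 K2) g = Cod (prod_category K1 K2) f"
    then obtain b a b' a' where fg: "f = (b, a)" "g = (b', a')" "b \<in> Arr K1" "a \<in> Arr K2"
      "b' \<in> Arr K1" "a' \<in> Arr K2" "src b' = tgt b" "src a' = tgt a"
      by (auto simp: defs)
    have "n (b' \<cdot>\<^bsub>K1\<^esub> b) (a' \<cdot>\<^bsub>K2\<^esub> a) = c3 (n b' a') (n b a)"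
      using fg n_comp [of "src b" "tgt b" "tgt b'" "under b" "under b'"
          "src a" "tgt a" "tgt a'" "under a" "under a'"]
      by (cases b; cases b'; cases a; cases a') (auto simp: defs)
    moreover have "b' \<cdot>\<^bsub>K1\<^esub> b \<in> Arr K1" "a' \<cdot>\<^bsub>K2\<^esub> a \<in> Arr K2"
      using fg by (intro K1.Comp_in K2.Comp_in; simp add: defs)+
    moreover have "src (b' \<cdot>\<^bsub>K1\<^esub> b) = src b" "tgt (b' \<cdot>\<^bsub>K1\<^esub> b) = tgt b'"
      "src (a' \<cdot>\<^bsub>K2\<^esub> a) = src a" "tgt (a' \<cdot>\<^bsub>K2\<^esub> a) = tgt a'"
      using fg by (auto simp: defs)
    ultimately show "FAr ?F (g \<cdot>\<^bsub>prod_category K1 K2\<^esub> f) = FAr ?F g \<cdot>\<^bsub>K3\<^esub> FAr ?F f"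
      using fg nin [of b a] nin [of b' a'] by (auto simp: K3_def) (auto simp: defs) }
qed (auto simp: K1_def K2_def)

section \<open>Strict 2-categories: products up to isomorphism\<close>

context strict_2_category
begin

lemma comp1_in:
  assumes "X \<in> Ob2 A" "Y \<in> Ob2 A" "Z \<in> Ob2 A" "f \<in> Obj (Hom2 A X Y)" "g \<in> Obj (Hom2 A Y Z)"
  shows "comp1 A X Y Z g f \<in> Obj (Hom2 A X Z)"
  using is_functor.FOb_Obj [OF Comp_functor [OF assms(1-3)]] assms by simp

text \<open>Functoriality of pairing is inherited from the composition functors, so the universal
  property of a strict product below asks only for unique existence of 1-cells and 2-cells.\<close>

lemma is_functor_pairing_functor:
  assumes "X \<in> Ob2 A" "Y \<in> Ob2 A" "P \<in> Ob2 A" "Z \<in> Ob2 A"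
    and p: "p \<in> Obj (Hom2 A P X)" and q: "q \<in> Obj (Hom2 A P Y)"
  shows "is_functor (Hom2 A Z P) (prod_category (Hom2 A Z X) (Hom2 A Z Y))
    (pairing_functor A X Y P p q Z)"
proof -
  interpret ZP: category "Hom2 A Z P" using Hom_category assms by blast
  interpret PX: category "Hom2 A P X" using Hom_category assms by blast
  interpret PY: category "Hom2 A P Y" using Hom_category assms by blast
  interpret X: is_functor "prod_category (Hom2 A P X) (Hom2 A Z P)" "Hom2 A Z X" "Comp2 A Z P X"
    using Comp_functor assms by blast
  interpret Y: is_functor "prod_category (Hom2 A P Y) (Hom2 A Z P)" "Hom2 A Z Y" "Comp2 A Z P Y"
    using Comp_functor assms by blast
  have id: "comp2 A Z P X (Idn (Hom2 A P X) p) (Idn (Hom2 A Z P) f) =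
      Idn (Hom2 A Z X) (comp1 A Z P X p f)"
    "comp2 A Z P Y (Idn (Hom2 A P Y) q) (Idn (Hom2 A Z P) f) = Idn (Hom2 A Z Y) (comp1 A Z P Y q f)"
    if "f \<in> Obj (Hom2 A Z P)" for f
    using that p q X.FAr_Idn [of "(p, f)"] Y.FAr_Idn [of "(q, f)"] by simp_all
  have comp: "comp2 A Z P X (Idn (Hom2 A P X) p) (b \<cdot>\<^bsub>Hom2 A Z P\<^esub> a) =
      comp2 A Z P X (Idn (Hom2 A P X) p) b \<cdot>\<^bsub>Hom2 A Z X\<^esub> comp2 A Z P X (Idn (Hom2 A P X) p) a"
    "comp2 A Z P Y (Idn (Hom2 A P Y) q) (b \<cdot>\<^bsub>Hom2 A Z P\<^esub> a) =
      comp2 A Z P Y (Idn (Hom2 A P Y) q) b \<cdot>\<^bsub>Hom2 A Z Y\<^esub> comp2 A Z P Y (Idn (Hom2 A P Y) q) a"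
    if "a \<in> Arr (Hom2 A Z P)" "b \<in> Arr (Hom2 A Z P)"
        "Dom (Hom2 A Z P) b = Cod (Hom2 A Z P) a" for a b
    using that p q X.FAr_Comp [of "(Idn (Hom2 A P X) p, a)" "(Idn (Hom2 A P X) p, b)"]
      Y.FAr_Comp [of "(Idn (Hom2 A P Y) q, a)" "(Idn (Hom2 A P Y) q, b)"] by simp_all
  show ?thesis
    by (rule is_functorI)
      (auto simp: pairing_functor_def p q id comp intro!: category_prod_category Hom_category assms)
qed

lemma strict_productI:
  assumes "X \<in> Ob2 A" "Y \<in> Ob2 A" "P \<in> Ob2 A"
    and p: "p \<in> Obj (Hom2 A P X)" and q: "q \<in> Obj (Hom2 A P Y)"
    and ex1: "\<And>Z f g. \<lbrakk>Z \<in> Ob2 A; f \<in> Obj (Hom2 A Z X); g \<in> Obj (Hom2 A Z Y)\<rbrakk> \<Longrightarrow>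
      \<exists>h\<in>Obj (Hom2 A Z P). comp1 A Z P X p h = f \<and> comp1 A Z P Y q h = g"
    and un1: "\<And>Z h k. \<lbrakk>Z \<in> Ob2 A; h \<in> Obj (Hom2 A Z P); k \<in> Obj (Hom2 A Z P);
      comp1 A Z P X p h = comp1 A Z P X p k; comp1 A Z P Y q h = comp1 A Z P Y q k\<rbrakk> \<Longrightarrow> h = k"
    and ex2: "\<And>Z a b. \<lbrakk>Z \<in> Ob2 A; a \<in> Arr (Hom2 A Z X); b \<in> Arr (Hom2 A Z Y)\<rbrakk> \<Longrightarrow>
      \<exists>c\<in>Arr (Hom2 A Z P). comp2 A Z P X (Idn (Hom2 A P X) p) c = a \<and>
        comp2 A Z P Y (Idn (Hom2 A P Y) q) c = b"
    and un2: "\<And>Z c d. \<lbrakk>Z \<in> Ob2 A; c \<in> Arr (Hom2 A Z P); d \<in> Arr (Hom2 A Z P);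
      comp2 A Z P X (Idn (Hom2 A P X) p) c = comp2 A Z P X (Idn (Hom2 A P X) p) d;
      comp2 A Z P Y (Idn (Hom2 A P Y) q) c = comp2 A Z P Y (Idn (Hom2 A P Y) q) d\<rbrakk> \<Longrightarrow> c = d"
  shows "strict_product A X Y P p q"
proof -
  have "iso_of_categories (Hom2 A Z P) (prod_category (Hom2 A Z X) (Hom2 A Z Y))
       (pairing_functor A X Y P p q Z)" if Z: "Z \<in> Ob2 A" for Z
  proof -
    interpret F: is_functor "Hom2 A Z P" "prod_category (Hom2 A Z X) (Hom2 A Z Y)"
      "pairing_functor A X Y P p q Z"
      by (rule is_functor_pairing_functor; fact)
    show ?thesis
    proof (rule iso_of_categoriesI [OF F.is_functor_axioms])
      show "bij_betw (FOb (pairing_functor A X Y P p q Z)) (Obj (Hom2 A Z P))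
        (Obj (prod_category (Hom2 A Z X) (Hom2 A Z Y)))"
        unfolding bij_betw_def
      proof
        show "inj_on (FOb (pairing_functor A X Y P p q Z)) (Obj (Hom2 A Z P))"
          using un1 [OF Z] by (auto simp: inj_on_def pairing_functor_def)
        show "FOb (pairing_functor A X Y P p q Z) ` Obj (Hom2 A Z P) =
          Obj (prod_category (Hom2 A Z X) (Hom2 A Z Y))"
        proof
          show "FOb (pairing_functor A X Y P p q Z) ` Obj (Hom2 A Z P) \<subseteq>
            Obj (prod_category (Hom2 A Z X) (Hom2 A Z Y))"
            using F.FOb_Obj by blast
        qed (use ex1 [OF Z] in \<open>force simp: pairing_functor_def\<close>)
      qed
      show "bij_betw (FAr (pairing_functor A X Y P p q Z)) (Arr (Hom2 A Z P))
        (Arr (prod_category (Hom2 A Z X) (Hom2 A Z Y)))"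
        unfolding bij_betw_def
      proof
        show "inj_on (FAr (pairing_functor A X Y P p q Z)) (Arr (Hom2 A Z P))"
          using un2 [OF Z] by (auto simp: inj_on_def pairing_functor_def)
        show "FAr (pairing_functor A X Y P p q Z) ` Arr (Hom2 A Z P) =
          Arr (prod_category (Hom2 A Z X) (Hom2 A Z Y))"
        proof
          show "FAr (pairing_functor A X Y P p q Z) ` Arr (Hom2 A Z P) \<subseteq>
            Arr (prod_category (Hom2 A Z X) (Hom2 A Z Y))"
            using F.FAr_Arr by blast
        qed (use ex2 [OF Z] in \<open>force simp: pairing_functor_def\<close>)
      qed
    qed
  qed
  then show ?thesis
    using assms by (auto simp: strict_product_def)
qed

lemma strict_productD:
  assumes "strict_product A X Y P p q" "Z \<in> Ob2 A"
  shows "bij_betw (\<lambda>f. (comp1 A Z P X p f, comp1 A Z P Y q f)) (Obj (Hom2 A Z P))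
    (Obj (Hom2 A Z X) \<times> Obj (Hom2 A Z Y))"
proof -
  have "bij_betw (FOb (pairing_functor A X Y P p q Z)) (Obj (Hom2 A Z P))
    (Obj (prod_category (Hom2 A Z X) (Hom2 A Z Y)))"
    using assms by (intro iso_of_categories_bij_Obj) (simp add: strict_product_def)
  then show ?thesis by (simp add: pairing_functor_def cong: bij_betw_cong) simp
qed

lemma strict_product_pairing:
  assumes "strict_product A X Y P p q" "Z \<in> Ob2 A" "f \<in> Obj (Hom2 A Z X)" "g \<in> Obj (Hom2 A Z Y)"
  obtains h where "h \<in> Obj (Hom2 A Z P)" "comp1 A Z P X p h = f" "comp1 A Z P Y q h = g"
proof -
  have "(f, g) \<in> (\<lambda>f. (comp1 A Z P X p f, comp1 A Z P Y q f)) ` Obj (Hom2 A Z P)"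
    using strict_productD [OF assms(1,2)] assms(3,4) by (auto simp: bij_betw_def)
  then show ?thesis using that by auto
qed

lemma strict_product_joint:
  assumes "strict_product A X Y P p q" "Z \<in> Ob2 A" "h \<in> Obj (Hom2 A Z P)" "k \<in> Obj (Hom2 A Z P)"
    "comp1 A Z P X p h = comp1 A Z P X p k" "comp1 A Z P Y q h = comp1 A Z P Y q k"
  shows "h = k"
  using strict_productD [OF assms(1,2)] assms(3-) by (auto simp: bij_betw_def inj_on_def)

text \<open>The usual argument: the two mediating morphisms are mutually inverse because both composites
  agree with a unit after each projection.\<close>

lemma strict_product_comparison:
  assumes "X \<in> Ob2 A" "Y \<in> Ob2 A" "strict_product A X Y P p q" "strict_product A X Y P' p' q'"
  obtains h where "h \<in> Obj (Hom2 A P P')" "comp1 A P P' X p' h = p" "comp1 A P P' Y q' h = q"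
    "iso_1cell A P P' h"
proof -
  have P: "P \<in> Ob2 A" "p \<in> Obj (Hom2 A P X)" "q \<in> Obj (Hom2 A P Y)"
    and P': "P' \<in> Ob2 A" "p' \<in> Obj (Hom2 A P' X)" "q' \<in> Obj (Hom2 A P' Y)"
    using assms by (auto simp: strict_product_def)
  obtain h where h: "h \<in> Obj (Hom2 A P P')" "comp1 A P P' X p' h = p" "comp1 A P P' Y q' h = q"
    using strict_product_pairing [OF assms(4) P] .
  obtain k where k: "k \<in> Obj (Hom2 A P' P)" "comp1 A P' P X p k = p'" "comp1 A P' P Y q k = q'"
    using strict_product_pairing [OF assms(3) P'] .
  note ob = assms(1,2) P P' h(1) k(1)
  have "comp1 A P P' P k h = Unit2 A P"
    by (rule strict_product_joint [OF assms(3) P(1)])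
      (simp_all add: ob comp1_in [of P P' P] Unit_in unit_right_1 h k flip: assoc_1)
  moreover have "comp1 A P' P P' h k = Unit2 A P'"
    by (rule strict_product_joint [OF assms(4) P'(1)])
      (simp_all add: ob comp1_in [of P' P P'] Unit_in unit_right_1 h k flip: assoc_1)
  ultimately show ?thesis using that h k by (auto simp: iso_1cell_def)
qed

lemma iso_1cell_comp:
  assumes "X \<in> Ob2 A" "Y \<in> Ob2 A" "Z \<in> Ob2 A" "iso_1cell A X Y f" "iso_1cell A Y Z g"
  shows "iso_1cell A X Z (comp1 A X Y Z g f)"
proof -
  obtain f' where f: "f \<in> Obj (Hom2 A X Y)" "f' \<in> Obj (Hom2 A Y X)"
    "comp1 A X Y X f' f = Unit2 A X" "comp1 A Y X Y f f' = Unit2 A Y"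
    using assms by (auto simp: iso_1cell_def)
  obtain g' where g: "g \<in> Obj (Hom2 A Y Z)" "g' \<in> Obj (Hom2 A Z Y)"
    "comp1 A Y Z Y g' g = Unit2 A Y" "comp1 A Z Y Z g g' = Unit2 A Z"
    using assms by (auto simp: iso_1cell_def)
  note ob = assms(1-3) f(1,2) g(1,2)
  have gf: "comp1 A X Y Z g f \<in> Obj (Hom2 A X Z)" and gf': "comp1 A Z Y X f' g' \<in> Obj (Hom2 A Z X)"
    using ob by (auto intro: comp1_in)
  have "comp1 A X Z X (comp1 A Z Y X f' g') (comp1 A X Y Z g f) =
      comp1 A X Y X f' (comp1 A X Y Y (comp1 A Y Z Y g' g) f)"
    using ob gf by (simp add: assoc_1)
  moreover have "comp1 A Z X Z (comp1 A X Y Z g f) (comp1 A Z Y X f' g') =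
      comp1 A Z Y Z g (comp1 A Z Y Y (comp1 A Y X Y f f') g')"
    using ob gf' by (simp add: assoc_1)
  ultimately show ?thesis
    using gf gf' ob f g by (auto simp: iso_1cell_def unit_left_1)
qed

lemma strict_final_hom:
  assumes "strict_final A T" "Z \<in> Ob2 A" shows "\<exists>f. Obj (Hom2 A Z T) = {f}"
proof -
  obtain F where "iso_of_categories (Hom2 A Z T) one_category F"
    using assms by (auto simp: strict_final_def)
  then have "bij_betw (FOb F) (Obj (Hom2 A Z T)) {()}"
    using iso_of_categories_bij_Obj by (fastforce simp: one_category_def)
  then have "card (Obj (Hom2 A Z T)) = 1" using bij_betw_same_card by fastforce
  then show ?thesis by (auto simp: card_1_singleton_iff)
qed

lemma strict_final_iso:
  assumes "strict_final A T" "strict_final A T'"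
  obtains h where "iso_1cell A T T' h"
proof -
  have ob: "T \<in> Ob2 A" "T' \<in> Ob2 A" using assms by (auto simp: strict_final_def)
  obtain f g where fg: "Obj (Hom2 A T T') = {f}" "Obj (Hom2 A T' T) = {g}"
    using strict_final_hom assms ob by metis
  have "comp1 A T T' T g f = Unit2 A T"
    using strict_final_hom [OF assms(1) ob(1)] comp1_in [of T T' T f g] Unit_in [of T] ob fg by auto
  moreover have "comp1 A T' T T' f g = Unit2 A T'"
    using strict_final_hom [OF assms(2) ob(2)] comp1_in [of T' T T' g f] Unit_in [of T'] ob fg
        by auto
  ultimately show ?thesis using that fg by (auto simp: iso_1cell_def)
qed

end

context is_two_functor
begin

lemma on_hom_in:
  assumes "X \<in> Ob2 A" "Y \<in> Ob2 A" "f \<in> Obj (Hom2 A X Y)"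
  shows "FOb (on_hom \<Phi> X Y) f \<in> Obj (Hom2 B (on_obj \<Phi> X) (on_obj \<Phi> Y))"
  using is_functor.FOb_Obj [OF on_hom_functor] assms by blast

lemma iso_1cell_image:
  assumes "X \<in> Ob2 A" "Y \<in> Ob2 A" "iso_1cell A X Y f"
  shows "iso_1cell B (on_obj \<Phi> X) (on_obj \<Phi> Y) (FOb (on_hom \<Phi> X Y) f)"
proof -
  obtain g where g: "f \<in> Obj (Hom2 A X Y)" "g \<in> Obj (Hom2 A Y X)"
    "comp1 A X Y X g f = Unit2 A X" "comp1 A Y X Y f g = Unit2 A Y"
    using assms by (auto simp: iso_1cell_def)
  then show ?thesis
    using assms(1,2) on_hom_comp1 [of X Y X f g] on_hom_comp1 [of Y X Y g f]
    by (auto simp: iso_1cell_def on_hom_in on_hom_unit intro!: bexI [of _ "FOb (on_hom \<Phi> Y X) g"])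
qed

text \<open>Products and final objects are unique up to isomorphism, and 2-functors preserve
  isomorphisms; hence preservation needs to be checked for one choice of product per pair
  of objects.\<close>

lemma preserves_strict_finite_productsI:
  assumes prod: "\<And>X Y. \<lbrakk>X \<in> Ob2 A; Y \<in> Ob2 A\<rbrakk> \<Longrightarrow> \<exists>P p q. strict_product A X Y P p q \<and>
      strict_product B (on_obj \<Phi> X) (on_obj \<Phi> Y) (on_obj \<Phi> P)
        (FOb (on_hom \<Phi> P X) p) (FOb (on_hom \<Phi> P Y) q)"
    and final: "\<exists>T. strict_final A T \<and> strict_final B (on_obj \<Phi> T)"
  shows "preserves_strict_finite_products A B \<Phi>"
  unfolding preserves_strict_finite_products_def
proof (intro conjI ballI allI impI)
  fix X Y P p q P' p' q'
  assume XY: "X \<in> Ob2 A" "Y \<in> Ob2 A" and P: "strict_product A X Y P p q"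
    and P': "strict_product B (on_obj \<Phi> X) (on_obj \<Phi> Y) P' p' q'"
  obtain R r s where R: "strict_product A X Y R r s"
    and BR: "strict_product B (on_obj \<Phi> X) (on_obj \<Phi> Y) (on_obj \<Phi> R)
        (FOb (on_hom \<Phi> R X) r) (FOb (on_hom \<Phi> R Y) s)"
    using prod [OF XY] by blast
  obtain h where h: "h \<in> Obj (Hom2 A P R)" "comp1 A P R X r h = p" "comp1 A P R Y s h = q"
    "iso_1cell A P R h"
    using source.strict_product_comparison [OF XY P R] .
  obtain k where k: "k \<in> Obj (Hom2 B (on_obj \<Phi> R) P')"
    "comp1 B (on_obj \<Phi> R) P' (on_obj \<Phi> X) p' k = FOb (on_hom \<Phi> R X) r"
    "comp1 B (on_obj \<Phi> R) P' (on_obj \<Phi> Y) q' k = FOb (on_hom \<Phi> R Y) s"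
    "iso_1cell B (on_obj \<Phi> R) P' k"
    using target.strict_product_comparison [OF on_obj_in [OF XY(1)] on_obj_in [OF XY(2)] BR P'] .
  have ob: "P \<in> Ob2 A" "R \<in> Ob2 A" "P' \<in> Ob2 B" "r \<in> Obj (Hom2 A R X)" "s \<in> Obj (Hom2 A R Y)"
    "p' \<in> Obj (Hom2 B P' (on_obj \<Phi> X))" "q' \<in> Obj (Hom2 B P' (on_obj \<Phi> Y))"
    using P R P' by (auto simp: strict_product_def)
  define l where "l = comp1 B (on_obj \<Phi> P) (on_obj \<Phi> R) P' k (FOb (on_hom \<Phi> P R) h)"
  have "l \<in> Obj (Hom2 B (on_obj \<Phi> P) P')"
    unfolding l_def using ob h k by (auto intro!: target.comp1_in on_obj_in on_hom_in)
  moreover have "comp1 B (on_obj \<Phi> P) P' (on_obj \<Phi> X) p' l = FOb (on_hom \<Phi> P X) p"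
    using ob h k XY on_hom_comp1 [of P R X h r]
    by (simp add: l_def on_obj_in on_hom_in flip: target.assoc_1)
  moreover have "comp1 B (on_obj \<Phi> P) P' (on_obj \<Phi> Y) q' l = FOb (on_hom \<Phi> P Y) q"
    using ob h k XY on_hom_comp1 [of P R Y h s]
    by (simp add: l_def on_obj_in on_hom_in flip: target.assoc_1)
  moreover have "iso_1cell B (on_obj \<Phi> P) P' l"
    unfolding l_def using ob h k by (auto intro!: target.iso_1cell_comp iso_1cell_image on_obj_in)
  ultimately show "\<exists>h\<in>Obj (Hom2 B (on_obj \<Phi> P) P').
      comp1 B (on_obj \<Phi> P) P' (on_obj \<Phi> X) p' h = FOb (on_hom \<Phi> P X) p \<and>
      comp1 B (on_obj \<Phi> P) P' (on_obj \<Phi> Y) q' h = FOb (on_hom \<Phi> P Y) q \<and>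
      iso_1cell B (on_obj \<Phi> P) P' h" by blast
next
  fix T T' assume T: "strict_final A T" and T': "strict_final B T'"
  obtain U where U: "strict_final A U" "strict_final B (on_obj \<Phi> U)" using final by blast
  obtain h where h: "iso_1cell A T U h" using source.strict_final_iso [OF T U(1)] .
  obtain k where k: "iso_1cell B (on_obj \<Phi> U) T' k" using target.strict_final_iso [OF U(2) T'] .
  have "T \<in> Ob2 A" "U \<in> Ob2 A" "T' \<in> Ob2 B" using T U T' by (auto simp: strict_final_def)
  then have "iso_1cell B (on_obj \<Phi> T) T'
      (comp1 B (on_obj \<Phi> T) (on_obj \<Phi> U) T' k (FOb (on_hom \<Phi> T U) h))"
    using h k by (auto intro!: target.iso_1cell_comp iso_1cell_image on_obj_in)
  then show "\<exists>h\<in>Obj (Hom2 B (on_obj \<Phi> T) T'). iso_1cell B (on_obj \<Phi> T) T' h"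
    by (auto simp: iso_1cell_def)
qed

end

section \<open>The 2-category of functors\<close>

definition functor_obj :: "('u, 'u, 'u, 'u) functor_obj \<Rightarrow> bool" where
  "functor_obj X \<longleftrightarrow> is_functor (fsrc X) (ftgt X) (ffun X)"

definition commuting_square ::
  "('u, 'u, 'u, 'u) functor_obj \<Rightarrow> ('u, 'u, 'u, 'u) functor_obj \<Rightarrow> 'u square \<Rightarrow> bool" where
  "commuting_square X Y f \<longleftrightarrow>
    is_functor (fsrc X) (fsrc Y) (fst f) \<and> is_functor (ftgt X) (ftgt Y) (snd f) \<and>
    fcompose (fsrc X) (ffun Y) (fst f) = fcompose (fsrc X) (snd f) (ffun X)"

lemma Obj_functors_hom [simp]: "f \<in> Obj (functors_hom X Y) \<longleftrightarrow> commuting_square X Y f"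
  by (auto simp: functors_hom_def commuting_square_def)

lemma square_2cells_iff:
  "t \<in> square_2cells X Y f g \<longleftrightarrow>
    nat_trans (fsrc X) (fsrc Y) (fst f) (fst g) (fst t) \<and>
    nat_trans (ftgt X) (ftgt Y) (snd f) (snd g) (snd t) \<and>
    (\<forall>x\<in>Obj (fsrc X). snd t (FOb (ffun X) x) = FAr (ffun Y) (fst t x))"
  by (auto simp: square_2cells_def split: prod.splits)

lemma functors_hom_eq:
  "functors_hom X Y = arrow_category {f. commuting_square X Y f} (square_2cells X Y)
     (\<lambda>f. (nt_identity (fsrc X) (fsrc Y) (fst f), nt_identity (ftgt X) (ftgt Y) (snd f)))
     (\<lambda>b a. (nt_vcomp (fsrc X) (fsrc Y) (fst b) (fst a), nt_vcomp (ftgt X) (ftgt Y) (snd b) (snd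
       a)))"
  unfolding functors_hom_def commuting_square_def by (simp add: case_prod_unfold)

lemma Arr_functors_hom [simp]:
  "Arrow f g t \<in> Arr (functors_hom X Y) \<longleftrightarrow>
    commuting_square X Y f \<and> commuting_square X Y g \<and> t \<in> square_2cells X Y f g"
  by (simp add: functors_hom_eq)

lemma square_FOb:
  assumes "commuting_square X Y f" "x \<in> Obj (fsrc X)"
  shows "FOb (ffun Y) (FOb (fst f) x) = FOb (snd f) (FOb (ffun X) x)"
  using assms by (metis FOb_fcompose commuting_square_def)

lemma square_FAr:
  assumes "commuting_square X Y f" "x \<in> Arr (fsrc X)"
  shows "FAr (ffun Y) (FAr (fst f) x) = FAr (snd f) (FAr (ffun X) x)"
  using assms by (metis FAr_fcompose commuting_square_def)

lemma category_functors_hom: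
  assumes "functor_obj X" "functor_obj Y" shows "category (functors_hom X Y)"
proof -
  interpret X: is_functor "fsrc X" "ftgt X" "ffun X" using assms by (simp add: functor_obj_def)
  interpret Y: is_functor "fsrc Y" "ftgt Y" "ffun Y" using assms by (simp add: functor_obj_def)
  show ?thesis
    unfolding functors_hom_eq
  proof (rule category_arrow_category; clarify?)
    fix f assume f: "commuting_square X Y f"
    interpret f: is_functor "fsrc X" "fsrc Y" "fst f" using f by (simp add: commuting_square_def)
    interpret f': is_functor "ftgt X" "ftgt Y" "snd f" using f by (simp add: commuting_square_def)
    show "(nt_identity (fsrc X) (fsrc Y) (fst f), nt_identity (ftgt X) (ftgt Y) (snd f))
      \<in> square_2cells X Y f f"
      using f.is_functor_axioms f'.is_functor_axioms
      by (auto simp: square_2cells_iff nat_trans_identity square_FOb [OF f])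
  next
    fix f g h t u
    assume t: "t \<in> square_2cells X Y f g" and u: "u \<in> square_2cells X Y g h"
    interpret t: nat_trans "fsrc X" "fsrc Y" "fst f" "fst g" "fst t"
      using t by (simp add: square_2cells_iff)
    interpret u: nat_trans "fsrc X" "fsrc Y" "fst g" "fst h" "fst u"
      using u by (simp add: square_2cells_iff)
    show "(nt_vcomp (fsrc X) (fsrc Y) (fst u) (fst t), nt_vcomp (ftgt X) (ftgt Y) (snd u) (snd t))
       \<in> square_2cells X Y f h"
      using t u by (auto simp: square_2cells_iff intro: nat_trans_vcomp)
  qed (auto simp: square_2cells_iff prod_eq_iff nt_vcomp_identity_left nt_vcomp_identity_right
      nt_vcomp_assoc)
qed

lemma square_comp_eq:
  "square_comp X g f = (fcompose (fsrc X) (fst g) (fst f), fcompose (ftgt X) (snd g) (snd f))"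
  by (simp add: square_comp_def case_prod_unfold)

lemma commuting_square_comp:
  assumes "functor_obj X" "functor_obj Y" "functor_obj Z"
    and f: "commuting_square X Y f" and g: "commuting_square Y Z g"
  shows "commuting_square X Z (square_comp X g f)"
proof -
  interpret X: is_functor "fsrc X" "ftgt X" "ffun X" using assms by (simp add: functor_obj_def)
  interpret Z: is_functor "fsrc Z" "ftgt Z" "ffun Z" using assms by (simp add: functor_obj_def)
  interpret f: is_functor "fsrc X" "fsrc Y" "fst f" using f by (simp add: commuting_square_def)
  interpret f': is_functor "ftgt X" "ftgt Y" "snd f" using f by (simp add: commuting_square_def)
  interpret g: is_functor "fsrc Y" "fsrc Z" "fst g" using g by (simp add: commuting_square_def)
  interpret g': is_functor "ftgt Y" "ftgt Z" "snd g" using g by (simp add: commuting_square_def)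
  have "fcompose (fsrc X) (ffun Z) (fcompose (fsrc X) (fst g) (fst f)) =
      fcompose (fsrc X) (fcompose (ftgt X) (snd g) (snd f)) (ffun X)"
    by (rule functor_eqI [of _ "ftgt Z" _ "ftgt Z"])
      (auto intro!: is_functor_fcompose f.is_functor_axioms f'.is_functor_axioms
        g.is_functor_axioms g'.is_functor_axioms X.is_functor_axioms Z.is_functor_axioms
        simp: square_FOb [OF f] square_FOb [OF g] square_FAr [OF f] square_FAr [OF g])
  then show ?thesis
    using f g by (auto simp: commuting_square_def square_comp_eq intro: is_functor_fcompose)
qed

definition square_hcomp where
  "square_hcomp X Z b a =
    (nt_hcomp (fsrc X) (fsrc Z) (fst (src b)) (fst (tgt a)) (fst (under b)) (fst (under a)),
     nt_hcomp (ftgt X) (ftgt Z) (snd (src b)) (snd (tgt a)) (snd (under b)) (snd (under a)))"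

lemma square_hcomp_in:
  assumes X: "functor_obj X" and Z: "functor_obj Z"
    and f: "commuting_square X Y f'" and g: "commuting_square Y Z g"
    and t: "t \<in> square_2cells X Y f f'" and u: "u \<in> square_2cells Y Z g g'"
  shows "square_hcomp X Z (Arrow g g' u) (Arrow f f' t)
    \<in> square_2cells X Z (square_comp X g f) (square_comp X g' f')"
proof -
  interpret X: is_functor "fsrc X" "ftgt X" "ffun X" using X by (simp add: functor_obj_def)
  interpret Z: is_functor "fsrc Z" "ftgt Z" "ffun Z" using Z by (simp add: functor_obj_def)
  interpret t: nat_trans "fsrc X" "fsrc Y" "fst f" "fst f'" "fst t"
    using t by (simp add: square_2cells_iff)
  interpret u: nat_trans "fsrc Y" "fsrc Z" "fst g" "fst g'" "fst u"
    using u by (simp add: square_2cells_iff)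
  have "snd u (FOb (snd f') (FOb (ffun X) x)) \<cdot>\<^bsub>ftgt Z\<^esub> FAr (snd g) (snd t (FOb (ffun X) x)) =
      FAr (ffun Z) (fst u (FOb (fst f') x) \<cdot>\<^bsub>fsrc Z\<^esub> FAr (fst g) (fst t x))"
    if [simp]: "x \<in> Obj (fsrc X)" for x
  proof -
    have "snd u (FOb (snd f') (FOb (ffun X) x)) = FAr (ffun Z) (fst u (FOb (fst f') x))"
      using u by (simp add: square_2cells_iff flip: square_FOb [OF f])
    moreover have "FAr (snd g) (snd t (FOb (ffun X) x)) = FAr (ffun Z) (FAr (fst g) (fst t x))"
      using t by (simp add: square_2cells_iff square_FAr [OF g])
    ultimately show ?thesis by simp
  qed
  then show ?thesis
    using t u by (auto simp: square_2cells_iff square_hcomp_def square_comp_eq intro: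
        nat_trans_hcomp)
qed

lemma Functors_simps [simp]:
  "X \<in> Ob2 (Functors small) \<longleftrightarrow> small_category small (fsrc X) \<and> small_category small (ftgt X) \<and>
      functor_obj X"
  "Hom2 (Functors small) = functors_hom"
  "Unit2 (Functors small) X = (fidentity (fsrc X), fidentity (ftgt X))"
  by (auto simp: Functors_def functor_obj_def)

lemma Functors_Comp2:
  "Comp2 (Functors small) X Y Z =
    \<lparr>FOb = (\<lambda>(g, f)\<in>Obj (functors_hom Y Z) \<times> Obj (functors_hom X Y). square_comp X g f),
     FAr = (\<lambda>(b, a)\<in>Arr (functors_hom Y Z) \<times> Arr (functors_hom X Y).
       Arrow (square_comp X (src b) (src a)) (square_comp X (tgt b) (tgt a)) (square_hcomp X Z b
           a))\<rparr>"
  by (simp add: Functors_def square_hcomp_def)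

lemma Functors_comp1 [simp]:
  "\<lbrakk>commuting_square Y Z g; commuting_square X Y f\<rbrakk> \<Longrightarrow>
    comp1 (Functors small) X Y Z g f = square_comp X g f"
  by (simp add: Functors_Comp2)

lemma Functors_comp2 [simp]:
  "\<lbrakk>b \<in> Arr (functors_hom Y Z); a \<in> Arr (functors_hom X Y)\<rbrakk> \<Longrightarrow>
    comp2 (Functors small) X Y Z b a =
      Arrow (square_comp X (src b) (src a)) (square_comp X (tgt b) (tgt a)) (square_hcomp X Z b a)"
  by (simp add: Functors_Comp2)

lemma Idn_functors_hom [simp]:
  "commuting_square X Y f \<Longrightarrow> Idn (functors_hom X Y) f =
    Arrow f f (nt_identity (fsrc X) (fsrc Y) (fst f), nt_identity (ftgt X) (ftgt Y) (snd f))"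
  by (simp add: functors_hom_eq)

lemma is_functor_Functors_Comp2:
  assumes "functor_obj X" "functor_obj Y" "functor_obj Z"
  shows "is_functor (prod_category (functors_hom Y Z) (functors_hom X Y)) (functors_hom X Z)
    (Comp2 (Functors small) X Y Z)"
proof -
  have "is_functor (prod_category (functors_hom Y Z) (functors_hom X Y)) (functors_hom X Z)
    \<lparr>FOb = (\<lambda>(g, f)\<in>{f. commuting_square Y Z f} \<times> {f. commuting_square X Y f}. square_comp X g f),
     FAr = (\<lambda>(b, a)\<in>Arr (functors_hom Y Z) \<times> Arr (functors_hom X Y).
       Arrow (square_comp X (src b) (src a)) (square_comp X (tgt b) (tgt a)) (square_hcomp X Z b
           a))\<rparr>"
    unfolding functors_hom_eq
  proof (rule is_functor_arrow_composition; (fold functors_hom_eq)?; clarify?)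
    fix g f assume "commuting_square Y Z g" "commuting_square X Y f"
    then show "commuting_square X Z (square_comp X g f)"
      using commuting_square_comp assms by blast
  next
    fix g g' u f f' t
    assume "commuting_square Y Z g" "commuting_square X Y f'"
      "u \<in> square_2cells Y Z g g'" "t \<in> square_2cells X Y f f'"
    then show "square_hcomp X Z (Arrow g g' u) (Arrow f f' t)
      \<in> square_2cells X Z (square_comp X g f) (square_comp X g' f')"
      using square_hcomp_in assms by blast
  qed (auto simp: category_functors_hom assms square_hcomp_def square_comp_eq square_2cells_iff
      commuting_square_def nt_hcomp_identity nt_interchange)
  moreover have "{f. commuting_square Y Z f} = Obj (functors_hom Y Z)"
    "{f. commuting_square X Y f} = Obj (functors_hom X Y)" by auto
  ultimately show ?thesis by (simp only: Functors_Comp2)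
qed

lemma commuting_square_identity:
  assumes "functor_obj X" shows "commuting_square X X (fidentity (fsrc X), fidentity (ftgt X))"
  using assms is_functorD [of "fsrc X" "ftgt X" "ffun X"]
  by (auto simp: commuting_square_def functor_obj_def is_functor_fidentity
      fcompose_fidentity_left fcompose_fidentity_right)

lemma strict_2_category_Functors: "strict_2_category (Functors small)"
proof (rule strict_2_category.intro)
  let ?A = "Functors small"
  fix W X Y Z :: "('a, 'a, 'a, 'a) functor_obj" and f g h
  assume WX: "W \<in> Ob2 ?A" "X \<in> Ob2 ?A"
  then have fo: "functor_obj W" "functor_obj X" by auto
  show "category (Hom2 ?A W X)" using fo by (simp add: category_functors_hom)
  show "Unit2 ?A W \<in> Obj (Hom2 ?A W W)"
    using fo by (simp add: commuting_square_identity)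
  { assume f: "f \<in> Obj (Hom2 ?A W X)"
    then have "is_functor (fsrc W) (fsrc X) (fst f)" "is_functor (ftgt W) (ftgt X) (snd f)"
      by (auto simp: commuting_square_def)
    then show "comp1 ?A W X X (Unit2 ?A X) f = f"
      "comp1 ?A W W X f (Unit2 ?A W) = f"
      using f fo by (auto simp: commuting_square_identity square_comp_eq
          fcompose_fidentity_left fcompose_fidentity_right prod_eq_iff) }
  assume Y: "Y \<in> Ob2 ?A"
  show "is_functor (prod_category (Hom2 ?A X Y) (Hom2 ?A W X))
      (Hom2 ?A W Y) (Comp2 ?A W X Y)"
    using fo Y by (simp add: is_functor_Functors_Comp2)
  assume Z: "Z \<in> Ob2 ?A"
  assume fgh: "f \<in> Obj (Hom2 ?A W X)" "g \<in> Obj (Hom2 ?A X Y)"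
    "h \<in> Obj (Hom2 ?A Y Z)"
  then show "comp1 ?A W X Z (comp1 ?A X Y Z h g) f =
      comp1 ?A W Y Z h (comp1 ?A W X Y g f)"
    using fo Y Z commuting_square_comp [of W X Y f g] commuting_square_comp [of X Y Z g h]
    by (auto simp: square_comp_eq commuting_square_def intro: fcompose_assoc)
next
  let ?A = "Functors small"
  fix W X Y Z :: "('a, 'a, 'a, 'a) functor_obj" and a b c
  assume WX: "W \<in> Ob2 ?A" "X \<in> Ob2 ?A"
  then have fo: "functor_obj W" "functor_obj X" by auto
  assume a: "a \<in> Arr (Hom2 ?A W X)"
  obtain f f' t where a': "a = Arrow f f' t" by (cases a)
  have t: "commuting_square W X f" "commuting_square W X f'" "t \<in> square_2cells W X f f'"
    using a by (auto simp: a')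
  have is_f: "is_functor (fsrc W) (fsrc X) (fst f)" "is_functor (ftgt W) (ftgt X) (snd f)"
    "is_functor (fsrc W) (fsrc X) (fst f')" "is_functor (ftgt W) (ftgt X) (snd f')"
    using t by (auto simp: commuting_square_def)
  show "comp2 ?A W X X (Idn (Hom2 ?A X X) (Unit2 ?A X)) a = a"
    "comp2 ?A W W X a (Idn (Hom2 ?A W W) (Unit2 ?A W)) = a"
    using a fo t category.Idn_Arr [OF category_functors_hom, of X X
        "(fidentity (fsrc X), fidentity (ftgt X))"]
      category.Idn_Arr [OF category_functors_hom, of W W "(fidentity (fsrc W), fidentity (ftgt W))"]
      is_f
    by (auto simp: a' commuting_square_identity square_comp_eq square_2cells_iff square_hcomp_def
        fcompose_fidentity_left fcompose_fidentity_right
        nt_hcomp_unit_left nt_hcomp_unit_right prod_eq_iff)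
  assume YZ: "Y \<in> Ob2 ?A" "Z \<in> Ob2 ?A"
    and b: "b \<in> Arr (Hom2 ?A X Y)" and c: "c \<in> Arr (Hom2 ?A Y Z)"
  obtain g g' u where b': "b = Arrow g g' u" by (cases b)
  obtain h h' v where c': "c = Arrow h h' v" by (cases c)
  have u: "commuting_square X Y g" "commuting_square X Y g'" "u \<in> square_2cells X Y g g'"
    and v: "commuting_square Y Z h" "commuting_square Y Z h'" "v \<in> square_2cells Y Z h h'"
    using b c by (auto simp: b' c')
  have fo': "functor_obj Y" "functor_obj Z" using YZ by auto
  show "comp2 ?A W X Z (comp2 ?A X Y Z c b) a =
      comp2 ?A W Y Z c (comp2 ?A W X Y b a)"
    using square_hcomp_in [OF fo(1) fo'(1) t(2) u(1) t(3) u(3)]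
      square_hcomp_in [OF fo(2) fo'(2) u(2) v(1) u(3) v(3)] t u v
      commuting_square_comp [OF fo fo'(1) t(1) u(1)] commuting_square_comp [OF fo fo'(1) t(2) u(2)]
      commuting_square_comp [OF fo(2) fo' u(1) v(1)] commuting_square_comp [OF fo(2) fo' u(2) v(2)]
    by (simp add: a' b' c')
      (auto simp: square_comp_eq commuting_square_def square_hcomp_def square_2cells_iff
        intro!: fcompose_assoc nt_hcomp_assoc)
qed

section \<open>Products of functors\<close>

text \<open>Products in the 2-category of functors are formed separately on sources and targets. The mediating
  1-cells and 2-cells commute with the functors because this can be tested after projecting.\<close>

lemma strict_product_Functors:
  assumes ob: "X \<in> Ob2 (Functors small)" "Y \<in> Ob2 (Functors small)" "P \<in> Ob2 (Functors small)"
    and p: "commuting_square P X p" and q: "commuting_square P Y q"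
    and src: "product_cone (fsrc P) (fsrc X) (fsrc Y) (fst p) (fst q)"
    and tgt: "product_cone (ftgt P) (ftgt X) (ftgt Y) (snd p) (snd q)"
  shows "strict_product (Functors small) X Y P p q"
proof -
  let ?A = "Functors small"
  interpret strict_2_category ?A by (rule strict_2_category_Functors)
  interpret s: product_cone "fsrc P" "fsrc X" "fsrc Y" "fst p" "fst q" by fact
  interpret t: product_cone "ftgt P" "ftgt X" "ftgt Y" "snd p" "snd q" by fact
  interpret P: is_functor "fsrc P" "ftgt P" "ffun P" using ob by (simp add: functor_obj_def)
  have fo: "functor_obj X" "functor_obj Y" "functor_obj P" using ob by auto
  have ex1: "\<exists>h. commuting_square Z P h \<and> square_comp Z p h = f \<and> square_comp Z q h = g"
    if Z: "functor_obj Z" and f: "commuting_square Z X f" and g: "commuting_square Z Y g" for Z f g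
  proof -
    interpret Z: is_functor "fsrc Z" "ftgt Z" "ffun Z" using Z by (simp add: functor_obj_def)
    obtain h where h: "is_functor (fsrc Z) (fsrc P) h"
      "fcompose (fsrc Z) (fst p) h = fst f" "fcompose (fsrc Z) (fst q) h = fst g"
      using s.functor_pairing [of "fsrc Z" "fst f" "fst g"] f g unfolding commuting_square_def
          by blast
    obtain k where k: "is_functor (ftgt Z) (ftgt P) k"
      "fcompose (ftgt Z) (snd p) k = snd f" "fcompose (ftgt Z) (snd q) k = snd g"
      using t.functor_pairing [of "ftgt Z" "snd f" "snd g"] f g unfolding commuting_square_def
          by blast
    interpret h: is_functor "fsrc Z" "fsrc P" h by fact
    interpret k: is_functor "ftgt Z" "ftgt P" k by fact
    have h': "FOb (fst p) (FOb h x) = FOb (fst f) x" "FOb (fst q) (FOb h x) = FOb (fst g) x"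
      if "x \<in> Obj (fsrc Z)" for x
      using that by (simp_all flip: h(2,3))
    have h'': "FAr (fst p) (FAr h x) = FAr (fst f) x" "FAr (fst q) (FAr h x) = FAr (fst g) x"
      if "x \<in> Arr (fsrc Z)" for x
      using that by (simp_all flip: h(2,3))
    have k': "FOb (snd p) (FOb k x) = FOb (snd f) x" "FOb (snd q) (FOb k x) = FOb (snd g) x"
      if "x \<in> Obj (ftgt Z)" for x
      using that by (simp_all flip: k(2,3))
    have k'': "FAr (snd p) (FAr k x) = FAr (snd f) x" "FAr (snd q) (FAr k x) = FAr (snd g) x"
      if "x \<in> Arr (ftgt Z)" for x
      using that by (simp_all flip: k(2,3))
    have "fcompose (fsrc Z) (ffun P) h = fcompose (fsrc Z) k (ffun Z)"
    proof (rule functor_eqI)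
      show "is_functor (fsrc Z) (ftgt P) (fcompose (fsrc Z) (ffun P) h)"
        "is_functor (fsrc Z) (ftgt P) (fcompose (fsrc Z) k (ffun Z))"
        by (rule is_functor_fcompose; unfold_locales)+
    next
      fix x assume x: "x \<in> Obj (fsrc Z)"
      have "FOb (ffun P) (FOb h x) = FOb k (FOb (ffun Z) x)"
        by (rule t.Obj_eqI) (use x in \<open>auto simp: h' k' square_FOb [OF f] square_FOb [OF g]
          simp flip: square_FOb [OF p] square_FOb [OF q]\<close>)
      then show "FOb (fcompose (fsrc Z) (ffun P) h) x = FOb (fcompose (fsrc Z) k (ffun Z)) x"
        using x by simp
    next
      fix x assume x: "x \<in> Arr (fsrc Z)"
      have "FAr (ffun P) (FAr h x) = FAr k (FAr (ffun Z) x)"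
        by (rule t.Arr_eqI) (use x in \<open>auto simp: h'' k'' square_FAr [OF f] square_FAr [OF g]
          simp flip: square_FAr [OF p] square_FAr [OF q]\<close>)
      then show "FAr (fcompose (fsrc Z) (ffun P) h) x = FAr (fcompose (fsrc Z) k (ffun Z)) x"
        using x by simp
    qed
    then show ?thesis
      using h k by (auto simp: commuting_square_def square_comp_eq prod_eq_iff intro!: exI [of _
          "(h, k)"])
  qed
  have un1: "h = k" if "commuting_square Z P h" "commuting_square Z P k"
    "square_comp Z p h = square_comp Z p k" "square_comp Z q h = square_comp Z q k" for Z h k
    using that s.functor_pairing_unique [of "fsrc Z" "fst h" "fst k"]
      t.functor_pairing_unique [of "ftgt Z" "snd h" "snd k"]
    by (auto simp: commuting_square_def square_comp_eq prod_eq_iff)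
  have whisker: "comp2 ?A Z P X (Idn (functors_hom P X) p) (Arrow h k v) =
      Arrow (square_comp Z p h) (square_comp Z p k)
        (\<lambda>x\<in>Obj (fsrc Z). FAr (fst p) (fst v x), \<lambda>x\<in>Obj (ftgt Z). FAr (snd p) (snd v x))"
    "comp2 ?A Z P Y (Idn (functors_hom P Y) q) (Arrow h k v) =
      Arrow (square_comp Z q h) (square_comp Z q k)
        (\<lambda>x\<in>Obj (fsrc Z). FAr (fst q) (fst v x), \<lambda>x\<in>Obj (ftgt Z). FAr (snd q) (snd v x))"
    if "Arrow h k v \<in> Arr (functors_hom Z P)" for Z h k v
    using that p q category.Idn_Arr [OF category_functors_hom, of P X p]
      category.Idn_Arr [OF category_functors_hom, of P Y q] fo
      s.p.is_functor_axioms s.q.is_functor_axioms t.p.is_functor_axioms t.q.is_functor_axioms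
    by (auto simp: square_hcomp_def square_2cells_iff nt_hcomp_whisker)
  have ex2: "\<exists>c\<in>Arr (functors_hom Z P). comp2 ?A Z P X (Idn (functors_hom P X) p) c = a
      \<and> comp2 ?A Z P Y (Idn (functors_hom P Y) q) c = b"
    if Z: "functor_obj Z" and a: "a \<in> Arr (functors_hom Z X)" and b:
        "b \<in> Arr (functors_hom Z Y)" for Z a b
  proof -
    interpret Z: is_functor "fsrc Z" "ftgt Z" "ffun Z" using Z by (simp add: functor_obj_def)
    obtain f f' t where a': "a = Arrow f f' t" by (cases a)
    obtain g g' u where b': "b = Arrow g g' u" by (cases b)
    have t: "commuting_square Z X f" "commuting_square Z X f'" "t \<in> square_2cells Z X f f'"
      and u: "commuting_square Z Y g" "commuting_square Z Y g'" "u \<in> square_2cells Z Y g g'"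
      using a b by (auto simp: a' b')
    obtain h where h: "commuting_square Z P h" "square_comp Z p h = f" "square_comp Z q h = g"
      using ex1 [OF Z t(1) u(1)] by blast
    obtain h' where h': "commuting_square Z P h'" "square_comp Z p h' = f'"
        "square_comp Z q h' = g'"
      using ex1 [OF Z t(2) u(2)] by blast
    have func: "is_functor (fsrc Z) (fsrc P) (fst h)" "is_functor (fsrc Z) (fsrc P) (fst h')"
      "is_functor (ftgt Z) (ftgt P) (snd h)" "is_functor (ftgt Z) (ftgt P) (snd h')"
      using h h' by (auto simp: commuting_square_def)
    have nat: "nat_trans (fsrc Z) (fsrc X) (fcompose (fsrc Z) (fst p) (fst h)) (fcompose (fsrc Z)
        (fst p) (fst h')) (fst t)"
      "nat_trans (fsrc Z) (fsrc Y) (fcompose (fsrc Z) (fst q) (fst h)) (fcompose (fsrc Z) (fst q)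
          (fst h')) (fst u)"
      "nat_trans (ftgt Z) (ftgt X) (fcompose (ftgt Z) (snd p) (snd h)) (fcompose (ftgt Z) (snd p)
          (snd h')) (snd t)"
      "nat_trans (ftgt Z) (ftgt Y) (fcompose (ftgt Z) (snd q) (snd h)) (fcompose (ftgt Z) (snd q)
          (snd h')) (snd u)"
      using t(3) u(3) by (simp_all add: square_2cells_iff square_comp_eq flip: h(2,3) h'(2,3))
    obtain v where v: "nat_trans (fsrc Z) (fsrc P) (fst h) (fst h') v"
      "\<forall>x\<in>Obj (fsrc Z). FAr (fst p) (v x) = fst t x"
      "\<forall>x\<in>Obj (fsrc Z). FAr (fst q) (v x) = fst u x"
      using s.nat_trans_pairing [OF func(1,2) nat(1,2)] .
    obtain w where w: "nat_trans (ftgt Z) (ftgt P) (snd h) (snd h') w"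
      "\<forall>x\<in>Obj (ftgt Z). FAr (snd p) (w x) = snd t x"
      "\<forall>x\<in>Obj (ftgt Z). FAr (snd q) (w x) = snd u x"
      using t.nat_trans_pairing [OF func(3,4) nat(3,4)] .
    interpret v: nat_trans "fsrc Z" "fsrc P" "fst h" "fst h'" v by fact
    interpret w: nat_trans "ftgt Z" "ftgt P" "snd h" "snd h'" w by fact
    have "w (FOb (ffun Z) x) = FAr (ffun P) (v x)" if "x \<in> Obj (fsrc Z)" for x
      by (rule t.Arr_eqI) (use that t(3) u(3) in \<open>auto simp: v(2,3) w(2,3) square_2cells_iff
          simp flip: square_FAr [OF p] square_FAr [OF q]\<close>)
    then have c: "Arrow h h' (v, w) \<in> Arr (functors_hom Z P)"
      using h h' v(1) w(1) by (auto simp: square_2cells_iff)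
    have ext: "fst t \<in> extensional (Obj (fsrc Z))" "fst u \<in> extensional (Obj (fsrc Z))"
      "snd t \<in> extensional (Obj (ftgt Z))" "snd u \<in> extensional (Obj (ftgt Z))"
      using t(3) u(3) by (auto simp: square_2cells_iff intro: nat_trans.component_extensional)
    have "(\<lambda>x\<in>Obj (fsrc Z). FAr (fst p) (v x)) = fst t"
        "(\<lambda>x\<in>Obj (ftgt Z). FAr (snd p) (w x)) = snd t"
      "(\<lambda>x\<in>Obj (fsrc Z). FAr (fst q) (v x)) = fst u" "(\<lambda>x\<in>Obj (ftgt Z). FAr (snd q) (w x)) = snd u"
      by (rule extensionalityI [OF restrict_extensional]; simp add: ext v(2,3) w(2,3))+
    then show ?thesis
      using whisker [OF c] h h' by (intro bexI [OF _ c]) (simp add: a' b')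
  qed
  have un2: "c = d"
    if c: "c \<in> Arr (functors_hom Z P)" and d: "d \<in> Arr (functors_hom Z P)"
      and eq: "comp2 ?A Z P X (Idn (functors_hom P X) p) c =
        comp2 ?A Z P X (Idn (functors_hom P X) p) d"
      "comp2 ?A Z P Y (Idn (functors_hom P Y) q) c =
        comp2 ?A Z P Y (Idn (functors_hom P Y) q) d" for Z c d
  proof -
    obtain h h' v where c': "c = Arrow h h' v" by (cases c)
    obtain k k' w where d': "d = Arrow k k' w" by (cases d)
    have eq': "square_comp Z p h = square_comp Z p k" "square_comp Z p h' = square_comp Z p k'"
      "square_comp Z q h = square_comp Z q k" "square_comp Z q h' = square_comp Z q k'"
      "(\<lambda>x\<in>Obj (fsrc Z). FAr (fst p) (fst v x)) = (\<lambda>x\<in>Obj (fsrc Z). FAr (fst p) (fst w x))"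
      "(\<lambda>x\<in>Obj (ftgt Z). FAr (snd p) (snd v x)) = (\<lambda>x\<in>Obj (ftgt Z). FAr (snd p) (snd w x))"
      "(\<lambda>x\<in>Obj (fsrc Z). FAr (fst q) (fst v x)) = (\<lambda>x\<in>Obj (fsrc Z). FAr (fst q) (fst w x))"
      "(\<lambda>x\<in>Obj (ftgt Z). FAr (snd q) (snd v x)) = (\<lambda>x\<in>Obj (ftgt Z). FAr (snd q) (snd w x))"
      using eq c d whisker unfolding c' d' by auto
    have hk: "h = k" "h' = k'"
      using un1 [of Z h k] un1 [of Z h' k'] eq'(1-4) c d by (simp_all add: c' d')
    have n: "nat_trans (fsrc Z) (fsrc P) (fst h) (fst h') (fst v)"
      "nat_trans (ftgt Z) (ftgt P) (snd h) (snd h') (snd v)"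
      "nat_trans (fsrc Z) (fsrc P) (fst h) (fst h') (fst w)"
      "nat_trans (ftgt Z) (ftgt P) (snd h) (snd h') (snd w)"
      using c d by (auto simp: c' d' hk square_2cells_iff)
    have "fst v = fst w"
    proof (rule nat_trans_eqI [OF n(1,3)])
      fix x assume x: "x \<in> Obj (fsrc Z)"
      show "fst v x = fst w x"
        by (rule s.Arr_eqI) (use n x fun_cong [OF eq'(5), of x] fun_cong [OF eq'(7), of x]
          in \<open>auto intro: nat_trans.component_Arr\<close>)
    qed
    moreover have "snd v = snd w"
    proof (rule nat_trans_eqI [OF n(2,4)])
      fix x assume x: "x \<in> Obj (ftgt Z)"
      show "snd v x = snd w x"
        by (rule t.Arr_eqI) (use n x fun_cong [OF eq'(6), of x] fun_cong [OF eq'(8), of x]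
          in \<open>auto intro: nat_trans.component_Arr\<close>)
    qed
    ultimately show ?thesis by (simp add: c' d' hk prod_eq_iff)
  qed
  show ?thesis
  proof (rule strict_productI [OF ob], goal_cases)
    case (3 Z f g)
    then have "functor_obj Z" "commuting_square Z X f" "commuting_square Z Y g" by auto
    from ex1 [OF this] p q show ?case by auto
  next
    case (4 Z h k)
    then show ?case using un1 [of Z h k] p q by simp
  next
    case (5 Z a b)
    then show ?case using ex2 [of Z a b] by simp
  next
    case (6 Z c d)
    then show ?case using un2 [of c Z d] by simp
  qed (use p q in auto)
qed

text \<open>All functors and natural transformations into a terminal category coincide, so every pair of
  functors into \<open>T\<close> is automatically a commuting square.\<close>

lemma strict_final_Functors:
  assumes ob: "T \<in> Ob2 (Functors small)"
    and src: "terminal_category (fsrc T)" and tgt: "terminal_category (ftgt T)"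
  shows "strict_final (Functors small) T"
  unfolding strict_final_def
proof (intro conjI ballI)
  fix Z :: "('a, 'a, 'a, 'a) functor_obj" assume Z: "Z \<in> Ob2 (Functors small)"
  have fo: "functor_obj Z" "functor_obj T" using Z ob by auto
  interpret Z: is_functor "fsrc Z" "ftgt Z" "ffun Z" using fo by (simp add: functor_obj_def)
  interpret T: is_functor "fsrc T" "ftgt T" "ffun T" using fo by (simp add: functor_obj_def)
  interpret H: category "functors_hom Z T" by (rule category_functors_hom [OF fo])
  obtain S where S: "is_functor (fsrc Z) (fsrc T) S"
    using functor_to_terminal_exists [OF Z.source.category_axioms src] by blast
  obtain R where R: "is_functor (ftgt Z) (ftgt T) R"
    using functor_to_terminal_exists [OF Z.target.category_axioms tgt] by blast
  have "fcompose (fsrc Z) (ffun T) S = fcompose (fsrc Z) R (ffun Z)"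
    by (rule functor_to_terminal_unique [OF tgt is_functor_fcompose [OF S T.is_functor_axioms]
          is_functor_fcompose [OF Z.is_functor_axioms R]])
  then have SR: "commuting_square Z T (S, R)" using S R by (simp add: commuting_square_def)
  have un: "f = (S, R)" if "commuting_square Z T f" for f
    using that functor_to_terminal_unique [OF src _ S] functor_to_terminal_unique [OF tgt _ R]
    by (simp add: commuting_square_def prod_eq_iff)
  have Obj: "f \<in> Obj (functors_hom Z T) \<longleftrightarrow> f = (S, R)" for f
    using un [of f] SR by auto
  have "c = Idn (functors_hom Z T) (S, R)" if c: "c \<in> Arr (functors_hom Z T)" for c
  proof -
    obtain h h' v where c': "c = Arrow h h' v" by (cases c)
    have h: "h = (S, R)" "h' = (S, R)" using c un [of h] un [of h'] by (auto simp: c')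
    have "nat_trans (fsrc Z) (fsrc T) S S (fst v)" "nat_trans (ftgt Z) (ftgt T) R R (snd v)"
      using c by (auto simp: c' h square_2cells_iff)
    from nat_trans_to_terminal_unique [OF src this(1) nat_trans_identity [OF S]]
      nat_trans_to_terminal_unique [OF tgt this(2) nat_trans_identity [OF R]]
    have "fst v = nt_identity (fsrc Z) (fsrc T) S" "snd v = nt_identity (ftgt Z) (ftgt T) R" .
    then show ?thesis
      by (simp add: c' h SR prod_eq_iff)
  qed
  moreover have "Idn (functors_hom Z T) (S, R) \<in> Arr (functors_hom Z T)"
    using Obj by (intro H.Idn_Arr) blast
  ultimately have "Obj (functors_hom Z T) = {(S, R)}"
    "Arr (functors_hom Z T) = {Idn (functors_hom Z T) (S, R)}"
    using Obj by blast+
  then have "terminal_category (functors_hom Z T)"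
    using H.category_axioms by (auto simp: terminal_category_def)
  then show "\<exists>F. iso_of_categories (Hom2 (Functors small) Z T) one_category F"
    by (simp add: terminal_category_iso_one)
qed (rule ob)

section \<open>The 2-category of comonads\<close>

abbreviation oplax ::
    "('o, 'm) comonad \<Rightarrow> ('p, 'n) comonad \<Rightarrow> ('o, 'm, 'p, 'n) comonad_1cell \<Rightarrow> bool" where
  "oplax Q R f \<equiv> oplax_comonad_functor Q R (fst f) (snd f)"

lemma Obj_comonad_hom [simp]: "f \<in> Obj (comonad_hom Q R) \<longleftrightarrow> oplax Q R f"
  by (auto simp: comonad_hom_def)

lemma comonad_2cells_iff:
  "a \<in> comonad_2cells Q R f g \<longleftrightarrow> nat_trans (base Q) (base R) (fst f) (fst g) a \<and>
    (\<forall>x\<in>Obj (base Q). FAr (endo R) (a x) \<cdot>\<^bsub>base R\<^esub> snd f x = snd g x \<cdot>\<^bsub>base R\<^esub> a (FOb (endo Q) x))"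
  by (simp add: comonad_2cells_def case_prod_unfold)

lemma comonad_hom_eq:
  "comonad_hom Q R = arrow_category {f. oplax Q R f} (comonad_2cells Q R)
     (\<lambda>f. nt_identity (base Q) (base R) (fst f)) (nt_vcomp (base Q) (base R))"
  unfolding comonad_hom_def by (simp add: case_prod_unfold)

lemma Arr_comonad_hom [simp]:
  "Arrow f g t \<in> Arr (comonad_hom Q R) \<longleftrightarrow> oplax Q R f \<and> oplax Q R g \<and> t \<in> comonad_2cells Q R f g"
  by (simp add: comonad_hom_eq)

lemma Idn_comonad_hom [simp]:
  "oplax Q R f \<Longrightarrow> Idn (comonad_hom Q R) f = Arrow f f (nt_identity (base Q) (base R) (fst f))"
  by (simp add: comonad_hom_eq)

lemma comonad_functor:
  assumes "comonad Q" shows "is_functor (base Q) (base Q) (endo Q)"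
proof -
  interpret comonad Q by fact
  show ?thesis by unfold_locales
qed

lemma comonad_category:
  assumes "comonad Q" shows "category (base Q)"
  using is_functorD(1) [OF comonad_functor [OF assms]] .

lemma oplax_functor:
  assumes "oplax Q R f" shows "is_functor (base Q) (base R) (fst f)"
  using assms oplax_comonad_functor.underlying_functor by blast

sublocale oplax_comonad_functor \<subseteq> carrier: is_functor "base Q" "base R" F
  by (rule underlying_functor)

lemma oplax_comonads:
  assumes "oplax Q R f" shows "comonad Q" "comonad R"
  using assms by (simp_all add: oplax_comonad_functor_def)

lemma oplaxI:
  assumes "comonad Q" "comonad R" "is_functor (base Q) (base R) (fst f)"
    and "nat_trans (base Q) (base R) (fcompose (base Q) (fst f) (endo Q)) (fcompose (base Q) (endo
        R) (fst f)) (snd f)"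
    and "\<And>x. x \<in> Obj (base Q) \<Longrightarrow> comult R (FOb (fst f) x) \<cdot>\<^bsub>base R\<^esub> snd f x =
      FAr (endo R) (snd f x) \<cdot>\<^bsub>base R\<^esub> (snd f (FOb (endo Q) x) \<cdot>\<^bsub>base R\<^esub> FAr (fst f) (comult Q x))"
    and "\<And>x. x \<in> Obj (base Q) \<Longrightarrow>
      counit R (FOb (fst f) x) \<cdot>\<^bsub>base R\<^esub> snd f x = FAr (fst f) (counit Q x)"
  shows "oplax Q R f"
proof -
  interpret BR: category "base R" by (rule comonad_category) fact
  interpret Q: comonad Q by fact
  interpret R: comonad R by fact
  interpret F: is_functor "base Q" "base R" "fst f" by fact
  interpret A: nat_trans "base Q" "base R" "fcompose (base Q) (fst f) (endo Q)"
    "fcompose (base Q) (endo R) (fst f)" "snd f" by fact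
  show ?thesis
    by unfold_locales (simp_all add: assms(3,5,6) BR.Comp_assoc)
qed

lemma oplax_comult:
  assumes "oplax Q R f" "x \<in> Obj (base Q)"
  shows "comult R (FOb (fst f) x) \<cdot>\<^bsub>base R\<^esub> snd f x =
      FAr (endo R) (snd f x) \<cdot>\<^bsub>base R\<^esub> (snd f (FOb (endo Q) x) \<cdot>\<^bsub>base R\<^esub> FAr (fst f) (comult Q x))"
proof -
  interpret BR: category "base R" by (rule comonad_category [OF oplax_comonads(2) [OF assms(1)]])
  interpret oplax_comonad_functor Q R "fst f" "snd f" by fact
  show ?thesis
    using comult_compatible [OF assms(2)] assms(2) by (simp add: BR.Comp_assoc)
qed

text \<open>Functors that commute strictly with all the comonad structure become oplax comonad functors
  with identity structure map. Units and product projections are of this kind.\<close>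

definition strict_comonad_functor ::
  "('o, 'm) comonad \<Rightarrow> ('p, 'n) comonad \<Rightarrow> ('o, 'm, 'p, 'n) cfunctor \<Rightarrow> bool" where
  "strict_comonad_functor P Q p \<longleftrightarrow> is_functor (base P) (base Q) p \<and>
    fcompose (base P) p (endo P) = fcompose (base P) (endo Q) p \<and>
    (\<forall>x\<in>Obj (base P). FAr p (comult P x) = comult Q (FOb p x) \<and> FAr p (counit P x) =
      counit Q (FOb p x))"

definition strict_1cell ::
  "('o, 'm) comonad \<Rightarrow> ('p, 'n) comonad \<Rightarrow> ('o, 'm, 'p, 'n) cfunctor \<Rightarrow> ('o, 'm, 'p, 'n)
      comonad_1cell" where
  "strict_1cell P Q p = (p, nt_identity (base P) (base Q) (fcompose (base P) p (endo P)))"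

lemma strict_comonad_functor_FOb:
  assumes "strict_comonad_functor P Q p" "x \<in> Obj (base P)"
  shows "FOb p (FOb (endo P) x) = FOb (endo Q) (FOb p x)"
  using assms by (metis strict_comonad_functor_def FOb_fcompose)

lemma strict_comonad_functor_FAr:
  assumes "strict_comonad_functor P Q p" "x \<in> Arr (base P)"
  shows "FAr p (FAr (endo P) x) = FAr (endo Q) (FAr p x)"
  using assms by (metis strict_comonad_functor_def FAr_fcompose)

lemma oplax_strict_1cell:
  assumes "comonad P" "comonad Q" and p: "strict_comonad_functor P Q p"
  shows "oplax P Q (strict_1cell P Q p)"
proof -
  interpret P: comonad P by fact
  interpret Q: comonad Q by fact
  interpret p: is_functor "base P" "base Q" p using p by (simp add: strict_comonad_functor_def)
  have c: "fcompose (base P) p (endo P) = fcompose (base P) (endo Q) p"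
    using p by (simp add: strict_comonad_functor_def)
  have "nat_trans (base P) (base Q) (fcompose (base P) p (endo P)) (fcompose (base P) (endo Q) p)
     (nt_identity (base P) (base Q) (fcompose (base P) p (endo P)))"
    unfolding c [symmetric]
    by (rule nat_trans_identity [OF is_functor_fcompose [OF comonad_functor [OF assms(1)]
      p.is_functor_axioms]])
  then show ?thesis
    using p p.is_functor_axioms
    by (intro oplaxI assms)
      (auto simp: strict_1cell_def strict_comonad_functor_FOb [OF p] strict_comonad_functor_def)
qed

lemma comonad_comp1_eq:
  "comonad_comp1 Q S g f = (fcompose (base Q) (fst g) (fst f),
    \<lambda>x\<in>Obj (base Q). snd g (FOb (fst f) x) \<cdot>\<^bsub>base S\<^esub> FAr (fst g) (snd f x))"
  by (simp add: comonad_comp1_def case_prod_unfold)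

lemma fst_comonad_comp1 [simp]: "fst (comonad_comp1 Q S g f) = fcompose (base Q) (fst g) (fst f)"
  by (simp add: comonad_comp1_eq)

lemma snd_comonad_comp1 [simp]:
  "x \<in> Obj (base Q) \<Longrightarrow> snd (comonad_comp1 Q S g f) x =
    snd g (FOb (fst f) x) \<cdot>\<^bsub>base S\<^esub> FAr (fst g) (snd f x)"
  by (simp add: comonad_comp1_eq)

text \<open>Pasting the two structure maps. Besides the laws of \<open>f\<close> and \<open>g\<close>, compatibility with the
  comultiplication needs naturality of the structure map of \<open>g\<close> at a component of that of \<open>f\<close>.\<close>

lemma oplax_comp:
  assumes f: "oplax Q R f" and g: "oplax R S g"
  shows "oplax Q S (comonad_comp1 Q S g f)"
proof -
  interpret BS: category "base S" by (rule comonad_category [OF oplax_comonads(2) [OF g]])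
  interpret BR: category "base R" by (rule comonad_category [OF oplax_comonads(2) [OF f]])
  interpret f: oplax_comonad_functor Q R "fst f" "snd f" by fact
  interpret g: oplax_comonad_functor R S "fst g" "snd g" by fact
  note assoc = BS.Comp_assoc and ext = BS.Comp_extend
  show ?thesis
  proof (rule oplaxI, goal_cases)
    case 4
    show ?case
    proof (rule nat_transI)
      fix h assume h [simp]: "h \<in> Arr (base Q)"
      let ?x = "Dom (base Q) h" and ?y = "Cod (base Q) h"
      have n: "snd g (FOb (fst f) ?y) \<cdot>\<^bsub>base S\<^esub> FAr (fst g) (FAr (endo R) (FAr (fst f) h)) =
          FAr (endo S) (FAr (fst g) (FAr (fst f) h)) \<cdot>\<^bsub>base S\<^esub> snd g (FOb (fst f) ?x)"
        using g.structure_map.naturality [of "FAr (fst f) h"] by simp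
      have "snd g (FOb (fst f) ?y) \<cdot>\<^bsub>base S\<^esub> (FAr (fst g) (snd f ?y) \<cdot>\<^bsub>base S\<^esub>
          FAr (fst g) (FAr (fst f) (FAr (endo Q) h))) =
          snd g (FOb (fst f) ?y) \<cdot>\<^bsub>base S\<^esub> FAr (fst g) (snd f ?y \<cdot>\<^bsub>base R\<^esub>
              FAr (fst f) (FAr (endo Q) h))"
        by simp
      also have "\<dots> = snd g (FOb (fst f) ?y) \<cdot>\<^bsub>base S\<^esub>
          (FAr (fst g) (FAr (endo R) (FAr (fst f) h)) \<cdot>\<^bsub>base S\<^esub> FAr (fst g) (snd f ?x))"
        using f.structure_map.naturality [OF h] by simp
      also have "\<dots> = (FAr (endo S) (FAr (fst g) (FAr (fst f) h)) \<cdot>\<^bsub>base S\<^esub>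
          snd g (FOb (fst f) ?x)) \<cdot>\<^bsub>base S\<^esub> FAr (fst g) (snd f ?x)"
        by (rule ext [OF n]) auto
      finally show "snd (comonad_comp1 Q S g f) ?y \<cdot>\<^bsub>base S\<^esub>
          FAr (fcompose (base Q) (fst (comonad_comp1 Q S g f)) (endo Q)) h =
          FAr (fcompose (base Q) (endo S) (fst (comonad_comp1 Q S g f))) h \<cdot>\<^bsub>base S\<^esub>
              snd (comonad_comp1 Q S g f) ?x"
        by (simp add: assoc)
    qed (auto intro!: is_functor_fcompose oplax_functor [OF f] oplax_functor [OF g]
        comonad_functor oplax_comonads [OF f] oplax_comonads [OF g], simp add: comonad_comp1_eq)
  next
    case (5 x)
    then have x [simp]: "x \<in> Obj (base Q)" .
    let ?A = "snd f x" and ?AQ = "snd f (FOb (endo Q) x)" and ?w =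
        "FAr (fst g) (FAr (fst f) (comult Q x))"
      and ?B = "snd g (FOb (fst f) x)"
    have n: "snd g (FOb (endo R) (FOb (fst f) x)) \<cdot>\<^bsub>base S\<^esub> FAr (fst g) (FAr (endo R) ?A) =
        FAr (endo S) (FAr (fst g) ?A) \<cdot>\<^bsub>base S\<^esub> snd g (FOb (fst f) (FOb (endo Q) x))"
      using g.structure_map.naturality [of ?A] by simp
    have w: "comult S (FOb (fst g) (FOb (fst f) x)) \<cdot>\<^bsub>base S\<^esub> ?B =
        FAr (endo S) ?B \<cdot>\<^bsub>base S\<^esub> (snd g (FOb (endo R) (FOb (fst f) x)) \<cdot>\<^bsub>base S\<^esub>
            FAr (fst g) (comult R (FOb (fst f) x)))"
      using oplax_comult [OF g, of "FOb (fst f) x"] by simp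
    have "comult S (FOb (fst g) (FOb (fst f) x)) \<cdot>\<^bsub>base S\<^esub> (?B \<cdot>\<^bsub>base S\<^esub> FAr (fst g) ?A) =
        (FAr (endo S) ?B \<cdot>\<^bsub>base S\<^esub> (snd g (FOb (endo R) (FOb (fst f) x)) \<cdot>\<^bsub>base S\<^esub>
          FAr (fst g) (comult R (FOb (fst f) x)))) \<cdot>\<^bsub>base S\<^esub> FAr (fst g) ?A"
      by (rule ext [OF w]) auto
    also have "\<dots> = FAr (endo S) ?B \<cdot>\<^bsub>base S\<^esub> (snd g (FOb (endo R) (FOb (fst f) x)) \<cdot>\<^bsub>base S\<^esub>
        FAr (fst g) (comult R (FOb (fst f) x) \<cdot>\<^bsub>base R\<^esub> ?A))"
      by (simp add: assoc)
    also have "\<dots> = FAr (endo S) ?B \<cdot>\<^bsub>base S\<^esub> (snd g (FOb (endo R) (FOb (fst f) x)) \<cdot>\<^bsub>base S\<^esub>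
        (FAr (fst g) (FAr (endo R) ?A) \<cdot>\<^bsub>base S\<^esub> (FAr (fst g) ?AQ \<cdot>\<^bsub>base S\<^esub> ?w)))"
      by (simp add: oplax_comult [OF f x])
    also have "snd g (FOb (endo R) (FOb (fst f) x)) \<cdot>\<^bsub>base S\<^esub>
        (FAr (fst g) (FAr (endo R) ?A) \<cdot>\<^bsub>base S\<^esub> (FAr (fst g) ?AQ \<cdot>\<^bsub>base S\<^esub> ?w)) =
      (FAr (endo S) (FAr (fst g) ?A) \<cdot>\<^bsub>base S\<^esub> snd g (FOb (fst f) (FOb (endo Q) x))) \<cdot>\<^bsub>base S\<^esub>
        (FAr (fst g) ?AQ \<cdot>\<^bsub>base S\<^esub> ?w)"
      by (rule ext [OF n]) auto
    finally show ?case by (simp add: assoc)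
  next
    case (6 x)
    then have x [simp]: "x \<in> Obj (base Q)" .
    have w: "counit S (FOb (fst g) (FOb (fst f) x)) \<cdot>\<^bsub>base S\<^esub> snd g (FOb (fst f) x) =
        FAr (fst g) (counit R (FOb (fst f) x))"
      using g.counit_compatible [of "FOb (fst f) x"] by simp
    have "counit S (FOb (fst g) (FOb (fst f) x)) \<cdot>\<^bsub>base S\<^esub> (snd g (FOb (fst f) x) \<cdot>\<^bsub>base S\<^esub>
        FAr (fst g) (snd f x)) =
        FAr (fst g) (counit R (FOb (fst f) x)) \<cdot>\<^bsub>base S\<^esub> FAr (fst g) (snd f x)"
      by (rule ext [OF w]) auto
    also have "\<dots> = FAr (fst g) (counit R (FOb (fst f) x) \<cdot>\<^bsub>base R\<^esub> snd f x)" by simp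
    also have "\<dots> = FAr (fst g) (FAr (fst f) (counit Q x))" by (simp add: f.counit_compatible)
    finally show ?case by simp
  qed (auto intro!: is_functor_fcompose oplax_functor [OF f] oplax_functor [OF g]
      oplax_comonads [OF f] oplax_comonads [OF g])
qed

lemma comonad_2cells_vcomp:
  assumes f: "oplax Q R f" and g: "oplax Q R g" and h: "oplax Q R h"
    and t: "t \<in> comonad_2cells Q R f g" and u: "u \<in> comonad_2cells Q R g h"
  shows "nt_vcomp (base Q) (base R) u t \<in> comonad_2cells Q R f h"
proof -
  interpret BR: category "base R" by (rule comonad_category [OF oplax_comonads(2) [OF f]])
  interpret f: oplax_comonad_functor Q R "fst f" "snd f" by fact
  interpret g: oplax_comonad_functor Q R "fst g" "snd g" by fact
  interpret h: oplax_comonad_functor Q R "fst h" "snd h" by fact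
  interpret t: nat_trans "base Q" "base R" "fst f" "fst g" t using t by
      (simp add: comonad_2cells_iff)
  interpret u: nat_trans "base Q" "base R" "fst g" "fst h" u using u by
      (simp add: comonad_2cells_iff)
  have "FAr (endo R) (u x \<cdot>\<^bsub>base R\<^esub> t x) \<cdot>\<^bsub>base R\<^esub> snd f x =
      snd h x \<cdot>\<^bsub>base R\<^esub> (u (FOb (endo Q) x) \<cdot>\<^bsub>base R\<^esub>
          t (FOb (endo Q) x))" if x [simp]: "x \<in> Obj (base Q)" for x
  proof -
    have "FAr (endo R) (u x \<cdot>\<^bsub>base R\<^esub> t x) \<cdot>\<^bsub>base R\<^esub> snd f x =
        FAr (endo R) (u x) \<cdot>\<^bsub>base R\<^esub> (FAr (endo R) (t x) \<cdot>\<^bsub>base R\<^esub> snd f x)"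
      by (simp add: BR.Comp_assoc)
    also have "\<dots> = FAr (endo R) (u x) \<cdot>\<^bsub>base R\<^esub> (snd g x \<cdot>\<^bsub>base R\<^esub> t (FOb (endo Q) x))"
      using t by (simp add: comonad_2cells_iff)
    also have "\<dots> = (snd h x \<cdot>\<^bsub>base R\<^esub> u (FOb (endo Q) x)) \<cdot>\<^bsub>base R\<^esub> t (FOb (endo Q) x)"
      by (rule BR.Comp_extend) (use u in \<open>auto simp: comonad_2cells_iff\<close>)
    finally show ?thesis by (simp add: BR.Comp_assoc)
  qed
  then show ?thesis
    using t u by (auto simp: comonad_2cells_iff intro: nat_trans_vcomp)
qed

lemma comonad_2cells_identity:
  assumes f: "oplax Q R f" shows "nt_identity (base Q) (base R) (fst f) \<in> comonad_2cells Q R f f"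
proof -
  interpret BR: category "base R" by (rule comonad_category [OF oplax_comonads(2) [OF f]])
  interpret f: oplax_comonad_functor Q R "fst f" "snd f" by fact
  show ?thesis
    by (auto simp: comonad_2cells_iff nat_trans_identity [OF oplax_functor [OF f]])
qed

text \<open>The square for the horizontal composite is pasted from those of \<open>t\<close> and \<open>u\<close>, joined by two
  naturality squares: of the structure map of \<open>g\<close> at \<open>t\<close>, and of \<open>u\<close> at the structure map of \<open>f'\<close>.\<close>

lemma comonad_2cells_hcomp:
  assumes f: "oplax Q R f" and f': "oplax Q R f'" and g: "oplax R S g" and g': "oplax R S g'"
    and t: "t \<in> comonad_2cells Q R f f'" and u: "u \<in> comonad_2cells R S g g'"
  shows "nt_hcomp (base Q) (base S) (fst g) (fst f') u t
    \<in> comonad_2cells Q S (comonad_comp1 Q S g f) (comonad_comp1 Q S g' f')"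
proof -
  interpret BS: category "base S" by (rule comonad_category [OF oplax_comonads(2) [OF g]])
  interpret BR: category "base R" by (rule comonad_category [OF oplax_comonads(2) [OF f]])
  interpret f: oplax_comonad_functor Q R "fst f" "snd f" by fact
  interpret f': oplax_comonad_functor Q R "fst f'" "snd f'" by fact
  interpret g: oplax_comonad_functor R S "fst g" "snd g" by fact
  interpret g': oplax_comonad_functor R S "fst g'" "snd g'" by fact
  interpret t: nat_trans "base Q" "base R" "fst f" "fst f'" t using t by
      (simp add: comonad_2cells_iff)
  interpret u: nat_trans "base R" "base S" "fst g" "fst g'" u using u by
      (simp add: comonad_2cells_iff)
  note assoc = BS.Comp_assoc and ext = BS.Comp_extend
  have "FAr (endo S) (u (FOb (fst f') x) \<cdot>\<^bsub>base S\<^esub> FAr (fst g) (t x)) \<cdot>\<^bsub>base S\<^esub>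
        (snd g (FOb (fst f) x) \<cdot>\<^bsub>base S\<^esub> FAr (fst g) (snd f x)) =
      snd g' (FOb (fst f') x) \<cdot>\<^bsub>base S\<^esub> FAr (fst g') (snd f' x) \<cdot>\<^bsub>base S\<^esub>
        (u (FOb (fst f') (FOb (endo Q) x)) \<cdot>\<^bsub>base S\<^esub> FAr (fst g) (t (FOb (endo Q) x)))"
    if x [simp]: "x \<in> Obj (base Q)" for x
  proof -
    let ?Fx = "FOb (fst f) x" and ?F'x = "FOb (fst f') x" and ?tQ =
        "FAr (fst g) (t (FOb (endo Q) x))"
    have n: "FAr (endo S) (FAr (fst g) (t x)) \<cdot>\<^bsub>base S\<^esub> snd g ?Fx =
        snd g ?F'x \<cdot>\<^bsub>base S\<^esub> FAr (fst g) (FAr (endo R) (t x))"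
      using g.structure_map.naturality [of "t x"] by simp
    have n': "u (FOb (endo R) ?F'x) \<cdot>\<^bsub>base S\<^esub> FAr (fst g) (snd f' x) =
        FAr (fst g') (snd f' x) \<cdot>\<^bsub>base S\<^esub> u (FOb (fst f') (FOb (endo Q) x))"
      using u.naturality [of "snd f' x"] by simp
    have c: "FAr (endo S) (u ?F'x) \<cdot>\<^bsub>base S\<^esub> snd g ?F'x = snd g' ?F'x \<cdot>\<^bsub>base S\<^esub> u (FOb (endo R) ?F'x)"
      using u by (simp add: comonad_2cells_iff)
    have c': "FAr (endo R) (t x) \<cdot>\<^bsub>base R\<^esub> snd f x = snd f' x \<cdot>\<^bsub>base R\<^esub> t (FOb (endo Q) x)"
      using t by (simp add: comonad_2cells_iff)
    have "FAr (endo S) (u ?F'x \<cdot>\<^bsub>base S\<^esub> FAr (fst g) (t x)) \<cdot>\<^bsub>base S\<^esub> (snd g ?Fx \<cdot>\<^bsub>base S\<^esub>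
        FAr (fst g) (snd f x)) =
        FAr (endo S) (u ?F'x) \<cdot>\<^bsub>base S\<^esub> (FAr (endo S) (FAr (fst g) (t x)) \<cdot>\<^bsub>base S\<^esub> (snd g ?Fx \<cdot>\<^bsub>base S\<^esub>
            FAr (fst g) (snd f x)))"
      by (simp add: assoc)
    also have "FAr (endo S) (FAr (fst g) (t x)) \<cdot>\<^bsub>base S\<^esub> (snd g ?Fx \<cdot>\<^bsub>base S\<^esub> FAr (fst g) (snd f x)) =
        (snd g ?F'x \<cdot>\<^bsub>base S\<^esub> FAr (fst g) (FAr (endo R) (t x))) \<cdot>\<^bsub>base S\<^esub> FAr (fst g) (snd f x)"
      by (rule ext [OF n]) auto
    also have "\<dots> = snd g ?F'x \<cdot>\<^bsub>base S\<^esub> FAr (fst g) (FAr (endo R) (t x) \<cdot>\<^bsub>base R\<^esub> snd f x)"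
      by (simp add: assoc)
    also have "\<dots> = snd g ?F'x \<cdot>\<^bsub>base S\<^esub> (FAr (fst g) (snd f' x) \<cdot>\<^bsub>base S\<^esub> ?tQ)"
      by (simp add: c')
    also have "FAr (endo S) (u ?F'x) \<cdot>\<^bsub>base S\<^esub> \<dots> =
        (snd g' ?F'x \<cdot>\<^bsub>base S\<^esub> u (FOb (endo R) ?F'x)) \<cdot>\<^bsub>base S\<^esub> (FAr (fst g) (snd f' x) \<cdot>\<^bsub>base S\<^esub> ?tQ)"
      by (rule ext [OF c]) auto
    also have "\<dots> = snd g' ?F'x \<cdot>\<^bsub>base S\<^esub> (u (FOb (endo R) ?F'x) \<cdot>\<^bsub>base S\<^esub>
        (FAr (fst g) (snd f' x) \<cdot>\<^bsub>base S\<^esub> ?tQ))"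
      by (simp add: assoc)
    also have "u (FOb (endo R) ?F'x) \<cdot>\<^bsub>base S\<^esub> (FAr (fst g) (snd f' x) \<cdot>\<^bsub>base S\<^esub> ?tQ) =
        (FAr (fst g') (snd f' x) \<cdot>\<^bsub>base S\<^esub> u (FOb (fst f') (FOb (endo Q) x))) \<cdot>\<^bsub>base S\<^esub> ?tQ"
      by (rule ext [OF n']) auto
    finally show ?thesis by (simp add: assoc)
  qed
  then show ?thesis
    using t u by (auto simp: comonad_2cells_iff intro: nat_trans_hcomp)
qed

lemma category_comonad_hom: "category (comonad_hom Q R)"
  unfolding comonad_hom_eq
proof (rule category_arrow_category; clarify?)
  show "nt_identity (base Q) (base R) (fst f) \<in> comonad_2cells Q R f f" if "oplax Q R f" for f
    using that by (rule comonad_2cells_identity)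
  show "nt_vcomp (base Q) (base R) u t \<in> comonad_2cells Q R f h"
    if "oplax Q R f" "oplax Q R g" "oplax Q R h" "t \<in> comonad_2cells Q R f g"
        "u \<in> comonad_2cells Q R g h"
    for f g h t u
    using that by (rule comonad_2cells_vcomp)
qed (auto simp: comonad_2cells_iff nt_vcomp_identity_left nt_vcomp_identity_right nt_vcomp_assoc)

definition comonad_hcomp where
  "comonad_hcomp Q S b a =
    nt_hcomp (base Q) (base S) (fst (src b)) (fst (tgt a)) (under b) (under a)"

lemma Comonads_simps [simp]:
  "Q \<in> Ob2 (Comonads small) \<longleftrightarrow> comonad Q \<and> small_category small (base Q)"
  "Hom2 (Comonads small) = comonad_hom"
  "Unit2 (Comonads small) Q = (fidentity (base Q), nt_identity (base Q) (base Q) (endo Q))"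
  by (auto simp: Comonads_def)

lemma Comonads_Comp2:
  "Comp2 (Comonads small) Q R S =
    \<lparr>FOb = (\<lambda>(g, f)\<in>Obj (comonad_hom R S) \<times> Obj (comonad_hom Q R). comonad_comp1 Q S g f),
     FAr = (\<lambda>(b, a)\<in>Arr (comonad_hom R S) \<times> Arr (comonad_hom Q R).
       Arrow (comonad_comp1 Q S (src b) (src a)) (comonad_comp1 Q S (tgt b) (tgt a))
           (comonad_hcomp Q S b a))\<rparr>"
  by (simp add: Comonads_def comonad_hcomp_def)

lemma Comonads_comp1 [simp]:
  "\<lbrakk>oplax R S g; oplax Q R f\<rbrakk> \<Longrightarrow> comp1 (Comonads small) Q R S g f = comonad_comp1 Q S g f"
  by (simp add: Comonads_Comp2)

lemma Comonads_comp2 [simp]: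
  "\<lbrakk>b \<in> Arr (comonad_hom R S); a \<in> Arr (comonad_hom Q R)\<rbrakk> \<Longrightarrow>
    comp2 (Comonads small) Q R S b a =
      Arrow (comonad_comp1 Q S (src b) (src a)) (comonad_comp1 Q S (tgt b) (tgt a)) (comonad_hcomp
          Q S b a)"
  by (simp add: Comonads_Comp2)

lemma is_functor_Comonads_Comp2:
  "is_functor (prod_category (comonad_hom R S) (comonad_hom Q R)) (comonad_hom Q S)
    (Comp2 (Comonads small) Q R S)"
proof -
  have "is_functor (prod_category (comonad_hom R S) (comonad_hom Q R)) (comonad_hom Q S)
    \<lparr>FOb = (\<lambda>(g, f)\<in>{f. oplax R S f} \<times> {f. oplax Q R f}. comonad_comp1 Q S g f),
     FAr = (\<lambda>(b, a)\<in>Arr (comonad_hom R S) \<times> Arr (comonad_hom Q R).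
       Arrow (comonad_comp1 Q S (src b) (src a)) (comonad_comp1 Q S (tgt b) (tgt a))
           (comonad_hcomp Q S b a))\<rparr>"
    unfolding comonad_hom_eq
  proof (rule is_functor_arrow_composition; (fold comonad_hom_eq)?; clarify?)
    show "oplax Q S (comonad_comp1 Q S g f)" if "oplax R S g" "oplax Q R f" for g f
      using that(2,1) by (rule oplax_comp)
  next
    fix g g' u f f' t
    assume "oplax R S g" "oplax R S g'" "oplax Q R f" "oplax Q R f'"
      "u \<in> comonad_2cells R S g g'" "t \<in> comonad_2cells Q R f f'"
    then show "comonad_hcomp Q S (Arrow g g' u) (Arrow f f' t)
      \<in> comonad_2cells Q S (comonad_comp1 Q S g f) (comonad_comp1 Q S g' f')"
      using comonad_2cells_hcomp [of Q R f f' S g g' t u] by (simp add: comonad_hcomp_def)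
  qed (auto simp: category_comonad_hom comonad_hcomp_def comonad_2cells_iff
      nt_interchange intro!: nt_hcomp_identity intro: oplax_comonad_functor.underlying_functor)
  moreover have "{f. oplax R S f} = Obj (comonad_hom R S)"
      "{f. oplax Q R f} = Obj (comonad_hom Q R)"
    by auto
  ultimately show ?thesis by (simp only: Comonads_Comp2)
qed

lemma strict_comonad_functor_identity:
  assumes "comonad Q" shows "strict_comonad_functor Q Q (fidentity (base Q))"
proof -
  interpret comonad Q by fact
  show ?thesis
    using comonad_functor [OF assms]
    by (auto simp: strict_comonad_functor_def fcompose_fidentity_left fcompose_fidentity_right
        intro: is_functor_fidentity is_functorD)
qed

lemma oplax_identity:
  assumes "comonad Q" shows "oplax Q Q (fidentity (base Q), nt_identity (base Q) (base Q) (endo Q))"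
  using oplax_strict_1cell [OF assms assms strict_comonad_functor_identity [OF assms]]
  by (simp add: strict_1cell_def fcompose_fidentity_left comonad_functor [OF assms])

lemma oplax_eqI:
  assumes f: "oplax Q R f" and g: "oplax Q R g" and "fst f = fst g"
    and "\<And>x. x \<in> Obj (base Q) \<Longrightarrow> snd f x = snd g x"
  shows "f = g"
proof -
  interpret BR: category "base R" by (rule comonad_category [OF oplax_comonads(2) [OF f]])
  interpret f: oplax_comonad_functor Q R "fst f" "snd f" by fact
  interpret g: oplax_comonad_functor Q R "fst g" "snd g" by fact
  have "snd f = snd g"
    by (rule nat_trans_eqI [OF f.structure_map.nat_trans_axioms g.structure_map.nat_trans_axioms
      assms(4)])
  with assms(3) show ?thesis by (simp add: prod_eq_iff)
qed

lemma comonad_comp1_unit_left: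
  assumes f: "oplax Q R f"
  shows "comonad_comp1 Q R (fidentity (base R), nt_identity (base R) (base R) (endo R)) f = f"
proof -
  interpret BR: category "base R" by (rule comonad_category [OF oplax_comonads(2) [OF f]])
  interpret f: oplax_comonad_functor Q R "fst f" "snd f" by fact
  show ?thesis
    by (rule oplax_eqI [OF oplax_comp [OF f oplax_identity [OF f.target.comonad_axioms]] f])
      (simp_all add: fcompose_fidentity_left [OF oplax_functor [OF f]])
qed

lemma comonad_comp1_unit_right:
  assumes f: "oplax Q R f"
  shows "comonad_comp1 Q R f (fidentity (base Q), nt_identity (base Q) (base Q) (endo Q)) = f"
proof -
  interpret BR: category "base R" by (rule comonad_category [OF oplax_comonads(2) [OF f]])
  interpret f: oplax_comonad_functor Q R "fst f" "snd f" by fact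
  show ?thesis
    by (rule oplax_eqI [OF oplax_comp [OF oplax_identity [OF f.source.comonad_axioms] f] f])
      (simp_all add: fcompose_fidentity_right [OF oplax_functor [OF f]])
qed

lemma comonad_comp1_assoc:
  assumes f: "oplax P Q f" and g: "oplax Q R g" and h: "oplax R S h"
  shows "comonad_comp1 P S (comonad_comp1 Q S h g) f = comonad_comp1 P S h (comonad_comp1 P R g f)"
proof -
  interpret BS: category "base S" by (rule comonad_category [OF oplax_comonads(2) [OF h]])
  interpret f: oplax_comonad_functor P Q "fst f" "snd f" by fact
  interpret g: oplax_comonad_functor Q R "fst g" "snd g" by fact
  interpret h: oplax_comonad_functor R S "fst h" "snd h" by fact
  show ?thesis
  proof (rule oplax_eqI [OF oplax_comp [OF f oplax_comp [OF g h]] oplax_comp [OF oplax_comp [OF f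
      g] h]])
    show "fst (comonad_comp1 P S (comonad_comp1 Q S h g) f) =
        fst (comonad_comp1 P S h (comonad_comp1 P R g f))"
      by (simp add: fcompose_assoc [OF oplax_functor [OF f] oplax_functor [OF g]
        oplax_functor [OF h]])
  qed (simp add: BS.Comp_assoc)
qed

lemma strict_2_category_Comonads: "strict_2_category (Comonads small)"
proof (rule strict_2_category.intro)
  let ?A = "Comonads small"
  fix W X Y Z :: "('a, 'a) comonad" and f g h
  assume "W \<in> Ob2 ?A" "X \<in> Ob2 ?A"
  then have co: "comonad W" "comonad X" by auto
  show "category (Hom2 ?A W X)" by (simp add: category_comonad_hom)
  show "Unit2 ?A W \<in> Obj (Hom2 ?A W W)"
    using oplax_identity [OF co(1)] by simp
  { assume "f \<in> Obj (Hom2 ?A W X)"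
    then show "comp1 ?A W X X (Unit2 ?A X) f = f"
      "comp1 ?A W W X f (Unit2 ?A W) = f"
      using co by (auto simp: oplax_identity [simplified] comonad_comp1_unit_left
          comonad_comp1_unit_right) }
  show "is_functor (prod_category (Hom2 ?A X Y) (Hom2 ?A W X))
      (Hom2 ?A W Y) (Comp2 ?A W X Y)"
    by (simp add: is_functor_Comonads_Comp2)
  assume "f \<in> Obj (Hom2 ?A W X)" "g \<in> Obj (Hom2 ?A X Y)"
    "h \<in> Obj (Hom2 ?A Y Z)"
  then have fgh: "oplax W X f" "oplax X Y g" "oplax Y Z h" by auto
  then show "comp1 ?A W X Z (comp1 ?A X Y Z h g) f =
      comp1 ?A W Y Z h (comp1 ?A W X Y g f)"
    using oplax_comp [OF fgh(1,2)] oplax_comp [OF fgh(2,3)] by (simp add: comonad_comp1_assoc)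
next
  let ?A = "Comonads small"
  fix W X Y Z :: "('a, 'a) comonad" and a b c
  assume "W \<in> Ob2 ?A" "X \<in> Ob2 ?A"
  then have co: "comonad W" "comonad X" by auto
  assume a: "a \<in> Arr (Hom2 ?A W X)"
  obtain f f' t where a': "a = Arrow f f' t" by (cases a)
  have t: "oplax W X f" "oplax W X f'" "t \<in> comonad_2cells W X f f'"
    using a by (auto simp: a')
  have n: "nat_trans (base W) (base X) (fst f) (fst f') t" using t by (simp add: comonad_2cells_iff)
  show "comp2 ?A W X X (Idn (Hom2 ?A X X) (Unit2 ?A X)) a = a"
    "comp2 ?A W W X a (Idn (Hom2 ?A W W) (Unit2 ?A W)) = a"
    using t comonad_2cells_identity [OF oplax_identity [OF co(1)]]
      comonad_2cells_identity [OF oplax_identity [OF co(2)]]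
    by (simp_all add: a' oplax_identity [simplified] co comonad_hcomp_def comonad_comp1_unit_left
        comonad_comp1_unit_right nt_hcomp_unit_left [OF n] nt_hcomp_unit_right [OF n])
  assume b: "b \<in> Arr (Hom2 ?A X Y)" and c: "c \<in> Arr (Hom2 ?A Y Z)"
  obtain g g' u where b': "b = Arrow g g' u" by (cases b)
  obtain h h' v where c': "c = Arrow h h' v" by (cases c)
  have u: "oplax X Y g" "oplax X Y g'" "u \<in> comonad_2cells X Y g g'"
    and v: "oplax Y Z h" "oplax Y Z h'" "v \<in> comonad_2cells Y Z h h'"
    using b c by (auto simp: b' c')
  have n': "nat_trans (base X) (base Y) (fst g) (fst g') u"
      "nat_trans (base Y) (base Z) (fst h) (fst h') v"
    using u v by (simp_all add: comonad_2cells_iff)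
  show "comp2 ?A W X Z (comp2 ?A X Y Z c b) a =
      comp2 ?A W Y Z c (comp2 ?A W X Y b a)"
    using t u v oplax_comp [OF t(1) u(1)] oplax_comp [OF t(2) u(2)] oplax_comp [OF u(1) v(1)]
        oplax_comp [OF u(2) v(2)]
      comonad_2cells_hcomp [OF t(1,2) u(1,2) t(3) u(3)] comonad_2cells_hcomp [OF u(1,2) v(1,2)
          u(3) v(3)]
    by (simp add: a' b' c' comonad_hcomp_def comonad_comp1_assoc nt_hcomp_assoc [OF n n'])
qed

section \<open>Products of comonads\<close>

text \<open>The identity structure map of a strict functor drops out, so composing with it merely applies
  \<open>p\<close> to the functor and to the structure map.\<close>

lemma comonad_comp1_strict:
  assumes h: "oplax Z P h" and "comonad Q" and p: "strict_comonad_functor P Q p"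
  shows "comonad_comp1 Z Q (strict_1cell P Q p) h =
    (fcompose (base Z) p (fst h), \<lambda>x\<in>Obj (base Z). FAr p (snd h x))"
proof -
  interpret h: oplax_comonad_functor Z P "fst h" "snd h" by fact
  interpret p: is_functor "base P" "base Q" p using p by (simp add: strict_comonad_functor_def)
  show ?thesis
    by (auto simp: comonad_comp1_eq strict_1cell_def fun_eq_iff)
qed

text \<open>Products of comonads are formed on the underlying categories. Since the projections commute
  strictly with the structure, every equation between structure maps on the product is tested
  on the two factors.\<close>

lemma strict_product_Comonads:
  assumes ob: "Q \<in> Ob2 (Comonads small)" "R \<in> Ob2 (Comonads small)" "P \<in> Ob2 (Comonads small)"
    and p: "strict_comonad_functor P Q p" and q: "strict_comonad_functor P R q"
    and cone: "product_cone (base P) (base Q) (base R) p q"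
  shows "strict_product (Comonads small) Q R P (strict_1cell P Q p) (strict_1cell P R q)"
proof -
  let ?A = "Comonads small"
  interpret strict_2_category ?A by (rule strict_2_category_Comonads)
  interpret cone: product_cone "base P" "base Q" "base R" p q by fact
  have co: "comonad Q" "comonad R" "comonad P" using ob by auto
  interpret P: comonad P by fact
  define p' where "p' = strict_1cell P Q p"
  define q' where "q' = strict_1cell P R q"
  have p': "oplax P Q p'" and q': "oplax P R q'"
    by (simp_all only: p'_def q'_def oplax_strict_1cell co p q)
  have comp: "comonad_comp1 Z Q p' h =
      (fcompose (base Z) p (fst h), \<lambda>x\<in>Obj (base Z). FAr p (snd h x))"
    "comonad_comp1 Z R q' h = (fcompose (base Z) q (fst h), \<lambda>x\<in>Obj (base Z). FAr q (snd h x))"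
    if "oplax Z P h" for Z :: "('a, 'a) comonad" and h
    using comonad_comp1_strict [OF that co(1) p] comonad_comp1_strict [OF that co(2) q]
    by (simp_all add: p'_def q'_def)
  have str: "FAr p (comult P x) = comult Q (FOb p x)" "FAr q (comult P x) = comult R (FOb q x)"
    "FAr p (counit P x) = counit Q (FOb p x)" "FAr q (counit P x) = counit R (FOb q x)"
    if "x \<in> Obj (base P)" for x
    using that p q by (simp_all add: strict_comonad_functor_def)
  note str = str strict_comonad_functor_FOb [OF p] strict_comonad_functor_FOb [OF q]
    strict_comonad_functor_FAr [OF p] strict_comonad_functor_FAr [OF q]
  have ex1: "\<exists>h. oplax Z P h \<and> comonad_comp1 Z Q p' h = f \<and> comonad_comp1 Z R q' h = g"
    if f: "oplax Z Q f" and g: "oplax Z R g" for Z :: "('a, 'a) comonad" and f g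
  proof -
    interpret f: oplax_comonad_functor Z Q "fst f" "snd f" by fact
    interpret g: oplax_comonad_functor Z R "fst g" "snd g" by fact
    have Z: "comonad Z" using f by (rule oplax_comonads)
    obtain H where H: "is_functor (base Z) (base P) H"
      "fcompose (base Z) p H = fst f" "fcompose (base Z) q H = fst g"
      using cone.functor_pairing [OF f.underlying_functor g.underlying_functor] .
    interpret H: is_functor "base Z" "base P" H by fact
    have pH: "FOb p (FOb H x) = FOb (fst f) x" "FOb q (FOb H x) = FOb (fst g) x"
      if "x \<in> Obj (base Z)" for x using that by (simp_all flip: H(2,3))
    have pH': "FAr p (FAr H x) = FAr (fst f) x" "FAr q (FAr H x) = FAr (fst g) x"
      if "x \<in> Arr (base Z)" for x using that by (simp_all flip: H(2,3))
    let ?S = "fcompose (base Z) H (endo Z)" and ?T = "fcompose (base Z) (endo P) H"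
    have S: "is_functor (base Z) (base P) ?S" and T: "is_functor (base Z) (base P) ?T"
      by (rule is_functor_fcompose; unfold_locales)+
    have "fcompose (base Z) p ?S = fcompose (base Z) (fst f) (endo Z)"
      "fcompose (base Z) q ?S = fcompose (base Z) (fst g) (endo Z)"
      unfolding H(2,3) [symmetric]
      by (rule fcompose_assoc [symmetric, OF comonad_functor [OF Z] H(1)]; unfold_locales)+
    moreover have "fcompose (base Z) p ?T = fcompose (base Z) (endo Q) (fst f)"
    proof -
      have "fcompose (base Z) p ?T = fcompose (base Z) (fcompose (base P) p (endo P)) H"
        by (rule fcompose_assoc [symmetric, OF H(1) comonad_functor [OF co(3)]]; unfold_locales)
      also have "\<dots> = fcompose (base Z) (fcompose (base P) (endo Q) p) H"
        using p by (simp add: strict_comonad_functor_def)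
      also have "\<dots> = fcompose (base Z) (endo Q) (fst f)"
        unfolding H(2) [symmetric] by (rule fcompose_assoc [OF H(1)]; unfold_locales)
      finally show ?thesis .
    qed
    moreover have "fcompose (base Z) q ?T = fcompose (base Z) (endo R) (fst g)"
    proof -
      have "fcompose (base Z) q ?T = fcompose (base Z) (fcompose (base P) q (endo P)) H"
        by (rule fcompose_assoc [symmetric, OF H(1) comonad_functor [OF co(3)]]; unfold_locales)
      also have "\<dots> = fcompose (base Z) (fcompose (base P) (endo R) q) H"
        using q by (simp add: strict_comonad_functor_def)
      also have "\<dots> = fcompose (base Z) (endo R) (fst g)"
        unfolding H(3) [symmetric] by (rule fcompose_assoc [OF H(1)]; unfold_locales)
      finally show ?thesis .
    qed
    ultimately have nat:
        "nat_trans (base Z) (base Q) (fcompose (base Z) p ?S) (fcompose (base Z) p ?T) (snd f)"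
      "nat_trans (base Z) (base R) (fcompose (base Z) q ?S) (fcompose (base Z) q ?T) (snd g)"
      using f.structure_map.nat_trans_axioms g.structure_map.nat_trans_axioms by simp_all
    obtain c where c: "nat_trans (base Z) (base P) ?S ?T c"
      "\<forall>x\<in>Obj (base Z). FAr p (c x) = snd f x" "\<forall>x\<in>Obj (base Z). FAr q (c x) = snd g x"
      using cone.nat_trans_pairing [OF S T nat] .
    interpret c: nat_trans "base Z" "base P" ?S ?T c by fact
    interpret Z2: comonad Z by fact
    have "oplax Z P (H, c)"
    proof (rule oplaxI [OF Z co(3)])
      fix x assume [simp]: "x \<in> Obj (base Z)"
      show "comult P (FOb (fst (H, c)) x) \<cdot>\<^bsub>base P\<^esub> snd (H, c) x = FAr (endo P) (snd (H, c) x) \<cdot>\<^bsub>base P\<^esub>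
          (snd (H, c) (FOb (endo Z) x) \<cdot>\<^bsub>base P\<^esub> FAr (fst (H, c)) (comult Z x))"
        by (rule cone.Arr_eqI)
          (auto simp: str c(2,3) pH pH' oplax_comult [OF f] oplax_comult [OF g])
      show "counit P (FOb (fst (H, c)) x) \<cdot>\<^bsub>base P\<^esub> snd (H, c) x = FAr (fst (H, c)) (counit Z x)"
        by (rule cone.Arr_eqI)
          (auto simp: str c(2,3) pH pH' f.counit_compatible g.counit_compatible)
    qed (use H(1) c(1) in auto)
    moreover have "(\<lambda>x\<in>Obj (base Z). FAr p (c x)) = snd f"
      by (rule extensionalityI [OF restrict_extensional f.structure_map.component_extensional])
        (simp add: c(2))
    moreover have "(\<lambda>x\<in>Obj (base Z). FAr q (c x)) = snd g"
      by (rule extensionalityI [OF restrict_extensional g.structure_map.component_extensional])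
        (simp add: c(3))
    ultimately show ?thesis
      using comp [of Z "(H, c)"] H(2,3) by (intro exI [of _ "(H, c)"]) simp
  qed
  have un1: "h = k"
    if h: "oplax Z P h" and k: "oplax Z P k" and eq:
        "comonad_comp1 Z Q p' h = comonad_comp1 Z Q p' k"
      "comonad_comp1 Z R q' h = comonad_comp1 Z R q' k" for Z :: "('a, 'a) comonad" and h k
  proof (rule oplax_eqI [OF h k])
    interpret h: oplax_comonad_functor Z P "fst h" "snd h" by fact
    interpret k: oplax_comonad_functor Z P "fst k" "snd k" by fact
    show "fst h = fst k"
      using eq cone.functor_pairing_unique [OF oplax_functor [OF h] oplax_functor [OF k]]
      by (simp add: comp [OF h] comp [OF k])
    fix x assume x: "x \<in> Obj (base Z)"
    have "(\<lambda>x\<in>Obj (base Z). FAr p (snd h x)) = (\<lambda>x\<in>Obj (base Z). FAr p (snd k x))"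
      "(\<lambda>x\<in>Obj (base Z). FAr q (snd h x)) = (\<lambda>x\<in>Obj (base Z). FAr q (snd k x))"
      using eq by (simp_all add: comp [OF h] comp [OF k])
    from fun_cong [OF this(1), of x] fun_cong [OF this(2), of x]
    show "snd h x = snd k x"
      using x cone.Arr_eqI [OF h.structure_map.component_Arr [OF x]
          k.structure_map.component_Arr [OF x]] by simp
  qed
  have whisker: "comp2 ?A Z P Q (Idn (comonad_hom P Q) p') (Arrow h k v) =
      Arrow (comonad_comp1 Z Q p' h) (comonad_comp1 Z Q p' k) (\<lambda>x\<in>Obj (base Z). FAr p (v x))"
    "comp2 ?A Z P R (Idn (comonad_hom P R) q') (Arrow h k v) =
      Arrow (comonad_comp1 Z R q' h) (comonad_comp1 Z R q' k) (\<lambda>x\<in>Obj (base Z). FAr q (v x))"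
    if "Arrow h k v \<in> Arr (comonad_hom Z P)" for Z h k v
  proof -
    have "nat_trans (base Z) (base P) (fst h) (fst k) v" using that by
        (simp add: comonad_2cells_iff)
    note nt_hcomp_whisker [OF this cone.p.is_functor_axioms] nt_hcomp_whisker [OF this
        cone.q.is_functor_axioms]
    moreover have "fst p' = p" "fst q' = q" by (simp_all add: p'_def q'_def strict_1cell_def)
    ultimately show "comp2 ?A Z P Q (Idn (comonad_hom P Q) p') (Arrow h k v) =
      Arrow (comonad_comp1 Z Q p' h) (comonad_comp1 Z Q p' k) (\<lambda>x\<in>Obj (base Z). FAr p (v x))"
      "comp2 ?A Z P R (Idn (comonad_hom P R) q') (Arrow h k v) =
      Arrow (comonad_comp1 Z R q' h) (comonad_comp1 Z R q' k) (\<lambda>x\<in>Obj (base Z). FAr q (v x))"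
      using that p' q' comonad_2cells_identity [OF p'] comonad_2cells_identity [OF q']
      by (simp_all add: comonad_hcomp_def)
  qed
  have ex2: "\<exists>c\<in>Arr (comonad_hom Z P). comp2 ?A Z P Q (Idn (comonad_hom P Q) p') c = a
      \<and> comp2 ?A Z P R (Idn (comonad_hom P R) q') c = b"
    if a: "a \<in> Arr (comonad_hom Z Q)" and b: "b \<in> Arr (comonad_hom Z R)" for Z ::
        "('a, 'a) comonad" and a b
  proof -
    obtain f f' t where a': "a = Arrow f f' t" by (cases a)
    obtain g g' u where b': "b = Arrow g g' u" by (cases b)
    have t: "oplax Z Q f" "oplax Z Q f'" "t \<in> comonad_2cells Z Q f f'"
      and u: "oplax Z R g" "oplax Z R g'" "u \<in> comonad_2cells Z R g g'"
      using a b by (auto simp: a' b')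
    obtain h where h: "oplax Z P h" "comonad_comp1 Z Q p' h = f" "comonad_comp1 Z R q' h = g"
      using ex1 [OF t(1) u(1)] by blast
    obtain h' where h': "oplax Z P h'" "comonad_comp1 Z Q p' h' = f'" "comonad_comp1 Z R q' h' = g'"
      using ex1 [OF t(2) u(2)] by blast
    interpret h: oplax_comonad_functor Z P "fst h" "snd h" by (rule h(1))
    interpret h': oplax_comonad_functor Z P "fst h'" "snd h'" by (rule h'(1))
    have f: "f = (fcompose (base Z) p (fst h), \<lambda>x\<in>Obj (base Z). FAr p (snd h x))"
      "f' = (fcompose (base Z) p (fst h'), \<lambda>x\<in>Obj (base Z). FAr p (snd h' x))"
      "g = (fcompose (base Z) q (fst h), \<lambda>x\<in>Obj (base Z). FAr q (snd h x))"
      "g' = (fcompose (base Z) q (fst h'), \<lambda>x\<in>Obj (base Z). FAr q (snd h' x))"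
      using h(2,3) h'(2,3) comp [OF h(1)] comp [OF h'(1)] by simp_all
    have nat: "nat_trans (base Z) (base Q) (fcompose (base Z) p (fst h)) (fcompose (base Z) p (fst
        h')) t"
      "nat_trans (base Z) (base R) (fcompose (base Z) q (fst h)) (fcompose (base Z) q (fst h')) u"
      using t(3) u(3) by (simp_all add: comonad_2cells_iff f)
    obtain v where v: "nat_trans (base Z) (base P) (fst h) (fst h') v"
      "\<forall>x\<in>Obj (base Z). FAr p (v x) = t x" "\<forall>x\<in>Obj (base Z). FAr q (v x) = u x"
      using cone.nat_trans_pairing [OF oplax_functor [OF h(1)] oplax_functor [OF h'(1)] nat] .
    interpret v: nat_trans "base Z" "base P" "fst h" "fst h'" v by fact
    have "FAr (endo P) (v x) \<cdot>\<^bsub>base P\<^esub> snd h x = snd h' x \<cdot>\<^bsub>base P\<^esub> v (FOb (endo Z) x)"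
      if [simp]: "x \<in> Obj (base Z)" for x
      by (rule cone.Arr_eqI) (use t(3) u(3) in \<open>auto simp: comonad_2cells_iff f str v(2,3)\<close>)
    then have c: "Arrow h h' v \<in> Arr (comonad_hom Z P)"
      using h(1) h'(1) v(1) by (simp add: comonad_2cells_iff)
    have "(\<lambda>x\<in>Obj (base Z). FAr p (v x)) = t"
      by (rule extensionalityI [OF restrict_extensional
        nat_trans.component_extensional [OF nat(1)]]) (simp add: v(2))
    moreover have "(\<lambda>x\<in>Obj (base Z). FAr q (v x)) = u"
      by (rule extensionalityI [OF restrict_extensional
        nat_trans.component_extensional [OF nat(2)]]) (simp add: v(3))
    ultimately show ?thesis
      using whisker [OF c] h(2,3) h'(2,3) by (intro bexI [OF _ c]) (simp add: a' b')
  qed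
  have un2: "c = d"
    if c: "c \<in> Arr (comonad_hom Z P)" and d: "d \<in> Arr (comonad_hom Z P)"
      and eq: "comp2 ?A Z P Q (Idn (comonad_hom P Q) p') c =
        comp2 ?A Z P Q (Idn (comonad_hom P Q) p') d"
      "comp2 ?A Z P R (Idn (comonad_hom P R) q') c =
        comp2 ?A Z P R (Idn (comonad_hom P R) q') d" for Z c d
  proof -
    obtain h h' v where c': "c = Arrow h h' v" by (cases c)
    obtain k k' w where d': "d = Arrow k k' w" by (cases d)
    have eq': "comonad_comp1 Z Q p' h = comonad_comp1 Z Q p' k"
        "comonad_comp1 Z Q p' h' = comonad_comp1 Z Q p' k'"
      "comonad_comp1 Z R q' h = comonad_comp1 Z R q' k"
          "comonad_comp1 Z R q' h' = comonad_comp1 Z R q' k'"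
      "(\<lambda>x\<in>Obj (base Z). FAr p (v x)) = (\<lambda>x\<in>Obj (base Z). FAr p (w x))"
      "(\<lambda>x\<in>Obj (base Z). FAr q (v x)) = (\<lambda>x\<in>Obj (base Z). FAr q (w x))"
      using eq whisker [OF c [unfolded c']] whisker [OF d [unfolded d']] unfolding c' d' by auto
    have hk: "h = k" "h' = k'"
      using un1 [of Z h k] un1 [of Z h' k'] eq'(1-4) c d by (simp_all add: c' d')
    have n: "nat_trans (base Z) (base P) (fst h) (fst h') v"
        "nat_trans (base Z) (base P) (fst h) (fst h') w"
      using c d by (auto simp: c' d' hk comonad_2cells_iff)
    have "v = w"
    proof (rule nat_trans_eqI [OF n])
      fix x assume x: "x \<in> Obj (base Z)"
      show "v x = w x"
        by (rule cone.Arr_eqI) (use n x fun_cong [OF eq'(5), of x] fun_cong [OF eq'(6), of x]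
          in \<open>auto intro: nat_trans.component_Arr\<close>)
    qed
    then show ?thesis by (simp add: c' d' hk)
  qed
  show ?thesis
    unfolding p'_def [symmetric] q'_def [symmetric]
  proof (rule strict_productI [OF ob], goal_cases)
    case (3 Z f g)
    then have "oplax Z Q f" "oplax Z R g" by auto
    from ex1 [OF this] p' q' show ?case by auto
  next
    case (4 Z h k)
    then show ?case using un1 [of Z h k] p' q' by simp
  next
    case (5 Z a b)
    then show ?case using ex2 [of a Z b] by simp
  next
    case (6 Z c d)
    then show ?case using un2 [of c Z d] by simp
  qed (use p' q' in auto)
qed

text \<open>Into a terminal category every functor commutes strictly with the comonad structure, which
  supplies the 1-cell; uniqueness holds because parallel data cannot differ.\<close>

lemma strict_final_Comonads:
  assumes ob: "T \<in> Ob2 (Comonads small)" and tmnl: "terminal_category (base T)"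
  shows "strict_final (Comonads small) T"
  unfolding strict_final_def
proof (intro conjI ballI)
  fix Z :: "('a, 'a) comonad" assume "Z \<in> Ob2 (Comonads small)"
  then have co: "comonad Z" "comonad T" using ob by auto
  interpret Z: comonad Z by fact
  interpret T: comonad T by fact
  interpret H: category "comonad_hom Z T" by (rule category_comonad_hom)
  have "category (base Z)" by unfold_locales
  then obtain S where S: "is_functor (base Z) (base T) S"
    using functor_to_terminal_exists [OF _ tmnl] by blast
  interpret S: is_functor "base Z" "base T" S by fact
  have "fcompose (base Z) S (endo Z) = fcompose (base Z) (endo T) S"
    by (rule functor_to_terminal_unique [OF tmnl]; rule is_functor_fcompose; unfold_locales)
  moreover have "FAr S (comult Z x) = comult T (FOb S x)" "FAr S (counit Z x) = counit T (FOb S x)"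
    if "x \<in> Obj (base Z)" for x
    using that by (auto intro!: terminal_arrow [OF tmnl])
  ultimately have "strict_comonad_functor Z T S"
    using S by (simp add: strict_comonad_functor_def)
  then have s: "oplax Z T (strict_1cell Z T S)" by (rule oplax_strict_1cell [OF co])
  define s where "s = strict_1cell Z T S"
  have un: "f = s" if f: "oplax Z T f" for f
  proof (rule oplax_eqI [OF f])
    interpret f: oplax_comonad_functor Z T "fst f" "snd f" by fact
    interpret s: oplax_comonad_functor Z T "fst s" "snd s" using s by (simp add: s_def)
    show "oplax Z T s" using s by (simp add: s_def)
    show "fst f = fst s"
      by (rule functor_to_terminal_unique [OF tmnl f.underlying_functor s.underlying_functor])
    show "snd f x = snd s x" if "x \<in> Obj (base Z)" for x
      using that by (auto intro!: terminal_arrow [OF tmnl])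
  qed
  have Obj: "f \<in> Obj (comonad_hom Z T) \<longleftrightarrow> f = s" for f
    using un [of f] s by (auto simp: s_def)
  have "c = Idn (comonad_hom Z T) s" if c: "c \<in> Arr (comonad_hom Z T)" for c
  proof -
    obtain h h' v where c': "c = Arrow h h' v" by (cases c)
    have h: "h = s" "h' = s" using c un [of h] un [of h'] by (auto simp: c')
    have "nat_trans (base Z) (base T) (fst s) (fst s) v" "is_functor (base Z) (base T) (fst s)"
      using c by (auto simp: c' h comonad_2cells_iff intro: oplax_functor)
    from nat_trans_to_terminal_unique [OF tmnl this(1) nat_trans_identity [OF this(2)]]
    show ?thesis using s by (simp add: c' h s_def)
  qed
  moreover have "Idn (comonad_hom Z T) s \<in> Arr (comonad_hom Z T)"
    using Obj by (intro H.Idn_Arr) blast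
  ultimately have "Obj (comonad_hom Z T) = {s}" "Arr (comonad_hom Z T) = {Idn (comonad_hom Z T) s}"
    using Obj by blast+
  then have "terminal_category (comonad_hom Z T)"
    using H.category_axioms by (auto simp: terminal_category_def)
  then show "\<exists>F. iso_of_categories (Hom2 (Comonads small) Z T) one_category F"
    by (simp add: terminal_category_iso_one)
qed (rule ob)

section \<open>Existence of finite products\<close>

text \<open>Products and categories of coalgebras have pairs as objects. Renaming objects and morphisms along
  injections moves such categories into the universe.\<close>

locale encoded_category = category C
  for C :: "('o, 'm) category" and e :: "'o \<Rightarrow> 'p" and d :: "'m \<Rightarrow> 'n" +
  assumes inj_e: "inj_on e (Obj C)" and inj_d: "inj_on d (Arr C)"
begin

lemma Obj_encode [simp]: "Obj (encode_category e d C) = e ` Obj C"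
  and Arr_encode [simp]: "Arr (encode_category e d C) = d ` Arr C"
  by (simp_all add: encode_category_def Let_def)

lemma encode_simps [simp]:
  "f \<in> Arr C \<Longrightarrow> Dom (encode_category e d C) (d f) = e (Dom C f)"
  "f \<in> Arr C \<Longrightarrow> Cod (encode_category e d C) (d f) = e (Cod C f)"
  "x \<in> Obj C \<Longrightarrow> Idn (encode_category e d C) (e x) = d (Idn C x)"
  "\<lbrakk>f \<in> Arr C; g \<in> Arr C; Dom C g = Cod C f\<rbrakk>
    \<Longrightarrow> d g \<cdot>\<^bsub>encode_category e d C\<^esub> d f = d (g \<cdot>\<^bsub>C\<^esub> f)"
  by (simp_all add: encode_category_def Let_def inv_into_f_f [OF inj_e] inv_into_f_f [OF inj_d])

lemma category_encode: "category (encode_category e d C)"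
proof -
  have e_eq: "e x = e y \<longleftrightarrow> x = y" if "x \<in> Obj C" "y \<in> Obj C" for x y
    using inj_onD [OF inj_e] that by blast
  show ?thesis
  proof
    show "Dom (encode_category e d C) \<in> Arr (encode_category e d C) \<rightarrow>\<^sub>E Obj (encode_category e d C)"
      "Cod (encode_category e d C) \<in> Arr (encode_category e d C) \<rightarrow>\<^sub>E Obj (encode_category e d C)"
      "Idn (encode_category e d C) \<in> Obj (encode_category e d C) \<rightarrow>\<^sub>E Arr (encode_category e d C)"
      by (auto simp: encode_category_def Let_def inv_into_f_f [OF inj_e] inv_into_f_f [OF inj_d]
        split: if_splits)
    fix f g
    show "g \<cdot>\<^bsub>encode_category e d C\<^esub> f = undefined"
      if "\<not> (f \<in> Arr (encode_category e d C) \<and> g \<in> Arr (encode_category e d C) \<and>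
        Dom (encode_category e d C) g = Cod (encode_category e d C) f)"
      using that by (auto simp: encode_category_def Let_def)
  qed (auto simp: e_eq Comp_assoc)
qed

lemma decode_simps [simp]:
  "x \<in> Obj C \<Longrightarrow> FOb (decode_functor e d C) (e x) = x"
  "f \<in> Arr C \<Longrightarrow> FAr (decode_functor e d C) (d f) = f"
  by (simp_all add: decode_functor_def inv_into_f_f [OF inj_e] inv_into_f_f [OF inj_d])

lemma encode_functor_simps [simp]:
  "x \<in> Obj C \<Longrightarrow> FOb (encode_functor e d C) x = e x"
  "f \<in> Arr C \<Longrightarrow> FAr (encode_functor e d C) f = d f"
  by (simp_all add: encode_functor_def)

lemma is_functor_encode: "is_functor C (encode_category e d C) (encode_functor e d C)"
  by (rule is_functorI) (auto simp: category_axioms category_encode, auto simp: encode_functor_def)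

lemma is_functor_decode: "is_functor (encode_category e d C) C (decode_functor e d C)"
proof -
  have e_eq: "e x = e y \<longleftrightarrow> x = y" if "x \<in> Obj C" "y \<in> Obj C" for x y
    using inj_onD [OF inj_e] that by blast
  show ?thesis
    by (rule is_functorI)
      (auto simp: category_axioms category_encode e_eq, auto simp: decode_functor_def)
qed

end

lemma nat_trans_whisker_right:
  assumes "nat_trans D E G G' b" "is_functor C D F"
  shows "nat_trans C E (fcompose C G F) (fcompose C G' F) (\<lambda>x\<in>Obj C. b (FOb F x))"
proof -
  interpret b: nat_trans D E G G' b by fact
  interpret F: is_functor C D F by fact
  show ?thesis
  proof (rule nat_transI)
    show "is_functor C E (fcompose C G F)" "is_functor C E (fcompose C G' F)"
      by (rule is_functor_fcompose; unfold_locales)+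
    show "(\<lambda>x\<in>Obj C. b (FOb F x)) (Cod C f) \<cdot>\<^bsub>E\<^esub> FAr (fcompose C G F) f =
      FAr (fcompose C G' F) f \<cdot>\<^bsub>E\<^esub> (\<lambda>x\<in>Obj C. b (FOb F x)) (Dom C f)" if "f \<in> Arr C" for f
      using that b.naturality [of "FAr F f"] by simp
  qed auto
qed

text \<open>The structure on \<open>E\<close> is the pairing of the structures of \<open>Q\<close> and \<open>R\<close>; its laws hold because they
  hold after both projections.\<close>

lemma (in product_cone) product_comonad:
  assumes Q: "comonad Q" "base Q = C" and R: "comonad R" "base R = D"
  obtains P where "comonad P" "base P = E" "strict_comonad_functor P Q p"
      "strict_comonad_functor P R q"
proof -
  interpret Q: comonad Q by (rule Q(1))
  interpret R: comonad R by (rule R(1))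
  have fQ: "is_functor C C (endo Q)" using comonad_functor [OF Q(1)] Q(2) by simp
  have fR: "is_functor D D (endo R)" using comonad_functor [OF R(1)] R(2) by simp
  interpret fQ: is_functor C C "endo Q" by fact
  interpret fR: is_functor D D "endo R" by fact
  have p: "is_functor E C p" and q: "is_functor E D q" by unfold_locales
  obtain T where T: "is_functor E E T" "fcompose E p T = fcompose E (endo Q) p"
    "fcompose E q T = fcompose E (endo R) q"
    using functor_pairing [OF is_functor_fcompose [OF p fQ] is_functor_fcompose [OF q fR]] .
  interpret T: is_functor E E T by (rule T(1))
  have pT: "FOb p (FOb T x) = FOb (endo Q) (FOb p x)" "FOb q (FOb T x) = FOb (endo R) (FOb q x)"
    if "x \<in> Obj E" for x
    using that arg_cong [OF T(2), of "\<lambda>H. FOb H x"] arg_cong [OF T(3), of "\<lambda>H. FOb H x"] by simp_all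
  have pT': "FAr p (FAr T f) = FAr (endo Q) (FAr p f)" "FAr q (FAr T f) = FAr (endo R) (FAr q f)"
    if "f \<in> Arr E" for f
    using that arg_cong [OF T(2), of "\<lambda>H. FAr H f"] arg_cong [OF T(3), of "\<lambda>H. FAr H f"] by simp_all
  have TT: "is_functor E E (fcompose E T T)" by (rule is_functor_fcompose [OF T(1) T(1)])
  have I: "is_functor E E (fidentity E)" by (rule is_functor_fidentity) unfold_locales
  have pTT: "fcompose E p (fcompose E T T) = fcompose E (fcompose C (endo Q) (endo Q)) p"
    by (rule functor_eqI [OF is_functor_fcompose [OF TT p]
          is_functor_fcompose [OF p is_functor_fcompose [OF fQ fQ]]]) (simp_all add: pT pT')
  have qTT: "fcompose E q (fcompose E T T) = fcompose E (fcompose D (endo R) (endo R)) q"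
    by (rule functor_eqI [OF is_functor_fcompose [OF TT q]
          is_functor_fcompose [OF q is_functor_fcompose [OF fR fR]]]) (simp_all add: pT pT')
  have w: "nat_trans E C (fcompose E p T) (fcompose E p (fcompose E T T)) (\<lambda>x\<in>Obj E. comult Q (FOb
      p x))"
    "nat_trans E D (fcompose E q T) (fcompose E q (fcompose E T T)) (\<lambda>x\<in>Obj E. comult R (FOb q x))"
    unfolding T(2,3) pTT qTT
    using nat_trans_whisker_right [OF Q.comult.nat_trans_axioms p [folded Q(2)]]
      nat_trans_whisker_right [OF R.comult.nat_trans_axioms q [folded R(2)]] Q(2) R(2) by simp_all
  have n: "nat_trans E C (fcompose E p T) (fcompose E p (fidentity E)) (\<lambda>x\<in>Obj E. counit Q (FOb p
      x))"
    "nat_trans E D (fcompose E q T) (fcompose E q (fidentity E)) (\<lambda>x\<in>Obj E. counit R (FOb q x))"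
    unfolding T(2,3) fcompose_fidentity_right [OF p] fcompose_fidentity_right [OF q]
    using nat_trans_whisker_right [OF Q.counit.nat_trans_axioms p [folded Q(2)]]
      nat_trans_whisker_right [OF R.counit.nat_trans_axioms q [folded R(2)]] Q(2) R(2)
      fcompose_fidentity_left [OF p] fcompose_fidentity_left [OF q] by simp_all
  obtain c where c: "nat_trans E E T (fcompose E T T) c"
    "\<forall>x\<in>Obj E. FAr p (c x) = (\<lambda>x\<in>Obj E. comult Q (FOb p x)) x"
    "\<forall>x\<in>Obj E. FAr q (c x) = (\<lambda>x\<in>Obj E. comult R (FOb q x)) x"
    using nat_trans_pairing [OF T(1) TT w] .
  obtain u where u: "nat_trans E E T (fidentity E) u"
    "\<forall>x\<in>Obj E. FAr p (u x) = (\<lambda>x\<in>Obj E. counit Q (FOb p x)) x"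
    "\<forall>x\<in>Obj E. FAr q (u x) = (\<lambda>x\<in>Obj E. counit R (FOb q x)) x"
    using nat_trans_pairing [OF T(1) I n] .
  interpret c: nat_trans E E T "fcompose E T T" c by (rule c(1))
  interpret u: nat_trans E E T "fidentity E" u by (rule u(1))
  define P where "P = \<lparr>base = E, endo = T, comult = c, counit = u\<rparr>"
  note Qlaws = Q.coassociative Q.counit_left Q.counit_right and Rlaws =
      R.coassociative R.counit_left R.counit_right
  have "comonad P"
  proof (intro comonad.intro comonad_axioms.intro)
    show "nat_trans (base P) (base P) (endo P) (fcompose (base P) (endo P) (endo P)) (comult P)"
      "nat_trans (base P) (base P) (endo P) (fidentity (base P)) (counit P)"
      using c(1) u(1) by (simp_all add: P_def)
    fix x assume "x \<in> Obj (base P)"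
    then have [simp]: "x \<in> Obj E" by (simp add: P_def)
    have "c (FOb T x) \<cdot>\<^bsub>E\<^esub> c x = FAr T (c x) \<cdot>\<^bsub>E\<^esub> c x"
      by (rule Arr_eqI) (use Qlaws(1) [of "FOb p x"] Rlaws(1) [of "FOb q x"] in
          \<open>auto simp: c(2,3) pT pT' Q(2) R(2)\<close>)
    then show "comult P (FOb (endo P) x) \<cdot>\<^bsub>base P\<^esub> comult P x =
        FAr (endo P) (comult P x) \<cdot>\<^bsub>base P\<^esub> comult P x"
      by (simp add: P_def)
    have "u (FOb T x) \<cdot>\<^bsub>E\<^esub> c x = Idn E (FOb T x)"
      by (rule Arr_eqI) (use Qlaws(2) [of "FOb p x"] Rlaws(2) [of "FOb q x"] in
          \<open>auto simp: c(2,3) u(2,3) pT pT' Q(2) R(2)\<close>)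
    then show "counit P (FOb (endo P) x) \<cdot>\<^bsub>base P\<^esub> comult P x = Idn (base P) (FOb (endo P) x)"
      by (simp add: P_def)
    have "FAr T (u x) \<cdot>\<^bsub>E\<^esub> c x = Idn E (FOb T x)"
      by (rule Arr_eqI) (use Qlaws(3) [of "FOb p x"] Rlaws(3) [of "FOb q x"] in
          \<open>auto simp: c(2,3) u(2,3) pT pT' Q(2) R(2)\<close>)
    then show "FAr (endo P) (counit P x) \<cdot>\<^bsub>base P\<^esub> comult P x = Idn (base P) (FOb (endo P) x)"
      by (simp add: P_def)
  qed
  moreover have "base P = E" by (simp add: P_def)
  moreover have "strict_comonad_functor P Q p" "strict_comonad_functor P R q"
    using p q T(2,3) by (auto simp: strict_comonad_functor_def P_def Q(2) R(2) c(2,3) u(2,3))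
  ultimately show ?thesis using that by blast
qed

definition identity_comonad :: "('o, 'm) category \<Rightarrow> ('o, 'm) comonad" where
  "identity_comonad C = \<lparr>base = C, endo = fidentity C,
     comult = nt_identity C C (fidentity C), counit = nt_identity C C (fidentity C)\<rparr>"

lemma comonad_identity_comonad:
  assumes "category C" shows "comonad (identity_comonad C)"
proof -
  interpret category C by fact
  have I: "is_functor C C (fidentity C)" by (rule is_functor_fidentity [OF assms])
  have n: "nat_trans C C (fidentity C) (fidentity C) (nt_identity C C (fidentity C))"
    by (rule nat_trans_identity [OF I])
  show ?thesis
    by (intro comonad.intro comonad_axioms.intro)
      (simp_all add: identity_comonad_def n fcompose_fidentity_left [OF I])
qed

context universe
begin

lemma pr_eq [simp]: "pr x = pr y \<longleftrightarrow> x = y"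
  using inj_pr by (auto dest: injD)

lemma encoded_category_pr: "category C \<Longrightarrow> encoded_category C pr pr"
  by (simp add: encoded_category_def encoded_category_axioms_def inj_on_def)

lemma small_product_category:
  fixes C D :: "('u, 'u) category"
  assumes C: "small_category small C" and D: "small_category small D"
  obtains E :: "('u, 'u) category" and p q where "small_category small E" "product_cone E C D p q"
proof -
  let ?P = "prod_category C D"
  have P: "category ?P" using assms by (intro category_prod_category)
      (auto simp: small_category_def)
  interpret C: category C using C by (simp add: small_category_def)
  interpret D: category D using D by (simp add: small_category_def)
  interpret encoded_category ?P pr pr by (rule encoded_category_pr [OF P])
  define E where "E = encode_category pr pr ?P"
  have dec: "is_functor E ?P (decode_functor pr pr ?P)" unfolding E_def by (rule is_functor_decode)
  define p :: "('u \<times> 'u, 'u \<times> 'u, 'u, 'u) cfunctor"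
    where "p = \<lparr>FOb = restrict fst (Obj ?P), FAr = restrict fst (Arr ?P)\<rparr>"
  define q :: "('u \<times> 'u, 'u \<times> 'u, 'u, 'u) cfunctor"
    where "q = \<lparr>FOb = restrict snd (Obj ?P), FAr = restrict snd (Arr ?P)\<rparr>"
  have p: "is_functor ?P C p" and q: "is_functor ?P D q"
    by (rule is_functorI; use P C D in \<open>auto simp: p_def q_def small_category_def\<close>)+
  have "product_cone E C D (fcompose E p (decode_functor pr pr ?P)) (fcompose E q (decode_functor
      pr pr ?P))"
  proof (intro product_cone.intro product_cone_axioms.intro)
    show "is_functor E C (fcompose E p (decode_functor pr pr ?P))"
      "is_functor E D (fcompose E q (decode_functor pr pr ?P))"
      using is_functor_fcompose [OF dec] p q by auto
    show "bij_betw (\<lambda>x. (FOb (fcompose E p (decode_functor pr pr ?P)) x,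
        FOb (fcompose E q (decode_functor pr pr ?P)) x)) (Obj E) (Obj C \<times> Obj D)"
      by (rule bij_betw_byWitness [where f' = pr]) (auto simp: E_def p_def q_def)
    show "bij_betw (\<lambda>x. (FAr (fcompose E p (decode_functor pr pr ?P)) x,
        FAr (fcompose E q (decode_functor pr pr ?P)) x)) (Arr E) (Arr C \<times> Arr D)"
      by (rule bij_betw_byWitness [where f' = pr]) (auto simp: E_def p_def q_def)
  qed
  moreover have "small_category small E"
    using assms small_Times category_encode by (auto simp: small_category_def E_def)
  ultimately show ?thesis using that by blast
qed

lemma small_terminal_category:
  obtains C :: "('u, 'u) category" where "small_category small C" "terminal_category C"
proof -
  obtain u :: 'u where True by simp
  interpret encoded_category one_category "\<lambda>_. u" "\<lambda>_. u"
    using category_one_category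
    by (simp add: encoded_category_def encoded_category_axioms_def inj_on_def)
  let ?C = "encode_category (\<lambda>_. u) (\<lambda>_. u) one_category"
  have "Obj ?C = {u}" "Arr ?C = {u}" unfolding Obj_encode Arr_encode by
      (auto simp: one_category_def)
  then have "small_category small ?C" "terminal_category ?C"
    using category_encode small_singleton by (auto simp: small_category_def terminal_category_def)
  then show ?thesis using that by blast
qed

lemma Comonads_product_cone_exists:
  assumes "Q \<in> Ob2 (Comonads small)" "R \<in> Ob2 (Comonads small)"
  obtains P p q where "P \<in> Ob2 (Comonads small)" "strict_comonad_functor P Q p"
    "strict_comonad_functor P R q" "product_cone (base P) (base Q) (base R) p q"
proof -
  obtain E :: "('u, 'u) category" and p q where E: "small_category small E"
    "product_cone E (base Q) (base R) p q"
    using small_product_category [of "base Q" "base R"] assms by auto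
  interpret product_cone E "base Q" "base R" p q by fact
  obtain P where "comonad P" "base P = E" "strict_comonad_functor P Q p"
      "strict_comonad_functor P R q"
    using product_comonad [of Q R] assms by auto
  then show ?thesis using that E by auto
qed

lemma has_strict_finite_products_Functors: "has_strict_finite_products (Functors small)"
  unfolding has_strict_finite_products_def
proof (intro conjI ballI)
  obtain C :: "('u, 'u) category" where C: "small_category small C" "terminal_category C"
    using small_terminal_category .
  then have "strict_final (Functors small) \<lparr>fsrc = C, ftgt = C, ffun = fidentity C\<rparr>"
    by (intro strict_final_Functors)
      (auto simp: functor_obj_def small_category_def intro: is_functor_fidentity)
  then show "\<exists>T. strict_final (Functors small) T" by blast
next
  fix X Y assume XY: "X \<in> Ob2 (Functors small)" "Y \<in> Ob2 (Functors small)"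
  have X: "is_functor (fsrc X) (ftgt X) (ffun X)" and Y: "is_functor (fsrc Y) (ftgt Y) (ffun Y)"
    using XY by (auto simp: functor_obj_def)
  obtain E :: "('u, 'u) category" and p q where E: "small_category small E"
    "product_cone E (fsrc X) (fsrc Y) p q"
    using small_product_category [of "fsrc X" "fsrc Y"] XY by auto
  obtain E' :: "('u, 'u) category" and p' q' where E': "small_category small E'"
    "product_cone E' (ftgt X) (ftgt Y) p' q'"
    using small_product_category [of "ftgt X" "ftgt Y"] XY by auto
  interpret s: product_cone E "fsrc X" "fsrc Y" p q by (rule E(2))
  interpret t: product_cone E' "ftgt X" "ftgt Y" p' q' by (rule E'(2))
  obtain F where F: "is_functor E E' F" "fcompose E p' F = fcompose E (ffun X) p"
    "fcompose E q' F = fcompose E (ffun Y) q"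
    using t.functor_pairing [OF is_functor_fcompose [OF s.p.is_functor_axioms X]
        is_functor_fcompose [OF s.q.is_functor_axioms Y]] .
  have "strict_product (Functors small) X Y \<lparr>fsrc = E, ftgt = E', ffun = F\<rparr> (p, p') (q, q')"
    by (rule strict_product_Functors)
      (use XY E E' F s.p.is_functor_axioms s.q.is_functor_axioms t.p.is_functor_axioms
        t.q.is_functor_axioms
        in \<open>auto simp: functor_obj_def commuting_square_def\<close>)
  then show "\<exists>P p q. strict_product (Functors small) X Y P p q" by blast
qed

end

section \<open>Coalgebras\<close>

lemma coalgebras_iff:
  "X \<in> coalgebras Q \<longleftrightarrow> fst X \<in> Obj (base Q) \<and> snd X \<in> Arr (base Q) \<and>
     Dom (base Q) (snd X) = fst X \<and> Cod (base Q) (snd X) = FOb (endo Q) (fst X) \<and>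
     comult Q (fst X) \<cdot>\<^bsub>base Q\<^esub> snd X = FAr (endo Q) (snd X) \<cdot>\<^bsub>base Q\<^esub> snd X \<and>
     counit Q (fst X) \<cdot>\<^bsub>base Q\<^esub> snd X = Idn (base Q) (fst X)"
  by (auto simp: coalgebras_def)

lemma coalgebra_laws:
  assumes "X \<in> coalgebras Q"
  shows "comult Q (fst X) \<cdot>\<^bsub>base Q\<^esub> snd X = FAr (endo Q) (snd X) \<cdot>\<^bsub>base Q\<^esub> snd X"
    "counit Q (fst X) \<cdot>\<^bsub>base Q\<^esub> snd X = Idn (base Q) (fst X)"
  using assms by (auto simp: coalgebras_iff)

lemma coalgebrasD [simp]:
  assumes "X \<in> coalgebras Q"
  shows "fst X \<in> Obj (base Q)" "snd X \<in> Arr (base Q)" "Dom (base Q) (snd X) = fst X"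
    "Cod (base Q) (snd X) = FOb (endo Q) (fst X)"
  using assms by (auto simp: coalgebras_iff)

lemma Cog_eq:
  "Cog Q = arrow_category (coalgebras Q)
     (\<lambda>X Y. {f \<in> Arr (base Q). Dom (base Q) f = fst X \<and> Cod (base Q) f = fst Y \<and>
        FAr (endo Q) f \<cdot>\<^bsub>base Q\<^esub> snd X = snd Y \<cdot>\<^bsub>base Q\<^esub> f})
     (\<lambda>X. Idn (base Q) (fst X)) (Comp (base Q))"
  unfolding Cog_def by (simp add: case_prod_unfold)

lemma Obj_Cog [simp]: "Obj (Cog Q) = coalgebras Q"
  by (simp add: Cog_eq)

lemma Arrow_in_Cog [simp]:
  "Arrow X Y f \<in> Arr (Cog Q) \<longleftrightarrow> X \<in> coalgebras Q \<and> Y \<in> coalgebras Q \<and> f \<in> Arr (base Q) \<and>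
    Dom (base Q) f = fst X \<and> Cod (base Q) f = fst Y \<and>
    FAr (endo Q) f \<cdot>\<^bsub>base Q\<^esub> snd X = snd Y \<cdot>\<^bsub>base Q\<^esub> f"
  by (simp add: Cog_eq)

lemma Arr_Cog_commutes:
  assumes "a \<in> Arr (Cog Q)"
  shows "FAr (endo Q) (under a) \<cdot>\<^bsub>base Q\<^esub> snd (src a) = snd (tgt a) \<cdot>\<^bsub>base Q\<^esub> under a"
  using assms by (auto simp: Cog_eq Arr_arrow_category)

lemma Arr_CogD [simp]:
  assumes "a \<in> Arr (Cog Q)"
  shows "src a \<in> coalgebras Q" "tgt a \<in> coalgebras Q" "under a \<in> Arr (base Q)"
    "Dom (base Q) (under a) = fst (src a)" "Cod (base Q) (under a) = fst (tgt a)"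
    "Dom (Cog Q) a = src a" "Cod (Cog Q) a = tgt a"
  using assms by (auto simp: Cog_eq) (auto simp: Arr_arrow_category)

lemma Idn_Cog [simp]: "X \<in> coalgebras Q \<Longrightarrow> Idn (Cog Q) X = Arrow X X (Idn (base Q) (fst X))"
  by (simp add: Cog_eq)

lemma Comp_Cog [simp]:
  assumes "a \<in> Arr (Cog Q)" "b \<in> Arr (Cog Q)" "src b = tgt a"
  shows "b \<cdot>\<^bsub>Cog Q\<^esub> a = Arrow (src a) (tgt b) (under b \<cdot>\<^bsub>base Q\<^esub> under a)"
  using assms by (simp add: Cog_eq)

lemma category_Cog:
  assumes "comonad Q" shows "category (Cog Q)"
proof -
  interpret B: category "base Q" by (rule comonad_category [OF assms])
  interpret Q: comonad Q by fact
  show ?thesis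
    unfolding Cog_eq
  proof (rule category_arrow_category, goal_cases)
    case (2 X Y Z f g)
    then have g: "FAr (endo Q) g \<cdot>\<^bsub>base Q\<^esub> snd Y = snd Z \<cdot>\<^bsub>base Q\<^esub> g"
      and f: "FAr (endo Q) f \<cdot>\<^bsub>base Q\<^esub> snd X = snd Y \<cdot>\<^bsub>base Q\<^esub> f" by auto
    have "FAr (endo Q) (g \<cdot>\<^bsub>base Q\<^esub> f) \<cdot>\<^bsub>base Q\<^esub> snd X = FAr (endo Q) g \<cdot>\<^bsub>base Q\<^esub> (snd Y \<cdot>\<^bsub>base Q\<^esub> f)"
      using 2 by (simp add: B.Comp_assoc f)
    also have "\<dots> = (snd Z \<cdot>\<^bsub>base Q\<^esub> g) \<cdot>\<^bsub>base Q\<^esub> f"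
      by (rule B.Comp_extend [OF g]) (use 2 in auto)
    finally show ?case using 2 by (simp add: B.Comp_assoc)
  qed (auto simp: B.Comp_assoc)
qed

definition cofree :: "('o, 'm) comonad \<Rightarrow> 'o \<Rightarrow> 'o \<times> 'm" where
  "cofree Q x = (FOb (endo Q) x, comult Q x)"

lemma fst_cofree [simp]: "fst (cofree Q x) = FOb (endo Q) x"
  and snd_cofree [simp]: "snd (cofree Q x) = comult Q x"
  by (simp_all add: cofree_def)

lemma cofree_in_coalgebras [simp]:
  assumes "comonad Q" "x \<in> Obj (base Q)" shows "cofree Q x \<in> coalgebras Q"
proof -
  interpret Q: comonad Q by fact
  show ?thesis
    using assms by (auto simp: coalgebras_iff Q.coassociative Q.counit_left)
qed

lemma cofree_map:
  assumes "comonad Q" "f \<in> Arr (base Q)"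
  shows "Arrow (cofree Q (Dom (base Q) f)) (cofree Q (Cod (base Q) f)) (FAr (endo Q) f) \<in> Arr (Cog
      Q)"
proof -
  interpret Q: comonad Q by fact
  show ?thesis
    using assms Q.comult.naturality [OF assms(2)] by simp
qed

text \<open>This is the unit of the adjunction between the forgetful functor and the cofree coalgebras.
  It is the source of the reconstruction of structure maps later on.\<close>

lemma coaction_map:
  assumes "comonad Q" "X \<in> coalgebras Q"
  shows "Arrow X (cofree Q (fst X)) (snd X) \<in> Arr (Cog Q)"
  using assms by (simp add: coalgebra_laws)

lemma fst_lift_obj [simp]: "fst (lift_obj R f X) = FOb (fst f) (fst X)"
  and snd_lift_obj [simp]: "snd (lift_obj R f X) = snd f (fst X) \<cdot>\<^bsub>base R\<^esub> FAr (fst f) (snd X)"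
  by (simp_all add: lift_obj_def case_prod_unfold)

text \<open>Coassociativity of the lifted coaction combines compatibility of \<open>f\<close> with the
  comultiplications, coassociativity of the given coaction, and naturality of the structure map at
  that coaction.\<close>

lemma lift_obj_in_coalgebras [simp]:
  assumes f: "oplax Q R f" and X: "X \<in> coalgebras Q"
  shows "lift_obj R f X \<in> coalgebras R"
proof -
  interpret BR: category "base R" by (rule comonad_category [OF oplax_comonads(2) [OF f]])
  interpret f: oplax_comonad_functor Q R "fst f" "snd f" by fact
  obtain V k where X': "X = (V, k)" by (cases X)
  have [simp]: "V \<in> Obj (base Q)" "k \<in> Arr (base Q)" "Dom (base Q) k = V"
      "Cod (base Q) k = FOb (endo Q) V"
    and w: "comult Q V \<cdot>\<^bsub>base Q\<^esub> k = FAr (endo Q) k \<cdot>\<^bsub>base Q\<^esub> k"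
    and n: "counit Q V \<cdot>\<^bsub>base Q\<^esub> k = Idn (base Q) V"
    using coalgebrasD [OF X] coalgebra_laws [OF X] by (simp_all add: X')
  let ?A = "snd f V" and ?k = "FAr (fst f) k" and ?AQ = "snd f (FOb (endo Q) V)"
  have nat: "?AQ \<cdot>\<^bsub>base R\<^esub> FAr (fst f) (FAr (endo Q) k) = FAr (endo R) ?k \<cdot>\<^bsub>base R\<^esub> ?A"
    using f.structure_map.naturality [of k] by simp
  have "comult R (FOb (fst f) V) \<cdot>\<^bsub>base R\<^esub> (?A \<cdot>\<^bsub>base R\<^esub> ?k) =
      (FAr (endo R) ?A \<cdot>\<^bsub>base R\<^esub> (?AQ \<cdot>\<^bsub>base R\<^esub> FAr (fst f) (comult Q V))) \<cdot>\<^bsub>base R\<^esub> ?k"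
    by (rule BR.Comp_extend [OF oplax_comult [OF f]]) auto
  also have "\<dots> = FAr (endo R) ?A \<cdot>\<^bsub>base R\<^esub> (?AQ \<cdot>\<^bsub>base R\<^esub> FAr (fst f) (comult Q V \<cdot>\<^bsub>base Q\<^esub> k))"
    by (simp add: BR.Comp_assoc)
  also have "\<dots> = FAr (endo R) ?A \<cdot>\<^bsub>base R\<^esub> (?AQ \<cdot>\<^bsub>base R\<^esub> (FAr (fst f) (FAr (endo Q) k) \<cdot>\<^bsub>base R\<^esub> ?k))"
    by (simp add: w)
  also have "?AQ \<cdot>\<^bsub>base R\<^esub> (FAr (fst f) (FAr (endo Q) k) \<cdot>\<^bsub>base R\<^esub> ?k) =
      (FAr (endo R) ?k \<cdot>\<^bsub>base R\<^esub> ?A) \<cdot>\<^bsub>base R\<^esub> ?k"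
    by (rule BR.Comp_extend [OF nat]) auto
  finally have 1: "comult R (FOb (fst f) V) \<cdot>\<^bsub>base R\<^esub> (?A \<cdot>\<^bsub>base R\<^esub> ?k) =
      FAr (endo R) (?A \<cdot>\<^bsub>base R\<^esub> ?k) \<cdot>\<^bsub>base R\<^esub> (?A \<cdot>\<^bsub>base R\<^esub> ?k)"
    by (simp add: BR.Comp_assoc)
  have "counit R (FOb (fst f) V) \<cdot>\<^bsub>base R\<^esub> (?A \<cdot>\<^bsub>base R\<^esub> ?k) = FAr (fst f) (counit Q V) \<cdot>\<^bsub>base R\<^esub> ?k"
    by (rule BR.Comp_extend [OF f.counit_compatible]) auto
  also have "\<dots> = FAr (fst f) (counit Q V \<cdot>\<^bsub>base Q\<^esub> k)" by simp
  finally have 2: "counit R (FOb (fst f) V) \<cdot>\<^bsub>base R\<^esub> (?A \<cdot>\<^bsub>base R\<^esub> ?k) = Idn (base R) (FOb (fst f) V)"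
    by (simp add: n)
  show ?thesis
    by (rule coalgebras_iff [THEN iffD2]) (use 1 2 in \<open>simp add: X'\<close>)
qed

lemma lift_arrow_in_Cog:
  assumes f: "oplax Q R f" and a: "a \<in> Arr (Cog Q)"
  shows "Arrow (lift_obj R f (src a)) (lift_obj R f (tgt a)) (FAr (fst f) (under a)) \<in> Arr (Cog R)"
proof -
  interpret BR: category "base R" by (rule comonad_category [OF oplax_comonads(2) [OF f]])
  interpret f: oplax_comonad_functor Q R "fst f" "snd f" by fact
  note [simp] = Arr_CogD [OF a]
  let ?V = "fst (src a)" and ?W = "fst (tgt a)"
  have nat: "FAr (endo R) (FAr (fst f) (under a)) \<cdot>\<^bsub>base R\<^esub> snd f ?V =
      snd f ?W \<cdot>\<^bsub>base R\<^esub> FAr (fst f) (FAr (endo Q) (under a))"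
    using f.structure_map.naturality [of "under a"] by simp
  have "FAr (endo R) (FAr (fst f) (under a)) \<cdot>\<^bsub>base R\<^esub> (snd f ?V \<cdot>\<^bsub>base R\<^esub> FAr (fst f) (snd (src a))) =
      (snd f ?W \<cdot>\<^bsub>base R\<^esub> FAr (fst f) (FAr (endo Q) (under a))) \<cdot>\<^bsub>base R\<^esub> FAr (fst f) (snd (src a))"
    by (rule BR.Comp_extend [OF nat]) auto
  also have "\<dots> = snd f ?W \<cdot>\<^bsub>base R\<^esub> FAr (fst f) (FAr (endo Q) (under a) \<cdot>\<^bsub>base Q\<^esub> snd (src a))"
    by (simp add: BR.Comp_assoc)
  also have "\<dots> = snd f ?W \<cdot>\<^bsub>base R\<^esub> FAr (fst f) (snd (tgt a) \<cdot>\<^bsub>base Q\<^esub> under a)"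
    by (simp add: Arr_Cog_commutes [OF a])
  finally show ?thesis
    by (simp add: lift_obj_in_coalgebras [OF f] BR.Comp_assoc)
qed

lemma is_functor_lift_functor:
  assumes f: "oplax Q R f" shows "is_functor (Cog Q) (Cog R) (lift_functor Q R f)"
proof -
  interpret F: is_functor "base Q" "base R" "fst f" by (rule oplax_functor [OF f])
  interpret CQ: category "Cog Q" by (rule category_Cog [OF oplax_comonads(1) [OF f]])
  interpret CR: category "Cog R" by (rule category_Cog [OF oplax_comonads(2) [OF f]])
  note in_Cog = lift_arrow_in_Cog [OF f] lift_obj_in_coalgebras [OF f]
  show ?thesis
  proof (rule is_functorI)
    fix a b assume ab: "a \<in> Arr (Cog Q)" "b \<in> Arr (Cog Q)" "Dom (Cog Q) b = Cod (Cog Q) a"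
    then show "FAr (lift_functor Q R f) (b \<cdot>\<^bsub>Cog Q\<^esub> a) =
        FAr (lift_functor Q R f) b \<cdot>\<^bsub>Cog R\<^esub> FAr (lift_functor Q R f) a"
      using CQ.Comp_in [OF ab] in_Cog(1) [OF ab(1)] in_Cog(1) [OF ab(2)] by
          (simp add: lift_functor_def del: Arrow_in_Cog)
  next
    fix X assume X: "X \<in> Obj (Cog Q)"
    then show "FAr (lift_functor Q R f) (Idn (Cog Q) X) = Idn (Cog R) (FOb (lift_functor Q R f) X)"
      using CQ.Idn_Arr [OF X] in_Cog(2) [of X] by (simp add: lift_functor_def del: Arrow_in_Cog)
  qed (use in_Cog CQ.category_axioms CR.category_axioms in \<open>auto simp: lift_functor_def simp del:
      Arrow_in_Cog\<close>)
qed

lemma is_functor_forgetful: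
  assumes "comonad Q" shows "is_functor (Cog Q) (base Q) (forgetful Q)"
proof -
  interpret CQ: category "Cog Q" by (rule category_Cog [OF assms])
  show ?thesis
  proof (rule is_functorI)
    fix a b assume ab: "a \<in> Arr (Cog Q)" "b \<in> Arr (Cog Q)" "Dom (Cog Q) b = Cod (Cog Q) a"
    then show "FAr (forgetful Q) (b \<cdot>\<^bsub>Cog Q\<^esub> a) = FAr (forgetful Q) b \<cdot>\<^bsub>base Q\<^esub> FAr (forgetful Q) a"
      using CQ.Comp_in [OF ab] by (simp add: forgetful_def del: Arrow_in_Cog)
  next
    fix X assume X: "X \<in> Obj (Cog Q)"
    then show "FAr (forgetful Q) (Idn (Cog Q) X) = Idn (base Q) (FOb (forgetful Q) X)"
      using CQ.Idn_Arr [OF X] by (simp add: forgetful_def case_prod_unfold del: Arrow_in_Cog)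
  qed (use CQ.category_axioms comonad_category [OF assms] in \<open>auto simp: forgetful_def
      case_prod_unfold\<close>)
qed

lemma forgetful_simps [simp]:
  "X \<in> coalgebras Q \<Longrightarrow> FOb (forgetful Q) X = fst X"
  "a \<in> Arr (Cog Q) \<Longrightarrow> FAr (forgetful Q) a = under a"
  by (simp_all add: forgetful_def case_prod_unfold)

section \<open>Coalgebras inside the universe\<close>

context universe
begin

abbreviation enc where "enc \<equiv> encode_arrow pr"

lemma enc_eq [simp]: "enc a = enc b \<longleftrightarrow> a = b"
  by (cases a; cases b) (auto simp: encode_arrow_def)

lemma encoded_category_Cog: "comonad Q \<Longrightarrow> encoded_category (Cog Q) pr enc"
  by (simp add: encoded_category_def encoded_category_axioms_def inj_on_def category_Cog)

lemma Obj_CogU [simp]: "comonad Q \<Longrightarrow> Obj (CogU pr Q) = pr ` coalgebras Q"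
  using encoded_category.Obj_encode [OF encoded_category_Cog] by (simp add: CogU_def)

lemma Arr_CogU [simp]: "comonad Q \<Longrightarrow> Arr (CogU pr Q) = enc ` Arr (Cog Q)"
  using encoded_category.Arr_encode [OF encoded_category_Cog] by (simp add: CogU_def)

lemma CogU_simps [simp]:
  assumes "comonad Q"
  shows "a \<in> Arr (Cog Q) \<Longrightarrow> Dom (CogU pr Q) (enc a) = pr (src a)"
    "a \<in> Arr (Cog Q) \<Longrightarrow> Cod (CogU pr Q) (enc a) = pr (tgt a)"
    "X \<in> coalgebras Q \<Longrightarrow> Idn (CogU pr Q) (pr X) = enc (Arrow X X (Idn (base Q) (fst X)))"
    "\<lbrakk>a \<in> Arr (Cog Q); b \<in> Arr (Cog Q); src b = tgt a\<rbrakk> \<Longrightarrow>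
      enc b \<cdot>\<^bsub>CogU pr Q\<^esub> enc a = enc (Arrow (src a) (tgt b) (under b \<cdot>\<^bsub>base Q\<^esub> under a))"
  using encoded_category.encode_simps [OF encoded_category_Cog [OF assms]] by
      (simp_all add: CogU_def)

lemma category_CogU: "comonad Q \<Longrightarrow> category (CogU pr Q)"
  using encoded_category.category_encode [OF encoded_category_Cog] by (simp add: CogU_def)

lemma is_functor_decode_CogU:
  "comonad Q \<Longrightarrow> is_functor (CogU pr Q) (Cog Q) (decode_functor pr enc (Cog Q))"
  using encoded_category.is_functor_decode [OF encoded_category_Cog] by (simp add: CogU_def)

lemma is_functor_forgetfulU:
  assumes "comonad Q" shows "is_functor (CogU pr Q) (base Q) (forgetfulU pr Q)"
  unfolding forgetfulU_def
  by (rule is_functor_fcompose [OF is_functor_decode_CogU is_functor_forgetful]) (rule assms)+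

lemma forgetfulU_simps [simp]:
  assumes "comonad Q"
  shows "X \<in> coalgebras Q \<Longrightarrow> FOb (forgetfulU pr Q) (pr X) = fst X"
    "a \<in> Arr (Cog Q) \<Longrightarrow> FAr (forgetfulU pr Q) (enc a) = under a"
proof -
  interpret encoded_category "Cog Q" pr enc by (rule encoded_category_Cog [OF assms])
  show "X \<in> coalgebras Q \<Longrightarrow> FOb (forgetfulU pr Q) (pr X) = fst X"
    "a \<in> Arr (Cog Q) \<Longrightarrow> FAr (forgetfulU pr Q) (enc a) = under a"
    by (simp_all add: forgetfulU_def assms)
qed

text \<open>This is faithfulness of the forgetful functor.\<close>

lemma CogU_Arr_eqI:
  assumes "comonad Q" "a \<in> Arr (CogU pr Q)" "b \<in> Arr (CogU pr Q)"
    "Dom (CogU pr Q) a = Dom (CogU pr Q) b" "Cod (CogU pr Q) a = Cod (CogU pr Q) b"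
    "FAr (forgetfulU pr Q) a = FAr (forgetfulU pr Q) b"
  shows "a = b"
  using assms by (auto intro: arrow.expand)

lemma functor_to_CogU_eqI:
  assumes Q: "comonad Q" and S: "is_functor Z (CogU pr Q) S" and T: "is_functor Z (CogU pr Q) T"
    and "\<And>x. x \<in> Obj Z \<Longrightarrow> FOb S x = FOb T x"
    and "\<And>a. a \<in> Arr Z \<Longrightarrow> FAr (forgetfulU pr Q) (FAr S a) = FAr (forgetfulU pr Q) (FAr T a)"
  shows "S = T"
proof (rule functor_eqI [OF S T assms(4)])
  interpret S: is_functor Z "CogU pr Q" S by fact
  interpret T: is_functor Z "CogU pr Q" T by fact
  fix a assume a: "a \<in> Arr Z"
  show "FAr S a = FAr T a"
    by (rule CogU_Arr_eqI [OF Q S.FAr_Arr [OF a] T.FAr_Arr [OF a]])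
      (simp_all add: a assms(4,5) del: Arr_CogU)
qed

lemma is_functor_lift_functorU:
  assumes f: "oplax Q R f" shows "is_functor (CogU pr Q) (CogU pr R) (lift_functorU pr Q R f)"
proof -
  have co: "comonad Q" "comonad R" using oplax_comonads [OF f] .
  have e: "is_functor (Cog R) (CogU pr R) (encode_functor pr enc (Cog R))"
    using encoded_category.is_functor_encode [OF encoded_category_Cog [OF co(2)]] by
        (simp add: CogU_def)
  show ?thesis
    unfolding lift_functorU_def
    by (rule is_functor_fcompose [OF is_functor_fcompose [OF is_functor_decode_CogU [OF co(1)]
            is_functor_lift_functor [OF f]] e])
qed

lemma lift_functorU_simps [simp]:
  assumes f: "oplax Q R f"
  shows "X \<in> coalgebras Q \<Longrightarrow> FOb (lift_functorU pr Q R f) (pr X) = pr (lift_obj R f X)"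
    "a \<in> Arr (Cog Q) \<Longrightarrow> FAr (lift_functorU pr Q R f) (enc a) =
      enc (Arrow (lift_obj R f (src a)) (lift_obj R f (tgt a)) (FAr (fst f) (under a)))"
proof -
  have co: "comonad Q" "comonad R" using oplax_comonads [OF f] .
  interpret Q: encoded_category "Cog Q" pr enc by (rule encoded_category_Cog [OF co(1)])
  interpret R: encoded_category "Cog R" pr enc by (rule encoded_category_Cog [OF co(2)])
  show "X \<in> coalgebras Q \<Longrightarrow> FOb (lift_functorU pr Q R f) (pr X) = pr (lift_obj R f X)"
    using lift_obj_in_coalgebras [OF f] by (simp add: lift_functorU_def lift_functor_def co)
  show "a \<in> Arr (Cog Q) \<Longrightarrow> FAr (lift_functorU pr Q R f) (enc a) =
      enc (Arrow (lift_obj R f (src a)) (lift_obj R f (tgt a)) (FAr (fst f) (under a)))"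
    using lift_arrow_in_Cog [OF f] by
        (simp add: lift_functorU_def lift_functor_def co del: Arrow_in_Cog)
qed

lemma lift_2cellU_simp [simp]:
  assumes "comonad Q" "X \<in> coalgebras Q"
  shows "lift_2cellU pr Q R a (pr X) =
    enc (Arrow (lift_obj R (src a) X) (lift_obj R (tgt a) X) (under a (fst X)))"
proof -
  interpret encoded_category "Cog Q" pr enc by (rule encoded_category_Cog [OF assms(1)])
  have "inv_into (coalgebras Q) pr (pr X) = X" using inv_into_f_f [OF inj_e] assms(2) by simp
  then show ?thesis using assms by (simp add: lift_2cellU_def lift_2cell_def)
qed

section \<open>The 2-functor from comonads to functors\<close>

abbreviation \<Phi> where "\<Phi> \<equiv> forgetful_2functor pr"

lemma on_obj_simps [simp]:
  "fsrc (on_obj \<Phi> Q) = CogU pr Q" "ftgt (on_obj \<Phi> Q) = base Q" "ffun (on_obj \<Phi> Q) = forgetfulU pr Q"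
  by (simp_all add: forgetful_2functor_def)

lemma on_hom_simps [simp]:
  "oplax Q R f \<Longrightarrow> FOb (on_hom \<Phi> Q R) f = (lift_functorU pr Q R f, fst f)"
  "a \<in> Arr (comonad_hom Q R) \<Longrightarrow> FAr (on_hom \<Phi> Q R) a =
    Arrow (lift_functorU pr Q R (src a), fst (src a)) (lift_functorU pr Q R (tgt a), fst (tgt a))
      (lift_2cellU pr Q R a, under a)"
  by (simp_all add: forgetful_2functor_def)

lemma functor_obj_image: "comonad Q \<Longrightarrow> functor_obj (on_obj \<Phi> Q)"
  by (simp add: functor_obj_def is_functor_forgetfulU)

lemma on_obj_in_Functors:
  assumes "Q \<in> Ob2 (Comonads small)" shows "on_obj \<Phi> Q \<in> Ob2 (Functors small)"
proof -
  have co: "comonad Q" and sm: "small (Obj (base Q))" "small (Arr (base Q))"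
    using assms by (auto simp: small_category_def)
  have "coalgebras Q \<subseteq> Obj (base Q) \<times> Arr (base Q)" by (auto simp: coalgebras_def)
  then have so: "small (pr ` coalgebras Q)"
    by (intro small_subset [OF small_Times [OF sm]] image_mono)
  have "enc ` Arr (Cog Q) \<subseteq> pr ` (pr ` (pr ` coalgebras Q \<times> pr ` coalgebras Q) \<times> Arr (base Q))"
    by (intro image_subsetI) (simp only: encode_arrow_def, intro imageI SigmaI; simp)
  then have "small (enc ` Arr (Cog Q))"
    using small_Times [OF small_Times [OF so so] sm(2)] small_subset by blast
  then show ?thesis
    using assms so co by (simp add: small_category_def category_CogU functor_obj_image)
qed

lemma commuting_square_lift:
  assumes f: "oplax Q R f"
  shows "commuting_square (on_obj \<Phi> Q) (on_obj \<Phi> R) (lift_functorU pr Q R f, fst f)"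
proof -
  have co: "comonad Q" "comonad R" using oplax_comonads [OF f] .
  have "fcompose (CogU pr Q) (forgetfulU pr R) (lift_functorU pr Q R f) =
      fcompose (CogU pr Q) (fst f) (forgetfulU pr Q)"
    by (rule functor_eqI [OF is_functor_fcompose [OF is_functor_lift_functorU [OF f]
      is_functor_forgetfulU [OF co(2)]]
          is_functor_fcompose [OF is_functor_forgetfulU [OF co(1)] oplax_functor [OF f]]])
      (auto simp: co f lift_obj_in_coalgebras [OF f] lift_arrow_in_Cog [OF f] simp del:
        Arrow_in_Cog)
  then show ?thesis
    by (simp add: commuting_square_def is_functor_lift_functorU [OF f] oplax_functor [OF f])
qed

text \<open>The lower component determines the morphism underlying each upper component, and faithfulness does
  the rest. This reduces all equations between images of 2-cells to the underlying categories.\<close>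

lemma square_2cells_eqI:
  assumes R: "comonad R" and X: "functor_obj X"
    and t: "t \<in> square_2cells X (on_obj \<Phi> R) f g" and u: "u \<in> square_2cells X (on_obj \<Phi> R) f g"
    and eq: "snd t = snd u"
  shows "t = u"
proof -
  interpret t: nat_trans "fsrc X" "CogU pr R" "fst f" "fst g" "fst t" using t by
      (simp add: square_2cells_iff)
  interpret u: nat_trans "fsrc X" "CogU pr R" "fst f" "fst g" "fst u" using u by
      (simp add: square_2cells_iff)
  have "fst t = fst u"
  proof (rule nat_trans_eqI [OF t.nat_trans_axioms u.nat_trans_axioms])
    fix x assume x: "x \<in> Obj (fsrc X)"
    show "fst t x = fst u x"
      by (rule CogU_Arr_eqI [OF R t.component_Arr [OF x] u.component_Arr [OF x]])
        (use x t u eq in \<open>simp_all add: square_2cells_iff del: Arr_CogU\<close>)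
  qed
  with eq show ?thesis by (simp add: prod_eq_iff)
qed

text \<open>The condition on a 2-cell of comonads, together with its naturality at the coaction, says
  that its component at the carrier is a morphism of coalgebras. Naturality on coalgebras is then
  naturality of the underlying morphisms.\<close>

lemma lift_2cell_in_square_2cells:
  assumes f: "oplax Q R f" and g: "oplax Q R g" and t: "t \<in> comonad_2cells Q R f g"
  shows "(lift_2cellU pr Q R (Arrow f g t), t) \<in>
    square_2cells (on_obj \<Phi> Q) (on_obj \<Phi> R) (lift_functorU pr Q R f, fst f) (lift_functorU pr Q R
        g, fst g)"
proof -
  have co: "comonad Q" "comonad R" using oplax_comonads [OF f] .
  interpret BR: category "base R" by (rule comonad_category [OF co(2)])
  interpret f: oplax_comonad_functor Q R "fst f" "snd f" by fact
  interpret g: oplax_comonad_functor Q R "fst g" "snd g" by fact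
  interpret t: nat_trans "base Q" "base R" "fst f" "fst g" t using t by
      (simp add: comonad_2cells_iff)
  have inC: "Arrow (lift_obj R f X) (lift_obj R g X) (t (fst X)) \<in> Arr (Cog R)" if X:
      "X \<in> coalgebras Q" for X
  proof -
    note [simp] = coalgebrasD [OF X]
    let ?k = "snd X" and ?V = "fst X"
    have c: "FAr (endo R) (t ?V) \<cdot>\<^bsub>base R\<^esub> snd f ?V = snd g ?V \<cdot>\<^bsub>base R\<^esub> t (FOb (endo Q) ?V)"
      using t by (simp add: comonad_2cells_iff)
    have "FAr (endo R) (t ?V) \<cdot>\<^bsub>base R\<^esub> (snd f ?V \<cdot>\<^bsub>base R\<^esub> FAr (fst f) ?k) =
        (snd g ?V \<cdot>\<^bsub>base R\<^esub> t (FOb (endo Q) ?V)) \<cdot>\<^bsub>base R\<^esub> FAr (fst f) ?k"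
      by (rule BR.Comp_extend [OF c]) auto
    also have "\<dots> = snd g ?V \<cdot>\<^bsub>base R\<^esub> (t (FOb (endo Q) ?V) \<cdot>\<^bsub>base R\<^esub> FAr (fst f) ?k)"
      by (simp add: BR.Comp_assoc)
    also have "t (FOb (endo Q) ?V) \<cdot>\<^bsub>base R\<^esub> FAr (fst f) ?k = FAr (fst g) ?k \<cdot>\<^bsub>base R\<^esub> t ?V"
      using t.naturality [of ?k] by simp
    finally show ?thesis
      using X by (simp add: lift_obj_in_coalgebras [OF f] lift_obj_in_coalgebras [OF g]
          BR.Comp_assoc)
  qed
  interpret L: is_functor "CogU pr Q" "CogU pr R" "lift_functorU pr Q R f"
      by (rule is_functor_lift_functorU [OF f])
  interpret M: is_functor "CogU pr Q" "CogU pr R" "lift_functorU pr Q R g"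
      by (rule is_functor_lift_functorU [OF g])
  have "nat_trans (CogU pr Q) (CogU pr R) (lift_functorU pr Q R f) (lift_functorU pr Q R g)
     (lift_2cellU pr Q R (Arrow f g t))"
  proof (rule nat_transI [OF L.is_functor_axioms M.is_functor_axioms])
    fix h assume "h \<in> Arr (CogU pr Q)"
    then obtain a where a: "h = enc a" "a \<in> Arr (Cog Q)" using co by auto
    show "lift_2cellU pr Q R (Arrow f g t) (Cod (CogU pr Q) h) \<cdot>\<^bsub>CogU pr R\<^esub>
        FAr (lift_functorU pr Q R f) h =
      FAr (lift_functorU pr Q R g) h \<cdot>\<^bsub>CogU pr R\<^esub>
          lift_2cellU pr Q R (Arrow f g t) (Dom (CogU pr Q) h)"
      using a t.naturality [of
          "under a"] inC lift_arrow_in_Cog [OF f a(2)] lift_arrow_in_Cog [OF g a(2)]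
      by (simp add: co f g del: Arrow_in_Cog)
  qed (use inC in \<open>auto simp: co f g simp del: Arrow_in_Cog\<close>, auto simp: lift_2cellU_def co)
  then show ?thesis
    using t inC by (auto simp: square_2cells_iff comonad_2cells_iff co simp del: Arrow_in_Cog)
qed

lemma is_functor_on_hom:
  assumes co: "comonad Q" "comonad R"
  shows "is_functor (comonad_hom Q R) (functors_hom (on_obj \<Phi> Q) (on_obj \<Phi> R)) (on_hom \<Phi> Q R)"
proof -
  let ?X = "on_obj \<Phi> Q" and ?Y = "on_obj \<Phi> R"
  interpret C: category "comonad_hom Q R" by (rule category_comonad_hom)
  interpret D: category "functors_hom ?X ?Y"
      by (rule category_functors_hom [OF functor_obj_image functor_obj_image]) fact+
  have arr: "FAr (on_hom \<Phi> Q R) a \<in> Arr (functors_hom ?X ?Y)" if "a \<in> Arr (comonad_hom Q R)" for a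
    using that by (cases a) (simp add: commuting_square_lift lift_2cell_in_square_2cells)
  have arr_eqI: "c = d" if "c \<in> Arr (functors_hom ?X ?Y)" "d \<in> Arr (functors_hom ?X ?Y)"
    "src c = src d" "tgt c = tgt d" "snd (under c) = snd (under d)" for c d
    using that square_2cells_eqI [OF co(2) functor_obj_image [OF co(1)]] by (cases c; cases d) auto
  have dom: "Dom (functors_hom ?X ?Y) c = src c" "Cod (functors_hom ?X ?Y) c = tgt c"
    if "c \<in> Arr (functors_hom ?X ?Y)" for c
    using that by (simp_all add: functors_hom_eq)
  have dom': "Dom (comonad_hom Q R) c = src c" "Cod (comonad_hom Q R) c = tgt c"
    if "c \<in> Arr (comonad_hom Q R)" for c
    using that by (simp_all add: comonad_hom_eq)
  have ob: "oplax Q R (src a)" "oplax Q R (tgt a)" if "a \<in> Arr (comonad_hom Q R)" for a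
    using that by (cases a; simp)+
  show ?thesis
  proof (rule is_functorI [OF C.category_axioms D.category_axioms _ _ _ arr])
    fix f assume f: "f \<in> Obj (comonad_hom Q R)"
    then show "FOb (on_hom \<Phi> Q R) f \<in> Obj (functors_hom ?X ?Y)" by (simp add: commuting_square_lift)
    have 1: "FAr (on_hom \<Phi> Q R) (Idn (comonad_hom Q R) f) \<in> Arr (functors_hom ?X ?Y)"
      by (rule arr [OF C.Idn_Arr [OF f]])
    have 2: "Idn (functors_hom ?X ?Y) (FOb (on_hom \<Phi> Q R) f) \<in> Arr (functors_hom ?X ?Y)"
      using f by (intro D.Idn_Arr) (simp add: commuting_square_lift)
    show "FAr (on_hom \<Phi> Q R) (Idn (comonad_hom Q R) f) =
        Idn (functors_hom ?X ?Y) (FOb (on_hom \<Phi> Q R) f)"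
      by (rule arr_eqI [OF 1 2])
        (use f C.Idn_Arr [OF f] in \<open>simp_all add: commuting_square_lift comonad_2cells_identity\<close>)
  next
    fix a b assume ab: "a \<in> Arr (comonad_hom Q R)" "b \<in> Arr (comonad_hom Q R)"
      "Dom (comonad_hom Q R) b = Cod (comonad_hom Q R) a"
    let ?L = "FAr (on_hom \<Phi> Q R)"
    have c: "b \<cdot>\<^bsub>comonad_hom Q R\<^esub> a \<in> Arr (comonad_hom Q R)" by (rule C.Comp_in [OF ab])
    have st: "src b = tgt a" using ab by (simp add: dom')
    have ce: "b \<cdot>\<^bsub>comonad_hom Q R\<^esub> a =
        Arrow (src a) (tgt b) (nt_vcomp (base Q) (base R) (under b) (under a))"
      using ab st by (simp add: comonad_hom_eq)
    have m: "Dom (functors_hom ?X ?Y) (?L b) = Cod (functors_hom ?X ?Y) (?L a)"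
      using ab st dom [OF arr [OF ab(1)]] dom [OF arr [OF ab(2)]] by simp
    then have m': "src (?L b) = tgt (?L a)"
      by (simp only: dom [OF arr [OF ab(1)]] dom [OF arr [OF ab(2)]])
    have de: "?L b \<cdot>\<^bsub>functors_hom ?X ?Y\<^esub> ?L a = Arrow (src (?L a)) (tgt (?L b))
       (nt_vcomp (CogU pr Q) (CogU pr R) (fst (under (?L b))) (fst (under (?L a))),
        nt_vcomp (base Q) (base R) (snd (under (?L b))) (snd (under (?L a))))"
      using arr [OF ab(1)] arr [OF ab(2)] m' unfolding functors_hom_eq by simp
    show "?L (b \<cdot>\<^bsub>comonad_hom Q R\<^esub> a) = ?L b \<cdot>\<^bsub>functors_hom ?X ?Y\<^esub> ?L a"
    proof (rule arr_eqI [OF arr [OF c] D.Comp_in [OF arr [OF ab(1)] arr [OF ab(2)] m]])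
    qed (simp_all only: de on_hom_simps(2) [OF c], simp_all only: on_hom_simps(2) [OF ab(1)]
        on_hom_simps(2) [OF ab(2)] ce arrow.sel fst_conv snd_conv)
  next
    fix a assume a: "a \<in> Arr (comonad_hom Q R)"
    show "Dom (functors_hom ?X ?Y) (FAr (on_hom \<Phi> Q R) a) =
        FOb (on_hom \<Phi> Q R) (Dom (comonad_hom Q R) a)"
      "Cod (functors_hom ?X ?Y) (FAr (on_hom \<Phi> Q R) a) =
          FOb (on_hom \<Phi> Q R) (Cod (comonad_hom Q R) a)"
      using dom [OF arr [OF a]] a ob by (simp_all add: dom')
  qed (simp_all add: forgetful_2functor_def)
qed

lemma lift_functorU_identity:
  assumes co: "comonad Q"
  shows "lift_functorU pr Q Q (fidentity (base Q), nt_identity (base Q) (base Q) (endo Q)) =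
      fidentity (CogU pr Q)"
    (is "lift_functorU pr Q Q ?i = _")
proof -
  have i: "oplax Q Q ?i" by (rule oplax_identity [OF co])
  interpret B: category "base Q" by (rule comonad_category [OF co])
  have l: "lift_obj Q ?i X = X" if "X \<in> coalgebras Q" for X
    using that coalgebrasD [OF that] by (simp add: prod_eq_iff)
  show ?thesis
    by (rule functor_eqI [OF is_functor_lift_functorU [OF i]
      is_functor_fidentity [OF category_CogU [OF co]]])
      (auto simp: co lift_functorU_simps [OF i] l intro: arrow.expand)
qed

lemma lift_functorU_comp:
  assumes f: "oplax Q R f" and g: "oplax R S g"
  shows "lift_functorU pr Q S (comonad_comp1 Q S g f) =
    fcompose (CogU pr Q) (lift_functorU pr R S g) (lift_functorU pr Q R f)"
proof -
  have co: "comonad Q" "comonad R" "comonad S" using oplax_comonads f g by blast+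
  have gf: "oplax Q S (comonad_comp1 Q S g f)" by (rule oplax_comp [OF f g])
  interpret BS: category "base S" by (rule comonad_category [OF co(3)])
  interpret f: oplax_comonad_functor Q R "fst f" "snd f" by fact
  interpret g: oplax_comonad_functor R S "fst g" "snd g" by fact
  have l: "lift_obj S (comonad_comp1 Q S g f) X = lift_obj S g (lift_obj R f X)" if
      "X \<in> coalgebras Q" for X
    using that coalgebrasD [OF that] by (simp add: prod_eq_iff BS.Comp_assoc)
  show ?thesis
    by (rule functor_eqI [OF is_functor_lift_functorU [OF gf]
          is_functor_fcompose [OF is_functor_lift_functorU [OF f] is_functor_lift_functorU [OF g]]])
      (auto simp: co lift_functorU_simps [OF gf] lift_functorU_simps [OF f]
        lift_functorU_simps [OF g] l
        lift_obj_in_coalgebras [OF f] lift_arrow_in_Cog [OF f] simp del: Arrow_in_Cog)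
qed

lemma is_two_functor_forgetful: "is_two_functor (Comonads small) (Functors small) \<Phi>"
proof (intro is_two_functor.intro is_two_functor_axioms.intro
    strict_2_category_Comonads strict_2_category_Functors)
  fix X :: "('u, 'u) comonad" assume X: "X \<in> Ob2 (Comonads small)"
  show "on_obj \<Phi> X \<in> Ob2 (Functors small)" by (rule on_obj_in_Functors [OF X])
  show "FOb (on_hom \<Phi> X X) (Unit2 (Comonads small) X) = Unit2 (Functors small) (on_obj \<Phi> X)"
    using X by (simp add: lift_functorU_identity oplax_identity [simplified])
next
  fix X Y :: "('u, 'u) comonad" assume "X \<in> Ob2 (Comonads small)" "Y \<in> Ob2 (Comonads small)"
  then show "is_functor (Hom2 (Comonads small) X Y) (Hom2 (Functors small) (on_obj \<Phi> X) (on_obj \<Phi>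
      Y)) (on_hom \<Phi> X Y)"
    by (simp add: is_functor_on_hom)
next
  fix X Y Z :: "('u, 'u) comonad" and f g
  assume "f \<in> Obj (Hom2 (Comonads small) X Y)" "g \<in> Obj (Hom2 (Comonads small) Y Z)"
  then have f: "oplax X Y f" and g: "oplax Y Z g" by auto
  show "FOb (on_hom \<Phi> X Z) (comp1 (Comonads small) X Y Z g f) =
    comp1 (Functors small) (on_obj \<Phi> X) (on_obj \<Phi> Y) (on_obj \<Phi> Z) (FOb (on_hom \<Phi> Y Z) g) (FOb
        (on_hom \<Phi> X Y) f)"
    using f g commuting_square_lift [OF f] commuting_square_lift [OF g] oplax_comp [OF f g]
    by (simp add: square_comp_eq lift_functorU_comp)
next
  fix X Y Z :: "('u, 'u) comonad" and a b
  assume X: "X \<in> Ob2 (Comonads small)" and Y: "Y \<in> Ob2 (Comonads small)" and Z: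
      "Z \<in> Ob2 (Comonads small)"
    and a: "a \<in> Arr (Hom2 (Comonads small) X Y)" and b: "b \<in> Arr (Hom2 (Comonads small) Y Z)"
  obtain f f' t where a': "a = Arrow f f' t" by (cases a)
  obtain g g' u where b': "b = Arrow g g' u" by (cases b)
  have f: "oplax X Y f" "oplax X Y f'" "t \<in> comonad_2cells X Y f f'"
    and g: "oplax Y Z g" "oplax Y Z g'" "u \<in> comonad_2cells Y Z g g'"
    using a b by (simp_all add: a' b')
  have co: "comonad X" "comonad Y" "comonad Z" using X Y Z by auto
  let ?gf = "comonad_comp1 X Z g f" and ?gf' = "comonad_comp1 X Z g' f'"
  let ?h = "nt_hcomp (base X) (base Z) (fst g) (fst f') u t"
  let ?L = "\<lambda>X Y f. (lift_functorU pr X Y f, fst f)"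
  have gf: "oplax X Z ?gf" "oplax X Z ?gf'" using oplax_comp f g by blast+
  have h: "?h \<in> comonad_2cells X Z ?gf ?gf'"
    by (rule comonad_2cells_hcomp) fact+
  have L: "?L X Z ?gf = square_comp (on_obj \<Phi> X) (?L Y Z g) (?L X Y f)"
    "?L X Z ?gf' = square_comp (on_obj \<Phi> X) (?L Y Z g') (?L X Y f')"
    using f g by (simp_all add: square_comp_eq lift_functorU_comp)
  have Fa: "Arrow (?L X Y f) (?L X Y f') (lift_2cellU pr X Y a, t) \<in> Arr (functors_hom (on_obj \<Phi>
      X) (on_obj \<Phi> Y))"
    using f by (simp add: a' commuting_square_lift lift_2cell_in_square_2cells)
  have Fb: "Arrow (?L Y Z g) (?L Y Z g') (lift_2cellU pr Y Z b, u) \<in> Arr (functors_hom (on_obj \<Phi>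
      Y) (on_obj \<Phi> Z))"
    using g by (simp add: b' commuting_square_lift lift_2cell_in_square_2cells)
  have "(lift_2cellU pr X Z (Arrow ?gf ?gf' ?h), ?h) =
    square_hcomp (on_obj \<Phi> X) (on_obj \<Phi> Z) (Arrow (?L Y Z g) (?L Y Z g') (lift_2cellU pr Y Z b, u))
      (Arrow (?L X Y f) (?L X Y f') (lift_2cellU pr X Y a, t))"
  proof (rule square_2cells_eqI [OF co(3) functor_obj_image [OF co(1)]
      lift_2cell_in_square_2cells [OF gf h]])
    show "square_hcomp (on_obj \<Phi> X) (on_obj \<Phi> Z) (Arrow (?L Y Z g) (?L Y Z g') (lift_2cellU pr Y Z
        b, u))
        (Arrow (?L X Y f) (?L X Y f') (lift_2cellU pr X Y a, t))
      \<in> square_2cells (on_obj \<Phi> X) (on_obj \<Phi> Z) (?L X Z ?gf) (?L X Z ?gf')"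
      unfolding L by (rule square_hcomp_in [where Y = "on_obj \<Phi> Y"])
          (use Fa Fb co in \<open>simp_all add: functor_obj_image\<close>)
  qed (simp add: square_hcomp_def)
  moreover have "comp2 (Comonads small) X Y Z b a = Arrow ?gf ?gf' ?h"
    using a b by (simp add: a' b' comonad_hcomp_def)
  moreover have "Arrow ?gf ?gf' ?h \<in> Arr (comonad_hom X Z)" using gf h by simp
  ultimately show "FAr (on_hom \<Phi> X Z) (comp2 (Comonads small) X Y Z b a) =
    comp2 (Functors small) (on_obj \<Phi> X) (on_obj \<Phi> Y) (on_obj \<Phi> Z) (FAr (on_hom \<Phi> Y Z) b) (FAr
        (on_hom \<Phi> X Y) a)"
    using Fa Fb a b L by (simp add: a' b' del: Arrow_in_Arr Arr_functors_hom Arr_comonad_hom)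
qed

section \<open>Full faithfulness\<close>

text \<open>The structure map of an oplax functor is recovered from its action on cofree coalgebras:
  naturality at the counit moves the counit next to the comultiplication, where they cancel.\<close>

lemma structure_map_from_cofree:
  assumes f: "oplax Q R f" and x: "x \<in> Obj (base Q)"
  shows "snd f x = FAr (endo R) (FAr (fst f) (counit Q x)) \<cdot>\<^bsub>base R\<^esub> snd (lift_obj R f (cofree Q x))"
proof -
  interpret BR: category "base R" by (rule comonad_category [OF oplax_comonads(2) [OF f]])
  interpret f: oplax_comonad_functor Q R "fst f" "snd f" by fact
  note [simp] = x
  have nat: "FAr (endo R) (FAr (fst f) (counit Q x)) \<cdot>\<^bsub>base R\<^esub> snd f (FOb (endo Q) x) =
      snd f x \<cdot>\<^bsub>base R\<^esub> FAr (fst f) (FAr (endo Q) (counit Q x))"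
    using f.structure_map.naturality [of "counit Q x"] by simp
  have "FAr (endo R) (FAr (fst f) (counit Q x)) \<cdot>\<^bsub>base R\<^esub> (snd f (FOb (endo Q) x) \<cdot>\<^bsub>base R\<^esub>
      FAr (fst f) (comult Q x)) =
      (snd f x \<cdot>\<^bsub>base R\<^esub> FAr (fst f) (FAr (endo Q) (counit Q x))) \<cdot>\<^bsub>base R\<^esub> FAr (fst f) (comult Q x)"
    by (rule BR.Comp_extend [OF nat]) auto
  also have "\<dots> = snd f x \<cdot>\<^bsub>base R\<^esub> FAr (fst f) (FAr (endo Q) (counit Q x) \<cdot>\<^bsub>base Q\<^esub> comult Q x)"
    by (simp add: BR.Comp_assoc)
  also have "\<dots> = snd f x"
    by (simp add: f.source.counit_right)
  finally show ?thesis by simp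
qed

lemma lift_functorU_inj:
  assumes f: "oplax Q R f" and g: "oplax Q R g" and "fst f = fst g"
    and eq: "lift_functorU pr Q R f = lift_functorU pr Q R g"
  shows "f = g"
proof (rule oplax_eqI [OF f g assms(3)])
  fix x assume x: "x \<in> Obj (base Q)"
  have "cofree Q x \<in> coalgebras Q" using oplax_comonads(1) [OF f] x by simp
  then have "lift_obj R f (cofree Q x) = lift_obj R g (cofree Q x)"
    using lift_functorU_simps(1) [OF f, of "cofree Q x"] lift_functorU_simps(1) [OF g, of
        "cofree Q x"] eq by simp
  then show "snd f x = snd g x"
    using structure_map_from_cofree [OF f x] structure_map_from_cofree [OF g x] assms(3) by metis
qed

text \<open>Fullness on 1-cells. Let \<open>S\<close> lift \<open>T\<close> to coalgebras and let \<open>s X\<close> be the coaction of \<open>S X\<close>.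
  The structure map is forced to be \<open>A x = R T n x \<circ> s (cofree x)\<close>. Everything follows from applying
  \<open>S\<close> to two kinds of coalgebra morphisms: images \<open>Q g\<close> between cofree coalgebras give naturality
  of \<open>A\<close>, and coactions \<open>X \<rightarrow> cofree (fst X)\<close> give \<open>A \<circ> T k = s X\<close> for a coalgebra \<open>X = (V, k)\<close>. The
  latter says that \<open>(T, A)\<close> induces \<open>S\<close>; at cofree coalgebras it turns the comonad laws for \<open>A\<close> into
  the coalgebra laws for \<open>s\<close>.\<close>

lemma lift_functorU_surj:
  assumes co: "comonad Q" "comonad R" and sq: "commuting_square (on_obj \<Phi> Q) (on_obj \<Phi> R) h"
  obtains f where "oplax Q R f" "h = (lift_functorU pr Q R f, fst f)"
proof -
  obtain S T where h: "h = (S, T)" by (cases h)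
  interpret BR: category "base R" by (rule comonad_category [OF co(2)])
  interpret S: is_functor "CogU pr Q" "CogU pr R" S using sq by (simp add: commuting_square_def h)
  interpret T: is_functor "base Q" "base R" T using sq by (simp add: commuting_square_def h)
  interpret Q: comonad Q by fact
  interpret R: comonad R by fact
  define s where "s X = snd (inv pr (FOb S (pr X)))" for X
  have S_obj: "(FOb T (fst X), s X) \<in> coalgebras R" "FOb S (pr X) = pr (FOb T (fst X), s X)"
    if X: "X \<in> coalgebras Q" for X
  proof -
    have "FOb S (pr X) \<in> pr ` coalgebras R" using S.FOb_Obj [of "pr X"] X co by simp
    then obtain Y where Y: "Y \<in> coalgebras R" "FOb S (pr X) = pr Y" by auto
    have "s X = snd Y" using Y by (simp add: s_def inv_f_f [OF inj_pr])
    moreover have "fst Y = FOb T (fst X)"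
      using square_FOb [OF sq, of "pr X"] X Y co by (simp add: h)
    ultimately show "(FOb T (fst X), s X) \<in> coalgebras R" "FOb S (pr X) = pr (FOb T (fst X), s X)"
      using Y by (metis prod.collapse)+
  qed
  have S_arr: "FAr (endo R) (FAr T (under a)) \<cdot>\<^bsub>base R\<^esub> s (src a) = s (tgt a) \<cdot>\<^bsub>base R\<^esub> FAr T (under a)"
    if a: "a \<in> Arr (Cog Q)" for a
  proof -
    have "FAr S (enc a) \<in> enc ` Arr (Cog R)" using S.FAr_Arr [of "enc a"] a co by simp
    then obtain b where b: "b \<in> Arr (Cog R)" "FAr S (enc a) = enc b" by auto
    have "pr (src b) = FOb S (pr (src a))" "pr (tgt b) = FOb S (pr (tgt a))"
      using S.Dom_FAr [of "enc a"] S.Cod_FAr [of "enc a"] a b co by simp_all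
    then have st: "src b = (FOb T (fst (src a)), s (src a))"
        "tgt b = (FOb T (fst (tgt a)), s (tgt a))"
      using S_obj(2) a by simp_all
    have "under b = FAr T (under a)"
      using square_FAr [OF sq, of "enc a"] a b co by (simp add: h)
    with Arr_Cog_commutes [OF b(1)] show ?thesis by (simp add: st)
  qed
  have s_arr [simp]: "s X \<in> Arr (base R)" "Dom (base R) (s X) = FOb T (fst X)"
    "Cod (base R) (s X) = FOb (endo R) (FOb T (fst X))" if "X \<in> coalgebras Q" for X
    using coalgebrasD [OF S_obj(1) [OF that]] by simp_all
  note cofree = cofree_in_coalgebras [OF co(1)]
  define A where "A = (\<lambda>x\<in>Obj (base Q). FAr (endo R) (FAr T (counit Q x)) \<cdot>\<^bsub>base R\<^esub> s (cofree Q x))"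
  have A_in [simp]: "A x \<in> Arr (base R)" "Dom (base R) (A x) = FOb T (FOb (endo Q) x)"
    "Cod (base R) (A x) = FOb (endo R) (FOb T x)" if "x \<in> Obj (base Q)" for x
    using that cofree [OF that] by (simp_all add: A_def)
  \<comment> \<open>The coaction of a coalgebra is a morphism to the cofree coalgebra on its carrier.\<close>
  have A_coaction: "A (fst X) \<cdot>\<^bsub>base R\<^esub> FAr T (snd X) = s X" if X: "X \<in> coalgebras Q" for X
  proof -
    note [simp] = coalgebrasD [OF X] cofree [OF coalgebrasD(1) [OF X]] s_arr [OF X]
    have c: "s (cofree Q (fst X)) \<cdot>\<^bsub>base R\<^esub> FAr T (snd X) = FAr (endo R) (FAr T (snd X)) \<cdot>\<^bsub>base R\<^esub> s X"
      using S_arr [OF coaction_map [OF co(1) X]] by simp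
    have "A (fst X) \<cdot>\<^bsub>base R\<^esub> FAr T (snd X) =
        FAr (endo R) (FAr T (counit Q (fst X))) \<cdot>\<^bsub>base R\<^esub> (s (cofree Q (fst X)) \<cdot>\<^bsub>base R\<^esub>
            FAr T (snd X))"
      by (simp add: A_def BR.Comp_assoc)
    also have "\<dots> = FAr (endo R) (FAr T (counit Q (fst X) \<cdot>\<^bsub>base Q\<^esub> snd X)) \<cdot>\<^bsub>base R\<^esub> s X"
      by (simp add: c BR.Comp_assoc)
    finally show ?thesis by (simp add: coalgebra_laws [OF X])
  qed
  have f: "oplax Q R (T, A)"
  proof (rule oplaxI [OF co])
    show "nat_trans (base Q) (base R) (fcompose (base Q) (fst (T, A)) (endo Q)) (fcompose (base Q)
        (endo R) (fst (T, A))) (snd (T, A))"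
      unfolding fst_conv snd_conv
    proof (rule nat_transI)
      show "is_functor (base Q) (base R) (fcompose (base Q) T (endo Q))"
        "is_functor (base Q) (base R) (fcompose (base Q) (endo R) T)"
        by (rule is_functor_fcompose; unfold_locales)+
      fix g assume g [simp]: "g \<in> Arr (base Q)"
      let ?x = "Dom (base Q) g" and ?y = "Cod (base Q) g"
      note [simp] = cofree [of ?x] cofree [of ?y]
      have m: "s (cofree Q ?y) \<cdot>\<^bsub>base R\<^esub> FAr T (FAr (endo Q) g) =
          FAr (endo R) (FAr T (FAr (endo Q) g)) \<cdot>\<^bsub>base R\<^esub> s (cofree Q ?x)"
        using S_arr [OF cofree_map [OF co(1) g]] by simp
      have "A ?y \<cdot>\<^bsub>base R\<^esub> FAr T (FAr (endo Q) g) =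
          FAr (endo R) (FAr T (counit Q ?y)) \<cdot>\<^bsub>base R\<^esub> (s (cofree Q ?y) \<cdot>\<^bsub>base R\<^esub>
              FAr T (FAr (endo Q) g))"
        by (simp add: A_def BR.Comp_assoc)
      also have "\<dots> = FAr (endo R) (FAr T (counit Q ?y \<cdot>\<^bsub>base Q\<^esub> FAr (endo Q) g)) \<cdot>\<^bsub>base R\<^esub>
          s (cofree Q ?x)"
        by (simp add: m BR.Comp_assoc)
      also have "counit Q ?y \<cdot>\<^bsub>base Q\<^esub> FAr (endo Q) g = g \<cdot>\<^bsub>base Q\<^esub> counit Q ?x"
        using Q.counit.naturality [OF g] by simp
      finally show "A ?y \<cdot>\<^bsub>base R\<^esub> FAr (fcompose (base Q) T (endo Q)) g =
          FAr (fcompose (base Q) (endo R) T) g \<cdot>\<^bsub>base R\<^esub> A ?x"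
        by (simp add: A_def BR.Comp_assoc)
    qed (simp_all, simp add: A_def)
  next
    fix x assume x [simp]: "x \<in> Obj (base Q)"
    note [simp] = cofree [OF x]
    have As: "A (FOb (endo Q) x) \<cdot>\<^bsub>base R\<^esub> FAr T (comult Q x) = s (cofree Q x)"
      using A_coaction [OF cofree [OF x]] by simp
    have laws: "comult R (FOb T (FOb (endo Q) x)) \<cdot>\<^bsub>base R\<^esub> s (cofree Q x) =
        FAr (endo R) (s (cofree Q x)) \<cdot>\<^bsub>base R\<^esub> s (cofree Q x)"
      "counit R (FOb T (FOb (endo Q) x)) \<cdot>\<^bsub>base R\<^esub> s (cofree Q x) =
          Idn (base R) (FOb T (FOb (endo Q) x))"
      using coalgebra_laws [OF S_obj(1), of "cofree Q x"] by simp_all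
    let ?n = "FAr T (counit Q x)"
    have w: "comult R (FOb T x) \<cdot>\<^bsub>base R\<^esub> FAr (endo R) ?n =
        FAr (endo R) (FAr (endo R) ?n) \<cdot>\<^bsub>base R\<^esub> comult R (FOb T (FOb (endo Q) x))"
      using R.comult.naturality [of ?n] by simp
    have "comult R (FOb T x) \<cdot>\<^bsub>base R\<^esub> A x = (FAr (endo R) (FAr (endo R) ?n) \<cdot>\<^bsub>base R\<^esub>
        comult R (FOb T (FOb (endo Q) x))) \<cdot>\<^bsub>base R\<^esub> s (cofree Q x)"
      unfolding A_def restrict_apply' [OF x] by (rule BR.Comp_extend [OF w]) auto
    also have "\<dots> = FAr (endo R) (A x) \<cdot>\<^bsub>base R\<^esub> s (cofree Q x)"
      by (simp add: A_def BR.Comp_assoc laws)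
    finally show "comult R (FOb (fst (T, A)) x) \<cdot>\<^bsub>base R\<^esub> snd (T, A) x =
        FAr (endo R) (snd (T, A) x) \<cdot>\<^bsub>base R\<^esub>
        (snd (T, A) (FOb (endo Q) x) \<cdot>\<^bsub>base R\<^esub> FAr (fst (T, A)) (comult Q x))"
      by (simp add: As)
    have n: "counit R (FOb T x) \<cdot>\<^bsub>base R\<^esub> FAr (endo R) ?n =
        ?n \<cdot>\<^bsub>base R\<^esub> counit R (FOb T (FOb (endo Q) x))"
      using R.counit.naturality [of ?n] by simp
    have "counit R (FOb T x) \<cdot>\<^bsub>base R\<^esub> A x = (?n \<cdot>\<^bsub>base R\<^esub> counit R (FOb T (FOb (endo Q) x))) \<cdot>\<^bsub>base R\<^esub>
        s (cofree Q x)"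
      unfolding A_def restrict_apply' [OF x] by (rule BR.Comp_extend [OF n]) auto
    then show "counit R (FOb (fst (T, A)) x) \<cdot>\<^bsub>base R\<^esub> snd (T, A) x = FAr (fst (T, A)) (counit Q x)"
      by (simp add: BR.Comp_assoc laws)
  qed (simp, unfold_locales)
  have "lift_functorU pr Q R (T, A) = S"
  proof (rule functor_to_CogU_eqI [OF co(2) is_functor_lift_functorU [OF f] S.is_functor_axioms])
    fix v assume "v \<in> Obj (CogU pr Q)"
    then obtain X where X: "v = pr X" "X \<in> coalgebras Q" using co by auto
    show "FOb (lift_functorU pr Q R (T, A)) v = FOb S v"
      using X S_obj(2) [OF X(2)] A_coaction [OF X(2)] by
          (simp add: lift_functorU_simps [OF f] prod_eq_iff)
  next
    fix v assume v: "v \<in> Arr (CogU pr Q)"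
    have "FAr (forgetfulU pr R) (FAr (lift_functorU pr Q R (T, A)) v) =
        FAr T (FAr (forgetfulU pr Q) v)"
      using square_FAr [OF commuting_square_lift [OF f], of v] v by simp
    also have "\<dots> = FAr (forgetfulU pr R) (FAr S v)"
      using square_FAr [OF sq, of v] v by (simp add: h)
    finally show "FAr (forgetfulU pr R) (FAr (lift_functorU pr Q R (T, A)) v) =
        FAr (forgetfulU pr R) (FAr S v)" .
  qed
  then show ?thesis using that [OF f] by (simp add: h)
qed

text \<open>Fullness on 2-cells. The lifted component at the cofree coalgebra on \<open>x\<close> makes \<open>b = snd t\<close> at
  \<open>Q x\<close> a morphism of coalgebras; postcomposing that equation with the image of the counit and
  using the reconstruction of structure maps gives the 2-cell condition at \<open>x\<close>.\<close>

lemma lift_2cellU_surj: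
  assumes f: "oplax Q R f" and g: "oplax Q R g"
    and t: "t \<in> square_2cells (on_obj \<Phi> Q) (on_obj \<Phi> R) (lift_functorU pr Q R f, fst f)
        (lift_functorU pr Q R g, fst g)"
  shows "snd t \<in> comonad_2cells Q R f g" "t = (lift_2cellU pr Q R (Arrow f g (snd t)), snd t)"
proof -
  have co: "comonad Q" "comonad R" using oplax_comonads [OF f] .
  interpret BR: category "base R" by (rule comonad_category [OF co(2)])
  interpret f: oplax_comonad_functor Q R "fst f" "snd f" by fact
  interpret g: oplax_comonad_functor Q R "fst g" "snd g" by fact
  interpret a: nat_trans "CogU pr Q" "CogU pr R" "lift_functorU pr Q R f" "lift_functorU pr Q R g"
      "fst t"
    using t by (simp add: square_2cells_iff)
  interpret b: nat_trans "base Q" "base R" "fst f" "fst g" "snd t"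
    using t by (simp add: square_2cells_iff)
  have "FAr (endo R) (snd t x) \<cdot>\<^bsub>base R\<^esub> snd f x = snd g x \<cdot>\<^bsub>base R\<^esub> snd t (FOb (endo Q) x)"
    if x [simp]: "x \<in> Obj (base Q)" for x
  proof -
    define X where "X = cofree Q x"
    have X [simp]: "X \<in> coalgebras Q" "fst X = FOb (endo Q) x" by (simp_all add: X_def co)
    have "fst t (pr X) \<in> enc ` Arr (Cog R)" using a.component_Arr [of "pr X"] co by simp
    then obtain c where c: "c \<in> Arr (Cog R)" "fst t (pr X) = enc c" by auto
    have st: "src c = lift_obj R f X" "tgt c = lift_obj R g X"
      using a.Dom_component [of "pr X"] a.Cod_component [of "pr X"] c co f g by simp_all
    have "under c = snd t (FOb (endo Q) x)"
    proof -
      have "\<forall>Y\<in>coalgebras Q. snd t (fst Y) = FAr (forgetfulU pr R) (fst t (pr Y))"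
        using t co by (simp add: square_2cells_iff)
      from bspec [OF this X(1)] show ?thesis by (simp add: c co)
    qed
    then have m: "FAr (endo R) (snd t (FOb (endo Q) x)) \<cdot>\<^bsub>base R\<^esub> snd (lift_obj R f X) =
        snd (lift_obj R g X) \<cdot>\<^bsub>base R\<^esub> snd t (FOb (endo Q) x)"
      using Arr_Cog_commutes [OF c(1)] by (simp add: st)
    have l: "snd (lift_obj R f X) \<in> Arr (base R)"
        "Dom (base R) (snd (lift_obj R f X)) = FOb (fst f) (FOb (endo Q) x)"
      "Cod (base R) (snd (lift_obj R f X)) = FOb (endo R) (FOb (fst f) (FOb (endo Q) x))"
      "snd (lift_obj R g X) \<in> Arr (base R)" "Dom (base R) (snd (lift_obj R g X)) =
          FOb (fst g) (FOb (endo Q) x)"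
      "Cod (base R) (snd (lift_obj R g X)) = FOb (endo R) (FOb (fst g) (FOb (endo Q) x))"
      using coalgebrasD [OF lift_obj_in_coalgebras [OF f X(1)]]
          coalgebrasD [OF lift_obj_in_coalgebras [OF g X(1)]]
      by (simp_all del: snd_lift_obj)
    let ?n = "counit Q x"
    have n: "FAr (endo R) (snd t x) \<cdot>\<^bsub>base R\<^esub> FAr (endo R) (FAr (fst f) ?n) =
        FAr (endo R) (FAr (fst g) ?n) \<cdot>\<^bsub>base R\<^esub> FAr (endo R) (snd t (FOb (endo Q) x))"
    proof -
      have "snd t x \<cdot>\<^bsub>base R\<^esub> FAr (fst f) ?n = FAr (fst g) ?n \<cdot>\<^bsub>base R\<^esub> snd t (FOb (endo Q) x)"
        using b.naturality [of ?n] by simp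
      then have "FAr (endo R) (snd t x \<cdot>\<^bsub>base R\<^esub> FAr (fst f) ?n) =
          FAr (endo R) (FAr (fst g) ?n \<cdot>\<^bsub>base R\<^esub> snd t (FOb (endo Q) x))" by simp
      then show ?thesis by simp
    qed
    have "FAr (endo R) (snd t x) \<cdot>\<^bsub>base R\<^esub> snd f x =
        FAr (endo R) (snd t x) \<cdot>\<^bsub>base R\<^esub> (FAr (endo R) (FAr (fst f) ?n) \<cdot>\<^bsub>base R\<^esub> snd (lift_obj R f X))"
      unfolding X_def structure_map_from_cofree [OF f x, symmetric] ..
    also have "\<dots> = (FAr (endo R) (FAr (fst g) ?n) \<cdot>\<^bsub>base R\<^esub>
        FAr (endo R) (snd t (FOb (endo Q) x))) \<cdot>\<^bsub>base R\<^esub> snd (lift_obj R f X)"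
      by (rule BR.Comp_extend [OF n]) (auto simp: l simp del: snd_lift_obj)
    also have "\<dots> = FAr (endo R) (FAr (fst g) ?n) \<cdot>\<^bsub>base R\<^esub> (snd (lift_obj R g X) \<cdot>\<^bsub>base R\<^esub>
        snd t (FOb (endo Q) x))"
      by (simp add: BR.Comp_assoc l m del: snd_lift_obj)
    also have "\<dots> = (FAr (endo R) (FAr (fst g) ?n) \<cdot>\<^bsub>base R\<^esub> snd (lift_obj R g X)) \<cdot>\<^bsub>base R\<^esub>
        snd t (FOb (endo Q) x)"
      by (simp add: BR.Comp_assoc l del: snd_lift_obj)
    also have "\<dots> = snd g x \<cdot>\<^bsub>base R\<^esub> snd t (FOb (endo Q) x)"
      unfolding X_def structure_map_from_cofree [OF g x, symmetric] ..
    finally show ?thesis .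
  qed
  then show b: "snd t \<in> comonad_2cells Q R f g"
    using b.nat_trans_axioms by (simp add: comonad_2cells_iff)
  show "t = (lift_2cellU pr Q R (Arrow f g (snd t)), snd t)"
    by (rule square_2cells_eqI [OF co(2) functor_obj_image [OF co(1)] t
      lift_2cell_in_square_2cells [OF f g b]]) simp
qed

lemma strictly_fully_faithful_forgetful:
  "strictly_fully_faithful (Comonads small) (Functors small) \<Phi>"
  unfolding strictly_fully_faithful_def
proof (intro ballI)
  fix Q R :: "('u, 'u) comonad" assume "Q \<in> Ob2 (Comonads small)" "R \<in> Ob2 (Comonads small)"
  then have co: "comonad Q" "comonad R" by auto
  let ?H = "functors_hom (on_obj \<Phi> Q) (on_obj \<Phi> R)"
  interpret H: is_functor "comonad_hom Q R" ?H "on_hom \<Phi> Q R" by (rule is_functor_on_hom [OF co])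
  have inj: "f = g" if "oplax Q R f" "oplax Q R g"
      "FOb (on_hom \<Phi> Q R) f = FOb (on_hom \<Phi> Q R) g" for f g
    using that lift_functorU_inj [OF that(1,2)] by simp
  have "iso_of_categories (comonad_hom Q R) ?H (on_hom \<Phi> Q R)"
  proof (rule iso_of_categoriesI [OF H.is_functor_axioms]; unfold bij_betw_def; intro conjI)
    show "inj_on (FOb (on_hom \<Phi> Q R)) (Obj (comonad_hom Q R))"
      by (rule inj_onI) (use inj in simp)
    show "inj_on (FAr (on_hom \<Phi> Q R)) (Arr (comonad_hom Q R))"
    proof (rule inj_onI)
      fix a b assume ab: "a \<in> Arr (comonad_hom Q R)" "b \<in> Arr (comonad_hom Q R)"
        "FAr (on_hom \<Phi> Q R) a = FAr (on_hom \<Phi> Q R) b"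
      have "oplax Q R (src a)" "oplax Q R (tgt a)" "oplax Q R (src b)" "oplax Q R (tgt b)"
        using ab(1,2) by (cases a; cases b; simp)+
      then show "a = b" using ab inj [of "src a" "src b"] inj [of "tgt a" "tgt b"]
        by (intro arrow.expand) simp
    qed
    show "FOb (on_hom \<Phi> Q R) ` Obj (comonad_hom Q R) = Obj ?H"
    proof
      show "Obj ?H \<subseteq> FOb (on_hom \<Phi> Q R) ` Obj (comonad_hom Q R)"
      proof
        fix h assume "h \<in> Obj ?H"
        then obtain f where "oplax Q R f" "h = (lift_functorU pr Q R f, fst f)"
          using lift_functorU_surj [OF co, of h] by auto
        then show "h \<in> FOb (on_hom \<Phi> Q R) ` Obj (comonad_hom Q R)"
          by (intro image_eqI [of _ _ f]) simp_all
      qed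
    qed (use H.FOb_Obj in blast)
    show "FAr (on_hom \<Phi> Q R) ` Arr (comonad_hom Q R) = Arr ?H"
    proof
      show "Arr ?H \<subseteq> FAr (on_hom \<Phi> Q R) ` Arr (comonad_hom Q R)"
      proof
        fix c assume c: "c \<in> Arr ?H"
        obtain h k t where c': "c = Arrow h k t" by (cases c)
        obtain f where f: "oplax Q R f" "h = (lift_functorU pr Q R f, fst f)"
          using lift_functorU_surj [OF co, of h] c by (auto simp: c')
        obtain g where g: "oplax Q R g" "k = (lift_functorU pr Q R g, fst g)"
          using lift_functorU_surj [OF co, of k] c by (auto simp: c')
        have t: "snd t \<in> comonad_2cells Q R f g"
            "t = (lift_2cellU pr Q R (Arrow f g (snd t)), snd t)"
          using lift_2cellU_surj [OF f(1) g(1), of t] c by (simp_all add: c' f(2) g(2))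
        show "c \<in> FAr (on_hom \<Phi> Q R) ` Arr (comonad_hom Q R)"
          by (rule image_eqI [of _ _ "Arrow f g (snd t)"]) (use f g t in \<open>simp_all add: c'\<close>)
      qed
    qed (use H.FAr_Arr in blast)
  qed
  then show "iso_of_categories (Hom2 (Comonads small) Q R)
      (Hom2 (Functors small) (on_obj \<Phi> Q) (on_obj \<Phi> R)) (on_hom \<Phi> Q R)" by simp
qed

section \<open>Preservation of products\<close>

text \<open>A coaction on an object of the product is a pair of coactions on its projections, since the
  coalgebra equations, and likewise the equation for morphisms, hold exactly when both projections
  satisfy them.\<close>

lemma product_cone_CogU:
  assumes co: "comonad P" "comonad Q" "comonad R"
    and p: "strict_comonad_functor P Q p" and q: "strict_comonad_functor P R q"
    and cone: "product_cone (base P) (base Q) (base R) p q"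
  shows "product_cone (CogU pr P) (CogU pr Q) (CogU pr R)
    (lift_functorU pr P Q (strict_1cell P Q p)) (lift_functorU pr P R (strict_1cell P R q))"
    (is "product_cone _ _ _ ?p ?q")
proof -
  interpret cone: product_cone "base P" "base Q" "base R" p q by fact
  interpret P: comonad P by fact
  interpret Q: comonad Q by fact
  interpret R: comonad R by fact
  have str: "FAr p (comult P x) = comult Q (FOb p x)" "FAr q (comult P x) = comult R (FOb q x)"
    "FAr p (counit P x) = counit Q (FOb p x)" "FAr q (counit P x) = counit R (FOb q x)"
    if "x \<in> Obj (base P)" for x
    using that p q by (simp_all add: strict_comonad_functor_def)
  note str = str strict_comonad_functor_FOb [OF p] strict_comonad_functor_FOb [OF q]
    strict_comonad_functor_FAr [OF p] strict_comonad_functor_FAr [OF q]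
  have op: "oplax P Q (strict_1cell P Q p)" and oq: "oplax P R (strict_1cell P R q)"
    by (rule oplax_strict_1cell; fact)+
  have lp: "lift_obj Q (strict_1cell P Q p) X = (FOb p (fst X), FAr p (snd X))"
    and lq: "lift_obj R (strict_1cell P R q) X = (FOb q (fst X), FAr q (snd X))" if X:
        "X \<in> coalgebras P" for X
    using coalgebrasD [OF X] by (simp_all add: prod_eq_iff strict_1cell_def str)
  have fs: "fst (strict_1cell P Q p) = p" "fst (strict_1cell P R q) = q" by
      (simp_all add: strict_1cell_def)
  have pX: "(FOb p (fst X), FAr p (snd X)) \<in> coalgebras Q"
      "(FOb q (fst X), FAr q (snd X)) \<in> coalgebras R"
    if X: "X \<in> coalgebras P" for X
    using lift_obj_in_coalgebras [OF op X] lift_obj_in_coalgebras [OF oq X] by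
        (simp_all add: lp lq X)
  have p_obj: "FOb ?p (pr X) = pr (FOb p (fst X), FAr p (snd X))"
    and q_obj: "FOb ?q (pr X) = pr (FOb q (fst X), FAr q (snd X))" if X: "X \<in> coalgebras P" for X
    using lift_functorU_simps(1) [OF op X] lift_functorU_simps(1) [OF oq X] lp lq X by simp_all
  have p_arr: "FAr ?p (enc a) =
      enc (Arrow (FOb p (fst (src a)), FAr p (snd (src a))) (FOb p (fst (tgt a)), FAr p (snd (tgt
          a))) (FAr p (under a)))"
    and q_arr: "FAr ?q (enc a) =
        enc (Arrow (FOb q (fst (src a)), FAr q (snd (src a))) (FOb q (fst (tgt a)), FAr q (snd
            (tgt a))) (FAr q (under a)))"
    if a: "a \<in> Arr (Cog P)" for a
    using lift_functorU_simps(2) [OF op a] lift_functorU_simps(2) [OF oq a] Arr_CogD(1,2) [OF a]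
    by (simp_all add: lp lq fs)
  have obj_inj: "X = Y" if X: "X \<in> coalgebras P" and Y: "Y \<in> coalgebras P"
    and eq: "FOb p (fst X) = FOb p (fst Y)" "FAr p (snd X) = FAr p (snd Y)"
      "FOb q (fst X) = FOb q (fst Y)" "FAr q (snd X) = FAr q (snd Y)" for X Y
  proof -
    have "fst X = fst Y" by (rule cone.Obj_eqI) (simp_all add: X Y eq)
    moreover have "snd X = snd Y" by (rule cone.Arr_eqI) (simp_all add: X Y eq)
    ultimately show ?thesis by (simp add: prod_eq_iff)
  qed
  have obj_surj: "\<exists>X\<in>coalgebras P. (FOb p (fst X), FAr p (snd X)) = Y \<and>
      (FOb q (fst X), FAr q (snd X)) = Z"
    if Y: "Y \<in> coalgebras Q" and Z: "Z \<in> coalgebras R" for Y Z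
  proof -
    note [simp] = coalgebrasD [OF Y] coalgebrasD [OF Z]
    obtain V where V: "V \<in> Obj (base P)" "FOb p V = fst Y" "FOb q V = fst Z"
      by (rule cone.Obj_exists [of "fst Y" "fst Z"]) simp_all
    obtain k where k: "k \<in> Arr (base P)" "FAr p k = snd Y" "FAr q k = snd Z"
      by (rule cone.Arr_exists [of "snd Y" "snd Z"]) simp_all
    have D: "Dom (base P) k = V"
      by (rule cone.Obj_eqI) (simp_all add: V k flip: cone.p.Dom_FAr cone.q.Dom_FAr)
    have C: "Cod (base P) k = FOb (endo P) V"
      by (rule cone.Obj_eqI) (simp_all add: V k str flip: cone.p.Cod_FAr cone.q.Cod_FAr)
    have "comult P V \<cdot>\<^bsub>base P\<^esub> k = FAr (endo P) k \<cdot>\<^bsub>base P\<^esub> k"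
      by (rule cone.Arr_eqI) (simp_all add: V k D C str coalgebra_laws [OF Y] coalgebra_laws [OF Z])
    moreover have "counit P V \<cdot>\<^bsub>base P\<^esub> k = Idn (base P) V"
      by (rule cone.Arr_eqI) (simp_all add: V k D C str coalgebra_laws [OF Y] coalgebra_laws [OF Z])
    ultimately have "(V, k) \<in> coalgebras P"
      by (intro coalgebras_iff [THEN iffD2]) (simp add: V k D C)
    then show ?thesis by (rule bexI [rotated]) (simp add: V k)
  qed
  show ?thesis
  proof (intro product_cone.intro product_cone_axioms.intro)
    show "is_functor (CogU pr P) (CogU pr Q) ?p" "is_functor (CogU pr P) (CogU pr R) ?q"
      by (rule is_functor_lift_functorU; fact)+
    show "bij_betw (\<lambda>x. (FOb ?p x, FOb ?q x)) (Obj (CogU pr P)) (Obj (CogU pr Q) \<times> Obj (CogU pr R))"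
      unfolding bij_betw_def
    proof
      show "inj_on (\<lambda>x. (FOb ?p x, FOb ?q x)) (Obj (CogU pr P))"
      proof (rule inj_onI)
        fix x y assume "x \<in> Obj (CogU pr P)" "y \<in> Obj (CogU pr P)" and eq:
            "(FOb ?p x, FOb ?q x) = (FOb ?p y, FOb ?q y)"
        then obtain X Y where X: "X \<in> coalgebras P" "x = pr X" and Y: "Y \<in> coalgebras P" "y = pr Y"
          using co by auto
        have "X = Y" by (rule obj_inj [OF X(1) Y(1)]) (use eq X Y in \<open>simp_all add: p_obj q_obj\<close>)
        then show "x = y" using X Y by simp
      qed
      show "(\<lambda>x. (FOb ?p x, FOb ?q x)) ` Obj (CogU pr P) = Obj (CogU pr Q) \<times> Obj (CogU pr R)"
      proof
        show "(\<lambda>x. (FOb ?p x, FOb ?q x)) ` Obj (CogU pr P) \<subseteq> Obj (CogU pr Q) \<times> Obj (CogU pr R)"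
          using pX by (auto simp: co p_obj q_obj)
        show "Obj (CogU pr Q) \<times> Obj (CogU pr R) \<subseteq> (\<lambda>x. (FOb ?p x, FOb ?q x)) ` Obj (CogU pr P)"
        proof (clarsimp simp: co)
          fix a b c d assume "(a, b) \<in> coalgebras Q" "(c, d) \<in> coalgebras R"
          from obj_surj [OF this] obtain X where X: "X \<in> coalgebras P"
            "(FOb p (fst X), FAr p (snd X)) = (a, b)" "(FOb q (fst X), FAr q (snd X)) = (c, d)"
                by blast
          then show "(pr (a, b), pr (c, d)) \<in> (\<lambda>x. (FOb ?p x, FOb ?q x)) ` pr ` coalgebras P"
            by (intro image_eqI [of _ _ "pr X"]) (simp_all add: p_obj q_obj)
        qed
      qed
    qed
    show "bij_betw (\<lambda>x. (FAr ?p x, FAr ?q x)) (Arr (CogU pr P)) (Arr (CogU pr Q) \<times> Arr (CogU pr R))"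
      unfolding bij_betw_def
    proof
      show "inj_on (\<lambda>x. (FAr ?p x, FAr ?q x)) (Arr (CogU pr P))"
      proof (rule inj_onI)
        fix x y assume "x \<in> Arr (CogU pr P)" "y \<in> Arr (CogU pr P)" and eq:
            "(FAr ?p x, FAr ?q x) = (FAr ?p y, FAr ?q y)"
        then obtain a b where a: "a \<in> Arr (Cog P)" "x = enc a" and b: "b \<in> Arr (Cog P)" "y = enc b"
          using co by auto
        have e: "src a = src b" "tgt a = tgt b"
          using eq a b by (auto simp: p_arr q_arr intro: obj_inj)
        moreover have "under a = under b"
          by (rule cone.Arr_eqI) (use eq a b in \<open>simp_all add: p_arr q_arr\<close>)
        ultimately show "x = y" using a b by (simp add: arrow.expand)
      qed
      show "(\<lambda>x. (FAr ?p x, FAr ?q x)) ` Arr (CogU pr P) = Arr (CogU pr Q) \<times> Arr (CogU pr R)"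
      proof
        show "(\<lambda>x. (FAr ?p x, FAr ?q x)) ` Arr (CogU pr P) \<subseteq> Arr (CogU pr Q) \<times> Arr (CogU pr R)"
          using is_functor.FAr_Arr [OF is_functor_lift_functorU [OF op]]
            is_functor.FAr_Arr [OF is_functor_lift_functorU [OF oq]] by blast
        show "Arr (CogU pr Q) \<times> Arr (CogU pr R) \<subseteq> (\<lambda>x. (FAr ?p x, FAr ?q x)) ` Arr (CogU pr P)"
        proof
          fix z assume "z \<in> Arr (CogU pr Q) \<times> Arr (CogU pr R)"
          then obtain a b where z: "z = (enc a, enc b)" and a: "a \<in> Arr (Cog Q)" and b:
              "b \<in> Arr (Cog R)"
            using co by auto
          note [simp] = Arr_CogD [OF a] Arr_CogD [OF b]
          obtain X where X: "X \<in> coalgebras P" "(FOb p (fst X), FAr p (snd X)) = src a"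
              "(FOb q (fst X), FAr q (snd X)) = src b"
            using obj_surj [of "src a" "src b"] by auto
          obtain Y where Y: "Y \<in> coalgebras P" "(FOb p (fst Y), FAr p (snd Y)) = tgt a"
              "(FOb q (fst Y), FAr q (snd Y)) = tgt b"
            using obj_surj [of "tgt a" "tgt b"] by auto
          obtain f where f: "f \<in> Arr (base P)" "FAr p f = under a" "FAr q f = under b"
            by (rule cone.Arr_exists [of "under a" "under b"]) simp_all
          note [simp] = coalgebrasD [OF X(1)] coalgebrasD [OF Y(1)]
          have XY: "FOb p (fst X) = fst (src a)" "FAr p (snd X) = snd (src a)"
              "FOb q (fst X) = fst (src b)" "FAr q (snd X) = snd (src b)"
            "FOb p (fst Y) = fst (tgt a)" "FAr p (snd Y) = snd (tgt a)"
                "FOb q (fst Y) = fst (tgt b)" "FAr q (snd Y) = snd (tgt b)"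
            by (simp_all flip: X(2,3) Y(2,3))
          have D: "Dom (base P) f = fst X"
            by (rule cone.Obj_eqI) (simp_all add: f XY flip: cone.p.Dom_FAr cone.q.Dom_FAr)
          have C: "Cod (base P) f = fst Y"
            by (rule cone.Obj_eqI) (simp_all add: f XY flip: cone.p.Cod_FAr cone.q.Cod_FAr)
          have "FAr (endo P) f \<cdot>\<^bsub>base P\<^esub> snd X = snd Y \<cdot>\<^bsub>base P\<^esub> f"
            by (rule cone.Arr_eqI)
              (simp_all add: f D C XY str Arr_Cog_commutes [OF a] Arr_Cog_commutes [OF b])
          then have c: "Arrow X Y f \<in> Arr (Cog P)" by (simp add: X(1) Y(1) f(1) D C)
          have "FAr ?p (enc (Arrow X Y f)) = enc a" "FAr ?q (enc (Arrow X Y f)) = enc b"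
            using p_arr [OF c] q_arr [OF c] by (simp_all add: X(2,3) Y(2,3) f(2,3))
          then show "z \<in> (\<lambda>x. (FAr ?p x, FAr ?q x)) ` Arr (CogU pr P)"
            using c by (intro image_eqI [of _ _ "enc (Arrow X Y f)"])
                (simp_all add: z co del: Arrow_in_Cog)
        qed
      qed
    qed
  qed
qed

text \<open>The only candidate for a coalgebra is the cofree one, since there is just one object and one
  morphism to choose from.\<close>

lemma terminal_category_CogU:
  assumes co: "comonad Q" and t: "terminal_category (base Q)"
  shows "terminal_category (CogU pr Q)"
proof -
  interpret Q: comonad Q by fact
  obtain x f where x: "Obj (base Q) = {x}" and f: "Arr (base Q) = {f}"
    using t by (auto simp: terminal_category_def)
  note eq = terminal_arrow [OF t]
  have X: "cofree Q x \<in> coalgebras Q" using co x by simp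
  have ob: "Y = cofree Q x" if Y: "Y \<in> coalgebras Q" for Y
  proof -
    have "fst Y = fst (cofree Q x)" using coalgebrasD(1) [OF Y] coalgebrasD(1) [OF X] x by simp
    moreover have "snd Y = snd (cofree Q x)"
        by (rule eq [OF coalgebrasD(2) [OF Y] coalgebrasD(2) [OF X]])
    ultimately show ?thesis by (simp add: prod_eq_iff)
  qed
  have I: "Idn (Cog Q) (cofree Q x) \<in> Arr (Cog Q)"
    by (rule category.Idn_Arr [OF category_Cog [OF co]]) (use X in simp)
  have ar: "a = Idn (Cog Q) (cofree Q x)" if a: "a \<in> Arr (Cog Q)" for a
  proof (rule arrow.expand)
    have "src a = cofree Q x" "tgt a = cofree Q x" using ob Arr_CogD(1,2) [OF a] by blast+
    moreover have "under a = under (Idn (Cog Q) (cofree Q x))"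
      by (rule eq [OF Arr_CogD(3) [OF a] Arr_CogD(3) [OF I]])
    ultimately show "src a = src (Idn (Cog Q) (cofree Q x)) \<and> tgt a =
        tgt (Idn (Cog Q) (cofree Q x)) \<and>
      under a = under (Idn (Cog Q) (cofree Q x))" using X by simp
  qed
  have "coalgebras Q = {cofree Q x}" "Arr (Cog Q) = {Idn (Cog Q) (cofree Q x)}"
    using ob X ar I by blast+
  then have "Obj (CogU pr Q) = {pr (cofree Q x)}"
      "Arr (CogU pr Q) = {enc (Idn (Cog Q) (cofree Q x))}"
    using co by simp_all
  then show ?thesis using category_CogU [OF co] by (auto simp: terminal_category_def)
qed

lemma Comonads_product_preserved:
  assumes Q: "Q \<in> Ob2 (Comonads small)" and R: "R \<in> Ob2 (Comonads small)"
  shows "\<exists>P p q. strict_product (Comonads small) Q R P p q \<and>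
    strict_product (Functors small) (on_obj \<Phi> Q) (on_obj \<Phi> R) (on_obj \<Phi> P)
      (FOb (on_hom \<Phi> P Q) p) (FOb (on_hom \<Phi> P R) q)"
proof -
  obtain P p q where P: "P \<in> Ob2 (Comonads small)" and p: "strict_comonad_functor P Q p"
    and q: "strict_comonad_functor P R q" and cone: "product_cone (base P) (base Q) (base R) p q"
    using Comonads_product_cone_exists [OF Q R] .
  have co: "comonad P" "comonad Q" "comonad R" using P Q R by auto
  let ?p = "strict_1cell P Q p" and ?q = "strict_1cell P R q"
  have op: "oplax P Q ?p" and oq: "oplax P R ?q"
    by (rule oplax_strict_1cell; fact)+
  have fs: "fst ?p = p" "fst ?q = q" by (simp_all add: strict_1cell_def)
  have "strict_product (Functors small) (on_obj \<Phi> Q) (on_obj \<Phi> R) (on_obj \<Phi> P)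
      (lift_functorU pr P Q ?p, fst ?p) (lift_functorU pr P R ?q, fst ?q)"
    using on_obj_in_Functors [OF Q] on_obj_in_Functors [OF R] on_obj_in_Functors [OF P]
      commuting_square_lift [OF op] commuting_square_lift [OF oq]
    by (rule strict_product_Functors) (simp_all add: product_cone_CogU co p q cone fs)
  then show ?thesis
    using strict_product_Comonads [OF Q R P p q cone] op oq on_hom_simps(1) by metis
qed

lemma Comonads_final_preserved:
  "\<exists>T. strict_final (Comonads small) T \<and> strict_final (Functors small) (on_obj \<Phi> T)"
proof -
  obtain C :: "('u, 'u) category" where C: "small_category small C" "terminal_category C"
    using small_terminal_category .
  let ?T = "identity_comonad C"
  have base: "base ?T = C" by (simp add: identity_comonad_def)
  have T: "?T \<in> Ob2 (Comonads small)"
    using C by (simp add: base small_category_def comonad_identity_comonad)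
  have "strict_final (Comonads small) ?T"
    by (rule strict_final_Comonads [OF T]) (simp add: base C)
  moreover have "strict_final (Functors small) (on_obj \<Phi> ?T)"
    using T C by (intro strict_final_Functors on_obj_in_Functors)
        (simp_all add: base terminal_category_CogU)
  ultimately show ?thesis by blast
qed

end

theorem theorem3:
  fixes small :: "'u set \<Rightarrow> bool" and pr :: "'u \<times> 'u \<Rightarrow> 'u"
  assumes "universe small pr"
  shows "is_two_functor (Comonads small) (Functors small) (forgetful_2functor pr) \<and>
    strictly_fully_faithful (Comonads small) (Functors small) (forgetful_2functor pr) \<and>
    has_strict_finite_products (Comonads small) \<and>
    has_strict_finite_products (Functors small) \<and>
    preserves_strict_finite_products (Comonads small) (Functors small) (forgetful_2functor pr)"
proof -
  interpret universe small pr by fact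
  have "has_strict_finite_products (Comonads small)"
    unfolding has_strict_finite_products_def
    using Comonads_product_preserved Comonads_final_preserved by blast
  moreover have "preserves_strict_finite_products (Comonads small) (Functors small)
      (forgetful_2functor pr)"
    by (rule is_two_functor.preserves_strict_finite_productsI [OF is_two_functor_forgetful
          Comonads_product_preserved Comonads_final_preserved])
  ultimately show ?thesis
    using is_two_functor_forgetful strictly_fully_faithful_forgetful
      has_strict_finite_products_Functors by blast
qed

end
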